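(* Let $M=M(N)$ be a sequence of positive integers with $\lim_{N\to\infty}M(N)/N=\alpha\ge 1$. For each $N$ let $\mathcal W_N$ be an $N\times M(N)$ random matrix with independent identically distributed real entries of mean $0$ and variance $1$, whose common law does not depend on $N$ and satisfies $\mathbf E|\mathcal W_N(1,1)|^k<\infty$ for all $k=1,2,3,\dots$. Let $Y_N=\mathcal W_N\mathcal W_N^t$, and let $\hat Y_N$ be the $(N-1)\times(N-1)$ matrix obtained from $Y_N$ by removing the $N$th row and column. Let $w_N^Y:\mathbb R\to\mathbb R$ be the (random) rectangular Young diagram $w^{\{x_i\},\{y_j\}}$ constructed from the eigenvalues $\{x_i\}_{i=1}^N$ of $Y_N$ and the eigenvalues $\{y_j\}_{j=1}^{N-1}$ of $\hat Y_N$. Let $\Omega_\alpha:\mathbb R\to\mathbb R$ be the unique continuous function such that $$\Omega_\alpha''(x)=\frac{x+(\alpha-1)}{\pi x\sqrt{4\alpha-(x-(\alpha+1))^2}},\qquad x\in\big((\alpha+1)-2\sqrt\alpha,\ (\alpha+1)+2\sqrt\alpha\big),$$ and $$\Omega_\alpha(x)=|x-\alpha|,\qquad x\in\big(-\infty,(\alpha+1)-2\sqrt\alpha\big]\cup\big[(\alpha+1)+2\sqrt\alpha,\infty\big).$$ Then $$\lim_{N\to\infty}\ \sup_{x\in\mathbb R}\left|\frac1N\,w_N^Y(xN)-\Omega_\alpha(x)\right|=0\qquad\text{in probability.}$$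
   Context: Two real sequences $\{x_i\}_{i=1}^n$, $\{y_j\}_{j=1}^{n-1}$ interlace if $x_1\ge y_1\ge x_2\ge\dots\ge x_{n-1}\ge y_{n-1}\ge x_n$. The eigenvalues (listed in decreasing order with multiplicity) of a real symmetric $n\times n$ matrix and of its submatrix obtained by deleting the last row and column interlace. Put $z_0=\sum_{i=1}^n x_i-\sum_{j=1}^{n-1}y_j$. The rectangular Young diagram $w^{\{x_i\},\{y_j\}}:\mathbb R\to\mathbb R$ is the function uniquely determined by: (1) it is continuous and piecewise linear, with derivative $\pm1$ except at finitely many points, which are exactly its local extrema; (2) its local minima are at the points $x_i$, its local maxima are at the points $y_j$, and there are no other local extrema; (3) $w^{\{x_i\},\{y_j\}}(x)=|x-z_0|$ when $|x|$ is large enough. Equivalently (and this is the meaning when some $x_i$ and $y_j$ coincide), $w^{\{x_i\},\{y_j\}}(x)=\sum_{i=1}^n|x-x_i|-\sum_{j=1}^{n-1}|x-y_j|$. *)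

theory Defs
  imports "HOL-Probability.Probability" "Jordan_Normal_Form.Char_Poly"
begin

text \<open>
  The eigenvalues of a real symmetric matrix, with multiplicity. All roots of its characteristic
  polynomial are real, so no eigenvalue is lost by taking the real roots only.
\<close>

definition eigenvalues_mset :: "real mat \<Rightarrow> real multiset" where
  "eigenvalues_mset A = proots (char_poly A)"

text \<open>
  The closed formula is used as the definition of the rectangular Young diagram because it also
  covers the case in which some minimum \<open>x\<^sub>i\<close> and some maximum \<open>y\<^sub>j\<close> coincide. The diagram does not
  depend on the order of the sequences, which are therefore represented as multisets.
\<close>

definition rect_diagram :: "real multiset \<Rightarrow> real multiset \<Rightarrow> real \<Rightarrow> real" where
  "rect_diagram X Y x = (\<Sum>a\<in>#X. \<bar>x - a\<bar>) - (\<Sum>b\<in>#Y. \<bar>x - b\<bar>)"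

definition is_Omega :: "real \<Rightarrow> (real \<Rightarrow> real) \<Rightarrow> bool" where
  "is_Omega \<alpha> \<Omega> \<longleftrightarrow>
     continuous_on UNIV \<Omega> \<and>
     (\<exists>\<Omega>'. \<forall>x\<in>{(\<alpha> + 1) - 2 * sqrt \<alpha> <..< (\<alpha> + 1) + 2 * sqrt \<alpha>}.
        (\<Omega> has_real_derivative \<Omega>' x) (at x) \<and>
        (\<Omega>' has_real_derivative
           (x + (\<alpha> - 1)) / (pi * x * sqrt (4 * \<alpha> - (x - (\<alpha> + 1))\<^sup>2))) (at x)) \<and>
     (\<forall>x\<in>{..(\<alpha> + 1) - 2 * sqrt \<alpha>} \<union> {(\<alpha> + 1) + 2 * sqrt \<alpha>..}. \<Omega> x = \<bar>x - \<alpha>\<bar>)"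

definition Omega :: "real \<Rightarrow> real \<Rightarrow> real" where
  "Omega \<alpha> = (THE \<Omega>. is_Omega \<alpha> \<Omega>)"

text \<open>
  Convergence in probability to a constant; the probability space may vary with the index.
  Measurability is part of the definition because \<^const>\<open>measure\<close> is \<open>0\<close> on non-measurable sets.
  It is required only eventually, so that finitely many degenerate indices do not matter.
\<close>

definition tendsto_in_prob ::
    "(nat \<Rightarrow> 'a measure) \<Rightarrow> (nat \<Rightarrow> 'a \<Rightarrow> real) \<Rightarrow> real \<Rightarrow> bool" where
  "tendsto_in_prob P X c \<longleftrightarrow>
     (\<forall>\<^sub>F n in sequentially. X n \<in> borel_measurable (P n)) \<and>
     (\<forall>\<epsilon>>0. (\<lambda>n. measure (P n) {\<omega>\<in>space (P n). \<bar>X n \<omega> - c\<bar> > \<epsilon>}) \<longlonglongrightarrow> 0)"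

text \<open>The function \<^const>\<open>Omega\<close> is well defined.\<close>

lemma is_Omega_unique:
  assumes \<alpha>: "\<alpha> \<ge> 1" and F: "is_Omega \<alpha> F" and G: "is_Omega \<alpha> G"
  shows "F = G"
proof
  fix x
  define a where "a = (\<alpha> + 1) - 2 * sqrt \<alpha>"
  define b where "b = (\<alpha> + 1) + 2 * sqrt \<alpha>"
  have ab: "a < b" using \<alpha> by (simp add: a_def b_def)
  define f where "f = (\<lambda>x. (x + (\<alpha> - 1)) / (pi * x * sqrt (4 * \<alpha> - (x - (\<alpha> + 1))\<^sup>2)))"
  obtain F' where F': "\<And>x. a < x \<Longrightarrow> x < b \<Longrightarrow> (F has_real_derivative F' x) (at x)"
      "\<And>x. a < x \<Longrightarrow> x < b \<Longrightarrow> (F' has_real_derivative f x) (at x)"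
    using F[unfolded is_Omega_def, folded a_def b_def]
    unfolding f_def by (meson greaterThanLessThan_iff)
  obtain G' where G': "\<And>x. a < x \<Longrightarrow> x < b \<Longrightarrow> (G has_real_derivative G' x) (at x)"
      "\<And>x. a < x \<Longrightarrow> x < b \<Longrightarrow> (G' has_real_derivative f x) (at x)"
    using G[unfolded is_Omega_def, folded a_def b_def]
    unfolding f_def by (meson greaterThanLessThan_iff)
  have out: "F x = G x" if "x \<le> a \<or> b \<le> x" for x
    using F G that unfolding is_Omega_def a_def b_def by auto
  define H where "H = (\<lambda>x. F x - G x)"
  have cH: "continuous_on {u..v} H" for u v
    using F G unfolding H_def is_Omega_def
    by (intro continuous_intros) (auto intro: continuous_on_subset)
  have dH: "(H has_real_derivative (F' x - G' x)) (at x)" if "a < x" "x < b" for x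
    unfolding H_def using F' G' that by (auto intro!: derivative_eq_intros)
  have diff: "H differentiable (at x)" if "a < x" "x < b" for x
    using dH[OF that] real_differentiable_def by blast
  have d2: "((\<lambda>x. F' x - G' x) has_real_derivative 0) (at x)" if "a < x" "x < b" for x
    using F' G' that by (auto intro!: derivative_eq_intros)
  show "F x = G x"
  proof (cases "a < x \<and> x < b")
    case False
    then show ?thesis using out by force
  next
    case True
    have "\<exists>l z. a < z \<and> z < x \<and> (H has_real_derivative l) (at z) \<and> H x - H a = (x - a) * l"
      using True cH diff by (intro MVT) auto
    then obtain l z where z: "a < z" "z < x" "(H has_real_derivative l) (at z)"
      "H x - H a = (x - a) * l" by blast
    have "\<exists>m w. x < w \<and> w < b \<and> (H has_real_derivative m) (at w) \<and> H b - H x = (b - x) * m"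
      using True cH diff by (intro MVT) auto
    then obtain m w where w: "x < w" "w < b" "(H has_real_derivative m) (at w)"
      "H b - H x = (b - x) * m" by blast
    have l: "l = F' z - G' z" using DERIV_unique[OF z(3) dH[of z]] z(1,2) True by simp
    have m: "m = F' w - G' w" using DERIV_unique[OF w(3) dH[of w]] w(1,2) True by simp
    have "(\<lambda>x. F' x - G' x) w = (\<lambda>x. F' x - G' x) z"
    proof (rule DERIV_isconst_end[where f = "\<lambda>x. F' x - G' x"])
      show "z < w" using z w by simp
      show "continuous_on {z..w} (\<lambda>x. F' x - G' x)"
        using d2 z w by (intro DERIV_continuous_on[where D = "\<lambda>_. 0"])
          (auto intro: has_field_derivative_at_within)
      show "\<And>x. z < x \<Longrightarrow> x < w \<Longrightarrow> ((\<lambda>x. F' x - G' x) has_real_derivative 0) (at x)"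
        using d2 z w by auto
    qed
    then have "l = m" using l m by simp
    moreover have "H a = 0" "H b = 0" using out by (auto simp: H_def)
    ultimately have Hx: "H x = (x - a) * l" "- H x = (b - x) * l" using z(4) w(4) by simp_all
    have "(b - a) * l = (x - a) * l + (b - x) * l" by (simp add: algebra_simps)
    also have "\<dots> = 0" unfolding Hx[symmetric] by simp
    finally have "l = 0" using ab by simp
    then show ?thesis using Hx(1) by (simp add: H_def)
  qed
qed

lemma is_Omega_exists:
  assumes \<alpha>: "\<alpha> \<ge> 1"
  shows "\<exists>\<Omega>. is_Omega \<alpha> \<Omega>"
proof -
  define a where "a = (\<alpha> + 1) - 2 * sqrt \<alpha>"
  define b where "b = (\<alpha> + 1) + 2 * sqrt \<alpha>"
  define f where "f = (\<lambda>x. (x + (\<alpha> - 1)) / (pi * x * sqrt (4 * \<alpha> - (x - (\<alpha> + 1))\<^sup>2)))"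
  define v where "v = (\<lambda>x. (x - (\<alpha> + 1)) / (2 * sqrt \<alpha>))"
  define u where "u = (\<lambda>x. ((\<alpha> + 1) * x - (\<alpha> - 1)\<^sup>2) / (2 * sqrt \<alpha> * x))"
  define R where "R = (\<lambda>x. 4 * \<alpha> - (x - (\<alpha> + 1))\<^sup>2)"
  define g where "g = (\<lambda>x. (arcsin (v x) + (if \<alpha> = 1 then 0 else arcsin (u x))) / pi)"
  have ab: "a < b" using \<alpha> by (simp add: a_def b_def)
  have s2: "(sqrt \<alpha>)\<^sup>2 = \<alpha>" and s0: "sqrt \<alpha> > 0" using \<alpha> by auto
  have a_eq: "a = (sqrt \<alpha> - 1)\<^sup>2"
    using \<alpha> by (simp add: a_def power2_eq_square algebra_simps)
  have a0: "a \<ge> 0" by (simp add: a_eq)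
  have a1: "a > 0" if "\<alpha> \<noteq> 1" using that \<alpha> by (simp add: a_eq)
  have R_eq: "R x = (x - a) * (b - x)" for x
    using s2 unfolding R_def a_def b_def by (simp add: power2_eq_square algebra_simps)
  have Rp: "R x > 0" if "a < x" "x < b" for x using that by (simp add: R_eq)
  have R0: "R x \<ge> 0" if "a \<le> x" "x \<le> b" for x using that by (simp add: R_eq)
  have v1: "1 - (v x)\<^sup>2 = R x / (4 * \<alpha>)" for x
    using s2 \<alpha> unfolding v_def R_def by (simp add: power_divide power_mult_distrib field_simps)
  have u1: "1 - (u x)\<^sup>2 = (\<alpha> - 1)\<^sup>2 * R x / (4 * \<alpha> * x\<^sup>2)" if "x \<noteq> 0" for x
  proof -
    have "1 - (u x)\<^sup>2 = (4 * \<alpha> * x\<^sup>2 - ((\<alpha> + 1) * x - (\<alpha> - 1)\<^sup>2)\<^sup>2) / (4 * \<alpha> * x\<^sup>2)"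
      using s2 \<alpha> that unfolding u_def by (simp add: power_divide power_mult_distrib field_simps)
    also have "4 * \<alpha> * x\<^sup>2 - ((\<alpha> + 1) * x - (\<alpha> - 1)\<^sup>2)\<^sup>2 = (\<alpha> - 1)\<^sup>2 * R x"
      unfolding R_def by (simp add: power2_eq_square algebra_simps)
    finally show ?thesis .
  qed
  have vb: "-1 \<le> v x \<and> v x \<le> 1" if "a \<le> x" "x \<le> b" for x
  proof -
    have "1 - (v x)\<^sup>2 \<ge> 0" using v1[of x] R0[OF that] \<alpha> by simp
    then have "(v x)\<^sup>2 \<le> 1" by simp
    then show ?thesis using abs_square_le_1[of "v x"] by (auto simp: abs_le_iff)
  qed
  have ub: "-1 \<le> u x \<and> u x \<le> 1" if "a \<le> x" "x \<le> b" "x \<noteq> 0" for x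
  proof -
    have "1 - (u x)\<^sup>2 \<ge> 0" using u1[OF that(3)] R0[OF that(1,2)] \<alpha> by simp
    then have "(u x)\<^sup>2 \<le> 1" by simp
    then show ?thesis using abs_square_le_1[of "u x"] by (auto simp: abs_le_iff)
  qed
  have strict: "-1 < y \<and> y < 1" if "1 - y\<^sup>2 > 0" for y :: real
    using that abs_square_less_1[of y] by (auto simp: abs_less_iff)
  have cv: "continuous_on {a..b} (\<lambda>x. arcsin (v x))"
    using vb s0 unfolding v_def by (intro continuous_on_arcsin continuous_intros) auto
  have cu: "continuous_on {a..b} (\<lambda>x. arcsin (u x))" if "\<alpha> \<noteq> 1"
    using ub s0 a1[OF that] \<alpha> unfolding u_def
    by (intro continuous_on_arcsin continuous_intros) auto
  have cg: "continuous_on {a..b} g"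
    unfolding g_def using cv cu by (cases "\<alpha> = 1") (auto intro!: continuous_intros)
  have dv: "((\<lambda>x. arcsin (v x)) has_real_derivative 1 / sqrt (R x)) (at x)"
    if "a < x" "x < b" for x
  proof -
    have p: "1 - (v x)\<^sup>2 > 0" using v1[of x] Rp[OF that] \<alpha> by simp
    have "(v has_real_derivative 1 / (2 * sqrt \<alpha>)) (at x)"
      unfolding v_def by (rule DERIV_cdivide) (auto intro!: derivative_eq_intros)
    then have "((\<lambda>x. arcsin (v x)) has_real_derivative
        inverse (sqrt (1 - (v x)\<^sup>2)) * (1 / (2 * sqrt \<alpha>))) (at x)"
      using strict[OF p] by (intro DERIV_chain2[OF DERIV_arcsin]) auto
    also have "inverse (sqrt (1 - (v x)\<^sup>2)) * (1 / (2 * sqrt \<alpha>)) = 1 / sqrt (R x)"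
      using s0 by (simp add: v1 real_sqrt_divide real_sqrt_mult)
    finally show ?thesis .
  qed
  have du: "((\<lambda>x. arcsin (u x)) has_real_derivative (\<alpha> - 1) / (x * sqrt (R x))) (at x)"
    if "a < x" "x < b" "\<alpha> \<noteq> 1" for x
  proof -
    have x0: "x > 0" using a1 that by fastforce
    have p: "1 - (u x)\<^sup>2 > 0" using u1[of x] x0 Rp[OF that(1,2)] \<alpha> that(3) by simp
    have "(u has_real_derivative (\<alpha> - 1)\<^sup>2 / (2 * sqrt \<alpha> * x\<^sup>2)) (at x)"
      unfolding u_def using x0 s0
      by (auto intro!: derivative_eq_intros simp: divide_simps power2_eq_square)
        (simp add: algebra_simps)
    then have "((\<lambda>x. arcsin (u x)) has_real_derivative
        inverse (sqrt (1 - (u x)\<^sup>2)) * ((\<alpha> - 1)\<^sup>2 / (2 * sqrt \<alpha> * x\<^sup>2))) (at x)"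
      using strict[OF p] by (intro DERIV_chain2[OF DERIV_arcsin]) auto
    also have "sqrt (1 - (u x)\<^sup>2) = (\<alpha> - 1) * sqrt (R x) / (2 * sqrt \<alpha> * x)"
      using x0 \<alpha> u1[of x] by (simp add: real_sqrt_divide real_sqrt_mult)
    also have "inverse ((\<alpha> - 1) * sqrt (R x) / (2 * sqrt \<alpha> * x)) * ((\<alpha> - 1)\<^sup>2 / (2 * sqrt \<alpha> * x\<^sup>2))
        = (\<alpha> - 1) / (x * sqrt (R x))"
      using x0 s0 that(3) Rp[OF that(1,2)] by (simp add: field_simps power2_eq_square)
    finally show ?thesis .
  qed
  have dg: "(g has_real_derivative f x) (at x)" if "a < x" "x < b" for x
  proof (cases "\<alpha> = 1")
    case True
    have "x > 0" using a0 that by simp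
    have "(g has_real_derivative (1 / sqrt (R x)) / pi) (at x)"
      unfolding g_def using True DERIV_cdivide[OF dv[OF that], of pi] by simp
    also have "(1 / sqrt (R x)) / pi = f x"
      using True \<open>x > 0\<close> by (simp add: f_def R_def)
    finally show ?thesis .
  next
    case False
    have x: "x > 0" using a0 that by simp
    have "(g has_real_derivative (1 / sqrt (R x) + (\<alpha> - 1) / (x * sqrt (R x))) / pi) (at x)"
      unfolding g_def
      using False DERIV_cdivide[OF DERIV_add[OF dv[OF that] du[OF that False]], of pi] by simp
    also have "(1 / sqrt (R x) + (\<alpha> - 1) / (x * sqrt (R x))) / pi = f x"
    proof -
      have "f x = (x + (\<alpha> - 1)) / (pi * x * sqrt (R x))" by (simp add: f_def R_def)
      then show ?thesis using x Rp[OF that] by (simp add: field_simps)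
    qed
    finally show ?thesis .
  qed
  define h where "h = (\<lambda>x. integral {a..x} g)"
  have dh: "(h has_real_derivative g x) (at x within {a..b})" if "x \<in> {a..b}" for x
    unfolding h_def using integral_has_real_derivative[OF cg that] .
  have ch: "continuous_on {a..b} h"
    using dh by (rule DERIV_continuous_on)
  have ha: "h a = 0" by (simp add: h_def)
  define B where "B = (\<bar>b - \<alpha>\<bar> - \<bar>a - \<alpha>\<bar> - h b) / (b - a)"
  define k where "k = (\<lambda>x. h x + \<bar>a - \<alpha>\<bar> + B * (x - a))"
  define \<Omega> where "\<Omega> = (\<lambda>x. if x \<in> {a..b} then k x else \<bar>x - \<alpha>\<bar>)"
  have ka: "k a = \<bar>a - \<alpha>\<bar>" by (simp add: k_def ha)
  have kb: "k b = \<bar>b - \<alpha>\<bar>" using ab by (simp add: k_def B_def)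
  have ck: "continuous_on {a..b} k"
    unfolding k_def by (intro continuous_intros ch)
  have "continuous_on ({a..b} \<union> ({..a} \<union> {b..})) \<Omega>"
    unfolding \<Omega>_def
  proof (rule continuous_on_cases[OF _ _ ck])
    show "continuous_on ({..a} \<union> {b..}) (\<lambda>x. \<bar>x - \<alpha>\<bar>)" by (intro continuous_intros)
    show "\<forall>x. x \<in> {a..b} \<and> x \<notin> {a..b} \<or> x \<in> {..a} \<union> {b..} \<and> x \<in> {a..b} \<longrightarrow> k x = \<bar>x - \<alpha>\<bar>"
    proof (intro allI impI)
      fix x assume "x \<in> {a..b} \<and> x \<notin> {a..b} \<or> x \<in> {..a} \<union> {b..} \<and> x \<in> {a..b}"
      then have "x = a \<or> x = b" by auto
      then show "k x = \<bar>x - \<alpha>\<bar>" using ka kb by blast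
    qed
  qed (intro closed_Un closed_atLeastAtMost closed_atMost closed_atLeast)+
  also have "{a..b} \<union> ({..a} \<union> {b..}) = UNIV" by auto
  finally have c\<Omega>: "continuous_on UNIV \<Omega>" .
  have d\<Omega>: "(\<Omega> has_real_derivative g x + B) (at x)" if "a < x" "x < b" for x
  proof -
    have "(h has_real_derivative g x) (at x within {a<..<b})"
      using dh[of x] that by (auto intro: DERIV_subset)
    then have "(h has_real_derivative g x) (at x)"
      using that by (simp add: at_within_open[of x "{a<..<b}"])
    then have "(k has_real_derivative g x + B) (at x)"
      unfolding k_def by (auto intro!: derivative_eq_intros)
    then show ?thesis
      by (rule has_field_derivative_transform_within_open[where S = "{a<..<b}"])
        (use that in \<open>auto simp: \<Omega>_def\<close>)
  qed
  have dg': "((\<lambda>x. g x + B) has_real_derivative f x) (at x)" if "a < x" "x < b" for x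
    using dg[OF that] by (auto intro!: derivative_eq_intros)
  have out: "\<Omega> x = \<bar>x - \<alpha>\<bar>" if "x \<in> {..a} \<union> {b..}" for x
    using that ka kb ab by (cases "x = a \<or> x = b") (auto simp: \<Omega>_def)
  have "is_Omega \<alpha> \<Omega>"
    unfolding is_Omega_def a_def[symmetric] b_def[symmetric]
  proof (intro conjI exI[of _ "\<lambda>x. g x + B"] ballI)
    fix x assume x: "x \<in> {a<..<b}"
    show "(\<Omega> has_real_derivative g x + B) (at x)" using d\<Omega> x by auto
    show "((\<lambda>x. g x + B) has_real_derivative
        (x + (\<alpha> - 1)) / (pi * x * sqrt (4 * \<alpha> - (x - (\<alpha> + 1))\<^sup>2))) (at x)"
      using dg' x by (auto simp: f_def)
  qed (use c\<Omega> out in auto)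
  then show ?thesis by blast
qed

lemma is_Omega_Omega: "\<alpha> \<ge> 1 \<Longrightarrow> is_Omega \<alpha> (Omega \<alpha>)"
  unfolding Omega_def by (metis is_Omega_exists is_Omega_unique theI)

end

theory Submission
  imports Defs "HOL-Real_Asymp.Real_Asymp"
begin

text \<open>
  The proof replaces the diagram by a density. Let \<open>x\<^sub>i\<close> and \<open>y\<^sub>j\<close> be the eigenvalues of \<open>Y / N\<close> and of
  its corner, all of them nonnegative, and let \<open>H x\<close> be the number of \<open>x\<^sub>i > x\<close> minus the number of
  \<open>y\<^sub>j > x\<close>. Interlacing says exactly that \<open>H\<close> takes values in \<open>[0, 1]\<close>, and for \<open>x \<ge> 0\<close> the rescaled
  diagram equals \<open>z\<^sub>0 + x - 2 * (integral of H over [0, x])\<close>, where \<open>z\<^sub>0\<close> is the total mass of \<open>H\<close>.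
  The limit shape \<open>\<Omega>\<^sub>\<alpha>\<close> has the same form, with a density of mass \<open>\<alpha>\<close>. Hence it suffices that the
  distribution functions of these densities converge uniformly. Because a density bounded by \<open>1\<close> has
  a distribution function with Lipschitz constant \<open>1\<close>, this follows from convergence of the total
  mass and of the Stieltjes transforms at all \<open>s > 0\<close> (\<open>stieltjes_continuity\<close>).

  The Stieltjes transform of \<open>H\<close> is a resolvent quantity. Its value at \<open>s\<close> is the logarithm of
  \<open>det (s + Y/N) / (s * det (s + Y'/N))\<close>, where \<open>Y'\<close> is the corner, and by the adjugate formula this
  ratio is \<open>1 + \<tau>\<^sub>N\<close>, where \<open>\<tau>\<^sub>i = r\<^sub>i \<bullet> Q\<^sub>i r\<^sub>i / N\<close>, \<open>r\<^sub>i\<close> is the \<open>i\<close>-th row of the data matrix and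
  \<open>Q\<^sub>i\<close> is the inverse of \<open>s + W\<^sup>t W / N\<close> with the \<open>i\<close>-th row of \<open>W\<close> replaced by zero (\<open>kernel_gram\<close>).
  The row \<open>r\<^sub>i\<close> is independent of \<open>Q\<^sub>i\<close>, and so \<open>\<tau>\<^sub>i\<close> is close to \<open>tr Q\<^sub>i / N\<close> in mean square
  (\<open>leave_one_form_deviation\<close>); a rank one perturbation moves the trace by at most \<open>1/s\<close>, so \<open>\<tau>\<^sub>i\<close> is
  close to \<open>t = tr Q / N\<close>, where \<open>Q\<close> is the full inverse. Finally there is the exact identity
  that the mean of \<open>1 / (1 + \<tau>\<^sub>i)\<close> over \<open>i\<close> is \<open>1 - M/N + s t\<close>
  (\<open>resolvent_self_consistent\<close>). It forces \<open>t\<close>, hence also \<open>\<tau>\<^sub>N\<close>, to converge to the positive root of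
  \<open>1 / (1 + t) = s t - (\<alpha> - 1)\<close>. The identity holds for every matrix and the equation is stable, which
  takes the place of a concentration estimate for \<open>t\<close>.

  Two facts are obtained without a spectral theorem. Interlacing comes from the ratio
  of the two characteristic polynomials, a corner entry of a resolvent, which maps the upper
  half-plane to the lower one: its argument is a sum of arctangents trapped in \<open>(-\<pi>, 0)\<close>,
  and the limit of this sum at the real axis counts eigenvalues. The measurability of the supremum holds
  because the integrals of \<open>H\<close> over intervals are limits of linear combinations of values of its
  Stieltjes transform, and these are logarithms of rational functions of the matrix entries.

  The limit density is explicit, essentially a sum of two arccosines; that its Stieltjes transform is
  \<open>ln (1 + t)\<close> is checked by differentiating in \<open>s\<close> (\<open>limit_stieltjes\<close>).
\<close>

section \<open>Characteristic polynomials of real symmetric matrices\<close>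

lemma poly_char_poly_eq_det:
  fixes A :: "'a :: field mat"
  assumes A: "A \<in> carrier_mat n n"
  shows "poly (char_poly A) z = det (mat n n (\<lambda>(i, j). (if i = j then z else 0) - A $$ (i, j)))"
  unfolding char_poly_def
  by (rule poly_det_cong[of _ n]) (use A in \<open>auto simp: char_poly_matrix_def\<close>)

text \<open>
  This is \<open>\<langle>v, (z - A) v\<rangle>\<close>: the contribution of \<open>A\<close> is a real number, so the imaginary part comes from
  \<open>z\<close> alone. Both the realness of eigenvalues and the sign of the resolvent entry below rest on it.
\<close>

lemma Im_symmetric_form:
  fixes A :: "real mat" and v :: "nat \<Rightarrow> complex"
  assumes sym: "\<And>i j. i < n \<Longrightarrow> j < n \<Longrightarrow> A $$ (i, j) = A $$ (j, i)"
  shows "Im (\<Sum>i<n. cnj (v i) * (z * v i - (\<Sum>j<n. of_real (A $$ (i, j)) * v j)))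
           = Im z * (\<Sum>i<n. (cmod (v i))\<^sup>2)"
proof -
  define q where "q = (\<Sum>i<n. \<Sum>j<n. cnj (v i) * of_real (A $$ (i, j)) * v j)"
  have "cnj q = (\<Sum>i<n. \<Sum>j<n. v i * of_real (A $$ (i, j)) * cnj (v j))"
    by (simp add: q_def)
  also have "\<dots> = (\<Sum>j<n. \<Sum>i<n. v i * of_real (A $$ (i, j)) * cnj (v j))"
    by (rule sum.swap)
  also have "\<dots> = q"
    unfolding q_def by (intro sum.cong refl) (auto simp: sym mult_ac)
  finally have "Im q = 0" by (metis complex_cnj_cancel_iff complex_eq_iff cnj.sel(2) neg_equal_zero)
  have "(\<Sum>i<n. cnj (v i) * (z * v i - (\<Sum>j<n. of_real (A $$ (i, j)) * v j)))
      = z * (\<Sum>i<n. of_real ((cmod (v i))\<^sup>2)) - q"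
    unfolding q_def sum_distrib_left sum_subtractf[symmetric]
    by (intro sum.cong refl)
       (simp add: right_diff_distrib sum_distrib_left complex_norm_square mult_ac del: of_real_power)
  also have "Im \<dots> = Im z * (\<Sum>i<n. (cmod (v i))\<^sup>2)"
    using \<open>Im q = 0\<close> unfolding of_real_sum[symmetric] by simp
  finally show ?thesis .
qed

definition char_val :: "real mat \<Rightarrow> complex \<Rightarrow> complex" where
  "char_val A z = poly (map_poly of_real (char_poly A)) z"

lemma char_val_eq_det:
  assumes A: "A \<in> carrier_mat n n"
  shows "char_val A z = det (mat n n (\<lambda>(i, j). (if i = j then z else 0) - of_real (A $$ (i, j))))"
proof -
  have "char_val A z = poly (char_poly (map_mat of_real A)) z"
    unfolding char_val_def by (subst of_real_hom.char_poly_hom[OF A]) simp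
  also have "\<dots> = det (mat n n (\<lambda>(i, j). (if i = j then z else 0) - map_mat of_real A $$ (i, j)))"
    by (rule poly_char_poly_eq_det) (use A in auto)
  also have "mat n n (\<lambda>(i, j). (if i = j then z else 0) - map_mat of_real A $$ (i, j)) =
       mat n n (\<lambda>(i, j). (if i = j then z else 0) - of_real (A $$ (i, j)) :: complex)"
    using A by auto
  finally show ?thesis .
qed

lemma char_val_nonzero:
  assumes A: "A \<in> carrier_mat n n"
    and sym: "\<And>i j. i < n \<Longrightarrow> j < n \<Longrightarrow> A $$ (i, j) = A $$ (j, i)"
    and z: "Im z \<noteq> 0"
  shows "char_val A z \<noteq> 0"
proof
  let ?Z = "mat n n (\<lambda>(i, j). (if i = j then z else 0) - of_real (A $$ (i, j)))"
  assume "char_val A z = 0"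
  then have "det ?Z = 0" using char_val_eq_det[OF A] by simp
  then obtain v where v: "v \<in> carrier_vec n" "v \<noteq> 0\<^sub>v n" "?Z *\<^sub>v v = 0\<^sub>v n"
    using det_0_iff_vec_prod_zero[of ?Z n] by auto
  have row: "z * v $ i - (\<Sum>j<n. of_real (A $$ (i, j)) * v $ j) = 0" if i: "i < n" for i
  proof -
    have "0 = (?Z *\<^sub>v v) $ i" using v(3) i by simp
    also have "\<dots> = (\<Sum>j<n. ((if i = j then z else 0) - of_real (A $$ (i, j))) * v $ j)"
      using i v(1) by (simp add: scalar_prod_def atLeast0LessThan)
    also have "\<dots> = (\<Sum>j<n. (if i = j then z * v $ j else 0)) - (\<Sum>j<n. of_real (A $$ (i, j)) * v $ j)"
      unfolding sum_subtractf[symmetric] by (intro sum.cong) (auto simp: algebra_simps)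
    also have "(\<Sum>j<n. (if i = j then z * v $ j else 0)) = z * v $ i" using i by simp
    finally show ?thesis by simp
  qed
  have "0 = Im z * (\<Sum>i<n. (cmod (v $ i))\<^sup>2)"
    using Im_symmetric_form[of n A "\<lambda>i. v $ i" z, OF sym] row by simp
  then have "(\<Sum>i<n. (cmod (v $ i))\<^sup>2) = 0" using z by simp
  then have "\<forall>i<n. v $ i = 0" by (subst (asm) sum_nonneg_eq_0_iff) auto
  then show False using v(1,2) by (metis carrier_vecD eq_vecI index_zero_vec)
qed

text \<open>
  The ratio is the last diagonal entry of \<open>(z - A)\<^sup>-\<^sup>1\<close>. If \<open>v\<close> is the last column of this inverse, then
  \<open>\<langle>v, (z - A) v\<rangle>\<close> is the conjugate of that entry, and its imaginary part is \<open>Im z\<close> times \<open>|v|\<^sup>2\<close>.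
\<close>

lemma Im_resolvent_corner_neg:
  assumes A: "A \<in> carrier_mat n n" and n: "n \<ge> 1"
    and sym: "\<And>i j. i < n \<Longrightarrow> j < n \<Longrightarrow> A $$ (i, j) = A $$ (j, i)"
    and z: "Im z > 0"
  shows "Im (char_val (mat_delete A (n - 1) (n - 1)) z / char_val A z) < 0"
proof -
  let ?Z = "mat n n (\<lambda>(i, j). (if i = j then z else 0) - of_real (A $$ (i, j)))"
  let ?p = "char_val A z" and ?p' = "char_val (mat_delete A (n - 1) (n - 1)) z"
  have Z: "?Z \<in> carrier_mat n n" by simp
  have p0: "?p \<noteq> 0" using char_val_nonzero[OF A sym] z by simp
  have pd: "det ?Z = ?p" using char_val_eq_det[OF A] by simp
  have del: "mat_delete A (n - 1) (n - 1) \<in> carrier_mat (n - 1) (n - 1)"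
    using mat_delete_carrier[of A n n] A by (simp add: mat_delete_def)
  have "?p' = det (mat_delete ?Z (n - 1) (n - 1))"
    unfolding char_val_eq_det[OF del]
    by (rule arg_cong[of _ _ det], rule eq_matI) (use A n in \<open>auto simp: mat_delete_def\<close>)
  then have corner: "adj_mat ?Z $$ (n - 1, n - 1) = ?p'"
    using n by (simp add: adj_mat_def cofactor_def)
  define v where "v = (\<lambda>i. adj_mat ?Z $$ (i, n - 1) / ?p)"
  have row: "z * v i - (\<Sum>j<n. of_real (A $$ (i, j)) * v j) = (if i = n - 1 then 1 else 0)"
    if i: "i < n" for i
  proof -
    have "(if i = n - 1 then ?p else 0) = (?Z * adj_mat ?Z) $$ (i, n - 1)"
      unfolding adj_mat(2)[OF Z] pd using i n by simp
    also have "\<dots> = (\<Sum>j<n. ((if i = j then z else 0) - of_real (A $$ (i, j))) * adj_mat ?Z $$ (j, n - 1))"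
      using i n adj_mat(1)[OF Z] by (simp add: scalar_prod_def atLeast0LessThan)
    also have "\<dots> = (\<Sum>j<n. ((if i = j then z else 0) - of_real (A $$ (i, j))) * v j) * ?p"
      unfolding sum_distrib_right using p0 by (intro sum.cong) (auto simp: v_def)
    also have "(\<Sum>j<n. ((if i = j then z else 0) - of_real (A $$ (i, j))) * v j)
       = (\<Sum>j<n. (if i = j then z * v j else 0)) - (\<Sum>j<n. of_real (A $$ (i, j)) * v j)"
      unfolding sum_subtractf[symmetric] by (intro sum.cong) (auto simp: algebra_simps)
    also have "(\<Sum>j<n. (if i = j then z * v j else 0)) = z * v i" using i by simp
    finally show ?thesis using p0 by (auto split: if_splits)
  qed
  have "(\<Sum>i<n. cnj (v i) * (z * v i - (\<Sum>j<n. of_real (A $$ (i, j)) * v j)))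
      = (\<Sum>i<n. if i = n - 1 then cnj (v i) else 0)"
    by (intro sum.cong) (auto simp: row)
  also have "\<dots> = cnj (v (n - 1))" using n by simp
  finally have "Im (cnj (v (n - 1))) = Im z * (\<Sum>i<n. (cmod (v i))\<^sup>2)"
    using Im_symmetric_form[of n A v z, OF sym] by simp
  moreover have "(\<Sum>i<n. (cmod (v i))\<^sup>2) > 0"
  proof (rule ccontr)
    assume "\<not> ?thesis"
    moreover have "(\<Sum>i<n. (cmod (v i))\<^sup>2) \<ge> 0" by (intro sum_nonneg) auto
    ultimately have "(\<Sum>i<n. (cmod (v i))\<^sup>2) = 0" by linarith
    then have "\<forall>i<n. v i = 0" by (subst (asm) sum_nonneg_eq_0_iff) auto
    then show False using row[of "n - 1"] n by simp
  qed
  ultimately have "Im (v (n - 1)) < 0" using mult_pos_pos[OF z] by fastforce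
  then show ?thesis by (simp only: v_def corner)
qed

text \<open>
  The complex roots of the characteristic polynomial are real by \<open>char_val_nonzero\<close>, so the
  factorization over the complex numbers descends to the real numbers.
\<close>

lemma symmetric_char_poly_splits:
  assumes A: "A \<in> carrier_mat n n"
    and sym: "\<And>i j. i < n \<Longrightarrow> j < n \<Longrightarrow> A $$ (i, j) = A $$ (j, i)"
  shows "size (eigenvalues_mset A) = n"
    and "char_poly A = (\<Prod>a\<in>#eigenvalues_mset A. [:- a, 1:])"
proof -
  interpret poly_of_real: map_poly_inj_comm_ring_hom "of_real :: real \<Rightarrow> complex" ..
  obtain as where as: "char_poly (map_mat of_real A) = (\<Prod>a\<leftarrow>as. [:- a, 1 :: complex:])" "length as = n"
    using char_poly_factorized[of "map_mat of_real A" n] A by auto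
  have val: "char_val A z = (\<Prod>a\<leftarrow>as. z - a)" for z
    unfolding char_val_def of_real_hom.char_poly_hom[OF A, symmetric] as(1)
    by (induction as) (auto simp: algebra_simps)
  have real: "Im a = 0" if "a \<in> set as" for a
  proof (rule ccontr)
    assume "Im a \<noteq> 0"
    then have "char_val A a \<noteq> 0" using char_val_nonzero[OF A] sym by blast
    moreover have "char_val A a = 0" unfolding val using that by (simp add: prod_list_zero_iff)
    ultimately show False by simp
  qed
  define bs where "bs = map Re as"
  have as_bs: "as = map of_real bs"
    unfolding bs_def by (rule HOL.sym, subst map_map, rule map_idI) (auto simp: real complex_eq_iff)
  have "map_poly of_real (char_poly A) = map_poly complex_of_real (\<Prod>b\<leftarrow>bs. [:- b, 1:])"
    unfolding of_real_hom.char_poly_hom[OF A, symmetric] as(1) as_bs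
    by (simp add: poly_of_real.hom_prod_list o_def)
  then have cp: "char_poly A = (\<Prod>b\<leftarrow>bs. [:- b, 1:])"
    by (rule poly_of_real.injectivity)
  have nz: "(\<Prod>b\<leftarrow>cs. [:- b, 1:]) \<noteq> 0" for cs :: "real list"
    by (auto simp: prod_list_zero_iff)
  have "proots (\<Prod>b\<leftarrow>cs. [:- b, 1:]) = mset cs" for cs :: "real list"
  proof (induction cs)
    case (Cons c cs)
    have "proots ([:- c, 1:] * (\<Prod>b\<leftarrow>cs. [:- b, 1:])) = add_mset c (mset cs)"
      by (subst proots_mult) (use nz Cons in auto)
    then show ?case by simp
  qed simp
  then have ev: "eigenvalues_mset A = mset bs"
    unfolding eigenvalues_mset_def cp .
  show "size (eigenvalues_mset A) = n" using as(2) by (simp add: ev bs_def)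
  show "char_poly A = (\<Prod>a\<in>#eigenvalues_mset A. [:- a, 1:])"
    unfolding ev cp by (simp add: prod_mset_prod_list[symmetric])
qed

section \<open>Interlacing from the argument of a rational function\<close>

text \<open>
  The argument is written as \<open>\<pi>/2 - arctan\<close> so that it depends continuously on \<open>y > 0\<close> and lies in
  \<open>(0, \<pi>)\<close>.
\<close>

lemma complex_diff_polar:
  fixes x y a :: real
  assumes y: "y > 0"
  shows "Complex x y - of_real a =
    of_real (cmod (Complex x y - of_real a)) * cis (pi / 2 - arctan ((x - a) / y))"
proof -
  define t where "t = (x - a) / y"
  have xt: "x - a = y * t" using y by (simp add: t_def)
  have s: "sqrt (1 + t\<^sup>2) > 0" by (simp add: add_pos_nonneg)
  have eq: "Complex x y - of_real a = Complex (y * t) y" by (simp add: complex_eq_iff xt)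
  have nrm: "cmod (Complex (y * t) y) = y * sqrt (1 + t\<^sup>2)"
  proof -
    have "(y * t)\<^sup>2 + y\<^sup>2 = y\<^sup>2 * (1 + t\<^sup>2)" by (simp add: algebra_simps power_mult_distrib)
    then show ?thesis using y by (simp add: complex_norm real_sqrt_mult)
  qed
  have "cos (pi / 2 - arctan t) = t / sqrt (1 + t\<^sup>2)" "sin (pi / 2 - arctan t) = 1 / sqrt (1 + t\<^sup>2)"
    by (simp_all add: cos_diff sin_diff cos_arctan sin_arctan)
  then show ?thesis
    unfolding eq nrm t_def[symmetric] using s by (simp add: complex_eq_iff)
qed

lemma prod_mset_polar:
  fixes X :: "real multiset"
  assumes y: "y > 0"
  shows "\<exists>r>0. (\<Prod>a\<in>#X. Complex x y - of_real a) =
    of_real r * cis (\<Sum>a\<in>#X. pi / 2 - arctan ((x - a) / y))"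
proof (induction X)
  case empty
  then show ?case by (auto intro: exI[of _ 1])
next
  case (add a X)
  then obtain r where r: "r > 0" "(\<Prod>a\<in>#X. Complex x y - of_real a) =
    of_real r * cis (\<Sum>a\<in>#X. pi / 2 - arctan ((x - a) / y))" by blast
  have "cmod (Complex x y - of_real a) > 0" using y by (simp add: complex_eq_iff)
  then show ?case
    using r complex_diff_polar[OF y, of x a]
    by (intro exI[of _ "cmod (Complex x y - of_real a) * r"]) (simp add: cis_mult[symmetric] mult_ac)
qed

lemma tendsto_sum_mset:
  fixes f :: "'a \<Rightarrow> 'b \<Rightarrow> real"
  assumes "\<And>a. a \<in># X \<Longrightarrow> ((\<lambda>y. f a y) \<longlongrightarrow> l a) F"
  shows "((\<lambda>y. \<Sum>a\<in>#X. f a y) \<longlongrightarrow> (\<Sum>a\<in>#X. l a)) F"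
  using assms by (induction X) (auto intro!: tendsto_add)

lemma continuous_on_sum_mset:
  fixes f :: "'a \<Rightarrow> real \<Rightarrow> real"
  assumes "\<And>a. a \<in># X \<Longrightarrow> continuous_on S (f a)"
  shows "continuous_on S (\<lambda>y. \<Sum>a\<in>#X. f a y)"
  using assms by (induction X) (auto intro!: continuous_on_add)

text \<open>
  Near the real axis, the argument of \<open>z - a\<close> decides on which side of \<open>a\<close> the point lies.
\<close>

lemma arctan_tendsto_side:
  fixes c :: real
  assumes "c \<noteq> 0"
  shows "((\<lambda>y. pi / 2 - arctan (c / y)) \<longlongrightarrow> (if c < 0 then pi else 0)) (at_right 0)"
proof (cases "c > 0")
  case True
  have "filterlim (\<lambda>y. c / y) at_top (at_right 0)"
    using True by real_asymp
  then have "((\<lambda>y. arctan (c / y)) \<longlongrightarrow> pi / 2) (at_right 0)"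
    by (rule filterlim_compose[OF tendsto_arctan_at_top])
  from tendsto_diff[OF tendsto_const this, of "pi/2"] show ?thesis using True by simp
next
  case False
  then have c: "c < 0" using assms by simp
  have "filterlim (\<lambda>y. c / y) at_bot (at_right 0)"
    using c by real_asymp
  then have "((\<lambda>y. arctan (c / y)) \<longlongrightarrow> - (pi / 2)) (at_right 0)"
    by (rule filterlim_compose[OF tendsto_arctan_at_bot])
  from tendsto_diff[OF tendsto_const this, of "pi/2"] show ?thesis using c by simp
qed

lemma sum_mset_indicator:
  "(\<Sum>a\<in>#X. if Q a then c else 0) = (c :: real) * real (size (filter_mset Q X))"
  by (induction X) (auto simp: algebra_simps)

text \<open>
  The sine vanishes at \<open>0\<close> and at \<open>-\<pi>\<close>, so by the intermediate value theorem \<open>\<theta>\<close> cannot leave the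
  interval in which it lies near infinity.
\<close>

lemma no_crossing:
  fixes \<theta> :: "real \<Rightarrow> real"
  assumes cont: "continuous_on {0<..} \<theta>"
    and sin: "\<And>y. y > 0 \<Longrightarrow> sin (\<theta> y) < 0"
    and lim: "(\<theta> \<longlongrightarrow> - (pi / 2)) at_top"
    and y: "y > 0"
  shows "- pi < \<theta> y \<and> \<theta> y < 0"
proof -
  have "eventually (\<lambda>t. dist (\<theta> t) (- (pi / 2)) < pi / 4) at_top"
    using lim by (rule tendstoD) simp
  then obtain Y where Y: "\<And>t. t \<ge> Y \<Longrightarrow> dist (\<theta> t) (- (pi / 2)) < pi / 4"
    by (auto simp: eventually_at_top_linorder)
  define u where "u = max y Y"
  have u: "u \<ge> y" "\<bar>\<theta> u + pi / 2\<bar> < pi / 4" using Y[of u] by (auto simp: u_def dist_real_def)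
  have u': "- pi < \<theta> u" "\<theta> u < 0" using u(2) pi_gt_zero unfolding abs_less_iff by linarith+
  have cont': "continuous_on {y..u} \<theta>" using cont y by (auto intro: continuous_on_subset)
  show ?thesis
  proof (rule ccontr)
    assume "\<not> ?thesis"
    then consider "\<theta> y \<ge> 0" | "\<theta> y \<le> - pi" by linarith
    then show False
    proof cases
      case 1
      then obtain t where "y \<le> t" "\<theta> t = 0"
        using IVT2'[of \<theta> u 0 y] u u' cont' by auto
      then show False using sin[of t] y by simp
    next
      case 2
      then obtain t where "y \<le> t" "\<theta> t = - pi"
        using IVT'[of \<theta> y "- pi" u] u u' cont' by auto
      then show False using sin[of t] y by simp
    qed
  qed
qed

text \<open>
  On the vertical line over \<open>x\<close>, the ratio of the two products has argument \<open>\<theta>\<close>, the difference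
  of the two sums of arguments. The hypothesis keeps \<open>\<theta>\<close> in \<open>(-\<pi>, 0)\<close>, and its limit at the real axis
  is \<open>\<pi>\<close> times the difference of the two counts. Multiplicities and common roots cause no case
  distinctions.
\<close>

lemma interlacing_counts:
  fixes X Y :: "real multiset"
  assumes size: "size X = size Y + 1"
    and neg: "\<And>z. Im z > 0 \<Longrightarrow> Im ((\<Prod>b\<in>#Y. z - of_real b) / (\<Prod>a\<in>#X. z - of_real a)) < 0"
  shows "size (filter_mset (\<lambda>b. x < b) Y) \<le> size (filter_mset (\<lambda>a. x < a) X)"
    and "size (filter_mset (\<lambda>a. x < a) X) \<le> size (filter_mset (\<lambda>b. x < b) Y) + 1"
proof -
  define S where "S = set_mset X \<union> set_mset Y"
  have finS: "finite S" by (simp add: S_def)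
  \<comment> \<open>The counts are continuous from the right, so \<open>x\<close> can be moved off all the roots.\<close>
  obtain x' where x': "x < x'" "\<And>a. a \<in> S \<Longrightarrow> x < a \<Longrightarrow> x' < a"
  proof (cases "{a \<in> S. x < a} = {}")
    case True
    then show ?thesis using that[of "x + 1"] by auto
  next
    case False
    have fin: "finite {a \<in> S. x < a}" using finS by simp
    have "x < Min {a \<in> S. x < a}" using False fin by (subst Min_gr_iff) auto
    then obtain m where m: "x < m" "m < Min {a \<in> S. x < a}" using dense by blast
    show ?thesis
      using m fin False by (intro that[of m]) (auto intro: less_le_trans[OF _ Min_le])
  qed
  have off: "x' \<noteq> a" if "a \<in> S" for a using x' that by (cases "x < a") fastforce+
  have filt: "filter_mset (\<lambda>a. x < a) Z = filter_mset (\<lambda>a. x' < a) Z" if "set_mset Z \<subseteq> S" for Z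
    using that x' by (intro filter_mset_cong) (auto dest: less_trans)
  define \<theta> where "\<theta> = (\<lambda>y. (\<Sum>b\<in>#Y. pi / 2 - arctan ((x' - b) / y)) - (\<Sum>a\<in>#X. pi / 2 - arctan ((x' - a) / y)))"
  have sin: "sin (\<theta> y) < 0" if y: "y > 0" for y
  proof -
    obtain r where r: "r > 0" "(\<Prod>a\<in>#X. Complex x' y - of_real a) =
      of_real r * cis (\<Sum>a\<in>#X. pi / 2 - arctan ((x' - a) / y))" using prod_mset_polar[OF y] by blast
    obtain s where s: "s > 0" "(\<Prod>b\<in>#Y. Complex x' y - of_real b) =
      of_real s * cis (\<Sum>b\<in>#Y. pi / 2 - arctan ((x' - b) / y))" using prod_mset_polar[OF y] by blast
    have "(\<Prod>b\<in>#Y. Complex x' y - of_real b) / (\<Prod>a\<in>#X. Complex x' y - of_real a)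
        = of_real (s / r) * cis (\<theta> y)"
      unfolding r(2) s(2) \<theta>_def by (simp add: cis_divide[symmetric])
    then have "(s / r) * sin (\<theta> y) < 0" using neg[of "Complex x' y"] y by simp
    then show ?thesis using r(1) s(1) by (simp add: mult_less_0_iff divide_less_0_iff)
  qed
  have cont: "continuous_on {0<..} \<theta>"
    unfolding \<theta>_def by (intro continuous_on_sum_mset continuous_intros) auto
  have "((\<lambda>y. pi / 2 - arctan ((x' - a) / y)) \<longlongrightarrow> pi / 2 - arctan 0) at_top" for a
    by (intro tendsto_intros tendsto_divide_0[OF tendsto_const] filterlim_at_top_imp_at_infinity filterlim_ident)
  then have "(\<theta> \<longlongrightarrow> (\<Sum>b\<in>#Y. pi / 2) - (\<Sum>a\<in>#X. pi / 2)) at_top"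
    unfolding \<theta>_def by (intro tendsto_diff tendsto_sum_mset) auto
  then have lim: "(\<theta> \<longlongrightarrow> - (pi / 2)) at_top"
    by (simp add: size field_simps)
  have range: "- pi < \<theta> y \<and> \<theta> y < 0" if "y > 0" for y
    using no_crossing[OF cont sin lim that] .
  have lim0: "(\<theta> \<longlongrightarrow> pi * real (size (filter_mset (\<lambda>b. x' < b) Y)) - pi * real (size (filter_mset (\<lambda>a. x' < a) X))) (at_right 0)"
    unfolding \<theta>_def sum_mset_indicator[symmetric]
  proof (intro tendsto_diff tendsto_sum_mset)
    fix a assume "a \<in># Y"
    then show "((\<lambda>y. pi / 2 - arctan ((x' - a) / y)) \<longlongrightarrow> (if x' < a then pi else 0)) (at_right 0)"
      using arctan_tendsto_side[of "x' - a"] off[of a] by (simp add: S_def)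
  next
    fix a assume "a \<in># X"
    then show "((\<lambda>y. pi / 2 - arctan ((x' - a) / y)) \<longlongrightarrow> (if x' < a then pi else 0)) (at_right 0)"
      using arctan_tendsto_side[of "x' - a"] off[of a] by (simp add: S_def)
  qed
  have ev: "eventually (\<lambda>y. - pi \<le> \<theta> y \<and> \<theta> y \<le> 0) (at_right 0)"
    using range by (auto simp: eventually_at_right_field intro!: exI[of _ 1] less_imp_le)
  have "pi * real (size (filter_mset (\<lambda>b. x' < b) Y)) - pi * real (size (filter_mset (\<lambda>a. x' < a) X)) \<le> 0"
    using ev by (intro tendsto_upperbound[OF lim0]) (auto elim: eventually_mono)
  then show "size (filter_mset (\<lambda>b. x < b) Y) \<le> size (filter_mset (\<lambda>a. x < a) X)"
    by (simp add: filt S_def)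
  have "pi * real (size (filter_mset (\<lambda>b. x' < b) Y)) - pi * real (size (filter_mset (\<lambda>a. x' < a) X)) \<ge> - pi"
    using ev by (intro tendsto_lowerbound[OF lim0]) (auto elim: eventually_mono)
  then have "pi * real (size (filter_mset (\<lambda>a. x' < a) X)) \<le> pi * (real (size (filter_mset (\<lambda>b. x' < b) Y)) + 1)"
    by (simp add: algebra_simps)
  then have "real (size (filter_mset (\<lambda>a. x' < a) X)) \<le> real (size (filter_mset (\<lambda>b. x' < b) Y)) + 1"
    by (simp only: mult_le_cancel_left_pos[OF pi_gt_zero])
  then show "size (filter_mset (\<lambda>a. x < a) X) \<le> size (filter_mset (\<lambda>b. x < b) Y) + 1"
    by (simp add: filt S_def)
qed

section \<open>Resolvents of sample covariance matrices\<close>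

text \<open>
  The matrix \<open>s + \<kappa> W\<^sup>t W\<close> for an \<open>n \<times> m\<close> matrix \<open>W\<close>. Data matrices are functions on pairs of
  indices here, so that rows can be removed without changing dimensions.
\<close>

definition reg_gram :: "real \<Rightarrow> real \<Rightarrow> (nat \<Rightarrow> nat \<Rightarrow> real) \<Rightarrow> nat \<Rightarrow> nat \<Rightarrow> real mat" where
  "reg_gram s \<kappa> W n m =
     mat m m (\<lambda>(j, k). (if j = k then s else 0) + \<kappa> * (\<Sum>i<n. W i j * W i k))"

text \<open>
  The entries of the inverse of \<^const>\<open>reg_gram\<close>. The adjugate formula makes it evident that they
  are measurable functions of the entries of \<open>W\<close>.
\<close>

definition resolvent :: "real \<Rightarrow> real \<Rightarrow> (nat \<Rightarrow> nat \<Rightarrow> real) \<Rightarrow> nat \<Rightarrow> nat \<Rightarrow> nat \<Rightarrow> nat \<Rightarrow> real" where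
  "resolvent s \<kappa> W n m j k = adj_mat (reg_gram s \<kappa> W n m) $$ (j, k) / det (reg_gram s \<kappa> W n m)"

text \<open>
  Replacing a row by zero has the same effect on \<open>W\<^sup>t W\<close> as deleting it, but keeps the index set.
\<close>

definition zero_row :: "nat \<Rightarrow> (nat \<Rightarrow> nat \<Rightarrow> real) \<Rightarrow> nat \<Rightarrow> nat \<Rightarrow> real" where
  "zero_row i W = (\<lambda>i' j. if i' = i then 0 else W i' j)"

lemma reg_gram_carrier: "reg_gram s \<kappa> W n m \<in> carrier_mat m m"
  by (simp add: reg_gram_def)

lemma reg_gram_apply:
  assumes "j < m"
  shows "(\<Sum>k<m. reg_gram s \<kappa> W n m $$ (j, k) * v k) =
    s * v j + \<kappa> * (\<Sum>i<n. W i j * (\<Sum>k<m. W i k * v k))"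
proof -
  have "(\<Sum>k<m. reg_gram s \<kappa> W n m $$ (j, k) * v k) =
      (\<Sum>k<m. (if j = k then s * v k else 0)) + (\<Sum>k<m. \<kappa> * (\<Sum>i<n. W i j * (W i k * v k)))"
    unfolding sum.distrib[symmetric] using assms
    by (intro sum.cong) (auto simp: reg_gram_def algebra_simps sum_distrib_right sum_distrib_left)
  also have "(\<Sum>k<m. (if j = k then s * v k else 0)) = s * v j" using assms by simp
  also have "(\<Sum>k<m. \<kappa> * (\<Sum>i<n. W i j * (W i k * v k))) = \<kappa> * (\<Sum>i<n. W i j * (\<Sum>k<m. W i k * v k))"
    unfolding sum_distrib_left by (rule sum.swap)
  finally show ?thesis .
qed

lemma reg_gram_form:
  "(\<Sum>j<m. v j * (\<Sum>k<m. reg_gram s \<kappa> W n m $$ (j, k) * v k)) =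
    s * (\<Sum>j<m. (v j)\<^sup>2) + \<kappa> * (\<Sum>i<n. (\<Sum>j<m. W i j * v j)\<^sup>2)"
proof -
  have "(\<Sum>j<m. v j * (\<Sum>k<m. reg_gram s \<kappa> W n m $$ (j, k) * v k)) =
      (\<Sum>j<m. s * (v j)\<^sup>2) + (\<Sum>j<m. \<kappa> * (\<Sum>i<n. (W i j * v j) * (\<Sum>k<m. W i k * v k)))"
    unfolding sum.distrib[symmetric]
    by (intro sum.cong refl, simp only: lessThan_iff reg_gram_apply)
       (simp add: power2_eq_square sum_distrib_left algebra_simps)
  also have "(\<Sum>j<m. \<kappa> * (\<Sum>i<n. (W i j * v j) * (\<Sum>k<m. W i k * v k))) =
      \<kappa> * (\<Sum>j<m. \<Sum>i<n. (W i j * v j) * (\<Sum>k<m. W i k * v k))" by (rule sum_distrib_left[symmetric])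
  also have "(\<Sum>j<m. \<Sum>i<n. (W i j * v j) * (\<Sum>k<m. W i k * v k))
      = (\<Sum>i<n. (\<Sum>j<m. W i j * v j)\<^sup>2)"
    by (subst sum.swap) (simp add: power2_eq_square sum_distrib_right)
  finally show ?thesis by (simp add: sum_distrib_left)
qed

lemma reg_gram_coercive:
  assumes "\<kappa> \<ge> 0"
  shows "s * (\<Sum>j<m. (v j)\<^sup>2) \<le> (\<Sum>j<m. v j * (\<Sum>k<m. reg_gram s \<kappa> W n m $$ (j, k) * v k))"
  unfolding reg_gram_form using assms by (simp add: sum_nonneg)

lemma det_reg_gram_nonzero:
  assumes s: "s > 0" and \<kappa>: "\<kappa> \<ge> 0"
  shows "det (reg_gram s \<kappa> W n m) \<noteq> 0"
proof
  let ?K = "reg_gram s \<kappa> W n m"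
  assume "det ?K = 0"
  then obtain v where v: "v \<in> carrier_vec m" "v \<noteq> 0\<^sub>v m" "?K *\<^sub>v v = 0\<^sub>v m"
    using det_0_iff_vec_prod_zero[OF reg_gram_carrier] by auto
  have row: "(\<Sum>k<m. ?K $$ (j, k) * vec_index v k) = 0" if j: "j < m" for j
  proof -
    have "0 = vec_index (?K *\<^sub>v v) j" using v(3) j by simp
    also have "\<dots> = (\<Sum>k<m. ?K $$ (j, k) * vec_index v k)"
      using j v(1) reg_gram_carrier[of s \<kappa> W n m] by (simp add: scalar_prod_def atLeast0LessThan)
    finally show ?thesis by simp
  qed
  have "s * (\<Sum>j<m. (vec_index v j)\<^sup>2) \<le> 0"
    using reg_gram_coercive[OF \<kappa>, where s = s and m = m and v = "vec_index v" and W = W and n = n] row by simp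
  moreover have "(\<Sum>j<m. (vec_index v j)\<^sup>2) \<ge> 0" by (intro sum_nonneg) auto
  ultimately have "(\<Sum>j<m. (vec_index v j)\<^sup>2) = 0" using s by (simp add: mult_le_0_iff)
  then have "\<forall>j<m. vec_index v j = 0" by (subst (asm) sum_nonneg_eq_0_iff) auto
  then show False using v(1,2) by (metis carrier_vecD eq_vecI index_zero_vec)
qed

context
  fixes s \<kappa> :: real and W :: "nat \<Rightarrow> nat \<Rightarrow> real" and n m :: nat
  assumes s: "s > 0" and \<kappa>: "\<kappa> \<ge> 0"
begin

abbreviation "reg_mat \<equiv> reg_gram s \<kappa> W n m"
abbreviation "res_mat \<equiv> resolvent s \<kappa> W n m"

lemma gram_adj_carrier: "adj_mat reg_mat \<in> carrier_mat m m"
  by (rule adj_mat(1)[OF reg_gram_carrier])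

lemma resolvent_right: "j < m \<Longrightarrow> l < m \<Longrightarrow> (\<Sum>k<m. reg_mat $$ (j, k) * res_mat k l) = (if j = l then 1 else 0)"
proof -
  assume jl: "j < m" "l < m"
  have "(reg_mat * adj_mat reg_mat) $$ (j, l) = (\<Sum>k<m. reg_mat $$ (j, k) * adj_mat reg_mat $$ (k, l))"
    using jl gram_adj_carrier reg_gram_carrier[of s \<kappa> W n m]
    by (simp add: scalar_prod_def atLeast0LessThan)
  also have "(reg_mat * adj_mat reg_mat) $$ (j, l) = (if j = l then det reg_mat else 0)"
    unfolding adj_mat(2)[OF reg_gram_carrier] using jl by simp
  finally have "(\<Sum>k<m. reg_mat $$ (j, k) * adj_mat reg_mat $$ (k, l)) = (if j = l then det reg_mat else 0)" ..
  moreover have "(\<Sum>k<m. reg_mat $$ (j, k) * res_mat k l) = (\<Sum>k<m. reg_mat $$ (j, k) * adj_mat reg_mat $$ (k, l)) / det reg_mat"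
    by (simp add: resolvent_def sum_divide_distrib)
  ultimately show ?thesis using det_reg_gram_nonzero[OF s \<kappa>] by simp
qed

lemma resolvent_left: "j < m \<Longrightarrow> l < m \<Longrightarrow> (\<Sum>k<m. res_mat j k * reg_mat $$ (k, l)) = (if j = l then 1 else 0)"
proof -
  assume jl: "j < m" "l < m"
  have "(adj_mat reg_mat * reg_mat) $$ (j, l) = (\<Sum>k<m. adj_mat reg_mat $$ (j, k) * reg_mat $$ (k, l))"
    using jl gram_adj_carrier reg_gram_carrier[of s \<kappa> W n m]
    by (simp add: scalar_prod_def atLeast0LessThan)
  also have "(adj_mat reg_mat * reg_mat) $$ (j, l) = (if j = l then det reg_mat else 0)"
    unfolding adj_mat(3)[OF reg_gram_carrier] using jl by simp
  finally have "(\<Sum>k<m. adj_mat reg_mat $$ (j, k) * reg_mat $$ (k, l)) = (if j = l then det reg_mat else 0)" ..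
  moreover have "(\<Sum>k<m. res_mat j k * reg_mat $$ (k, l)) = (\<Sum>k<m. adj_mat reg_mat $$ (j, k) * reg_mat $$ (k, l)) / det reg_mat"
    by (simp add: resolvent_def sum_divide_distrib)
  ultimately show ?thesis using det_reg_gram_nonzero[OF s \<kappa>] by simp
qed

lemma resolvent_solves:
  assumes "\<And>j. j < m \<Longrightarrow> (\<Sum>k<m. reg_mat $$ (j, k) * v k) = w j" and j: "j < m"
  shows "(\<Sum>k<m. res_mat j k * w k) = v j"
proof -
  have "(\<Sum>k<m. res_mat j k * w k) = (\<Sum>k<m. \<Sum>l<m. res_mat j k * reg_mat $$ (k, l) * v l)"
    by (intro sum.cong refl) (simp add: assms(1)[symmetric] sum_distrib_left mult.assoc)
  also have "\<dots> = (\<Sum>l<m. (\<Sum>k<m. res_mat j k * reg_mat $$ (k, l)) * v l)"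
    by (subst sum.swap) (simp add: sum_distrib_right)
  also have "\<dots> = (\<Sum>l<m. if j = l then v l else 0)"
    by (intro sum.cong) (auto simp: resolvent_left j)
  finally show ?thesis using j by simp
qed

lemma gram_apply_resolvent:
  assumes j: "j < m"
  shows "(\<Sum>k<m. reg_mat $$ (j, k) * (\<Sum>l<m. res_mat k l * w l)) = w j"
proof -
  have "(\<Sum>k<m. reg_mat $$ (j, k) * (\<Sum>l<m. res_mat k l * w l)) = (\<Sum>k<m. \<Sum>l<m. reg_mat $$ (j, k) * res_mat k l * w l)"
    by (simp add: sum_distrib_left mult.assoc)
  also have "\<dots> = (\<Sum>l<m. (\<Sum>k<m. reg_mat $$ (j, k) * res_mat k l) * w l)"
    by (subst sum.swap) (simp add: sum_distrib_right)
  also have "\<dots> = (\<Sum>l<m. if j = l then w l else 0)"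
    by (intro sum.cong) (auto simp: resolvent_right j)
  finally show ?thesis using j by simp
qed

lemma gram_sym: "j < m \<Longrightarrow> k < m \<Longrightarrow> reg_mat $$ (j, k) = reg_mat $$ (k, j)"
  by (simp add: reg_gram_def mult.commute)

lemma resolvent_sym:
  assumes "j < m" "l < m"
  shows "res_mat j l = res_mat l j"
proof -
  have "(\<Sum>k<m. reg_mat $$ (i, k) * res_mat j k) = (if i = j then 1 else 0)" if "i < m" for i
    using resolvent_left[OF assms(1) that] that
    by (simp add: gram_sym[of i] mult.commute[of _ "res_mat j _"] eq_commute cong: sum.cong_simp)
  then have "(\<Sum>k<m. res_mat l k * (if k = j then 1 else 0)) = res_mat j l"
    by (intro resolvent_solves assms) auto
  moreover have "(\<Sum>k<m. res_mat l k * (if k = j then 1 else 0)) = (\<Sum>k<m. if k = j then res_mat l k else 0)"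
    by (intro sum.cong) auto
  ultimately show ?thesis using assms by simp
qed

text \<open>
  The matrix is bounded below by \<open>s\<close>; this is applied to the solution \<open>v\<close> of \<open>(s + \<kappa> W\<^sup>t W) v = w\<close>.
\<close>

lemma resolvent_coercive:
  "s * (\<Sum>j<m. (\<Sum>k<m. res_mat j k * w k)\<^sup>2) \<le> (\<Sum>j<m. w j * (\<Sum>k<m. res_mat j k * w k))"
proof -
  have "(\<Sum>j<m. (\<Sum>k<m. res_mat j k * w k) * (\<Sum>k<m. reg_mat $$ (j, k) * (\<Sum>l<m. res_mat k l * w l)))
      = (\<Sum>j<m. w j * (\<Sum>k<m. res_mat j k * w k))"
    by (intro sum.cong refl, simp only: lessThan_iff gram_apply_resolvent) (rule mult.commute)
  then show ?thesis
    using reg_gram_coercive[OF \<kappa>, where s = s and m = m and v = "\<lambda>j. \<Sum>k<m. res_mat j k * w k" and W = W and n = n]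
    by simp
qed

lemma resolvent_column:
  assumes l: "l < m"
  shows "s * (\<Sum>j<m. (res_mat j l)\<^sup>2) \<le> res_mat l l"
proof -
  have e: "(\<Sum>k<m. res_mat j k * (if k = l then 1 else 0)) = res_mat j l" for j
  proof -
    have "(\<Sum>k<m. res_mat j k * (if k = l then 1 else 0)) = (\<Sum>k<m. if k = l then res_mat j k else 0)"
      by (intro sum.cong) auto
    then show ?thesis using l by simp
  qed
  have "(\<Sum>j<m. (if j = l then 1 else 0) * res_mat j l) = (\<Sum>j<m. if j = l then res_mat j l else 0)"
    by (intro sum.cong) auto
  then have "(\<Sum>j<m. (if j = l then 1 else 0) * res_mat j l) = res_mat l l" using l by simp
  then show ?thesis
    using resolvent_coercive[where w = "\<lambda>k. if k = l then 1 else 0"] unfolding e by simp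
qed

lemma resolvent_diag_nonneg: "l < m \<Longrightarrow> 0 \<le> res_mat l l"
  using resolvent_column[of l] s sum_nonneg[of "{..<m}" "\<lambda>j. (res_mat j l)\<^sup>2"]
  by (meson mult_nonneg_nonneg less_imp_le order_trans zero_le_power2)

text \<open>
  If \<open>S\<close> is the sum and \<open>q\<close> the inverse, then \<open>s * S \<le> q l l\<close> by coercivity and \<open>(q l l)\<^sup>2 \<le> S\<close>.
  Hence \<open>s\<^sup>2 * S\<^sup>2 \<le> S\<close>.
\<close>

lemma resolvent_column_bound:
  assumes l: "l < m"
  shows "(\<Sum>j<m. (res_mat j l)\<^sup>2) \<le> 1 / s\<^sup>2"
proof -
  define S where "S = (\<Sum>j<m. (res_mat j l)\<^sup>2)"
  have S0: "S \<ge> 0" unfolding S_def by (intro sum_nonneg) auto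
  have "(res_mat l l)\<^sup>2 \<le> S" unfolding S_def using l by (intro member_le_sum) auto
  moreover have "(s * S)\<^sup>2 \<le> (res_mat l l)\<^sup>2"
    using resolvent_column[OF l] s S0 by (intro power_mono) (auto simp: S_def)
  ultimately have "s\<^sup>2 * S * S \<le> 1 * S" by (simp add: power2_eq_square mult_ac)
  then have "s\<^sup>2 * S \<le> 1" using S0 s by (cases "S = 0") (auto dest: mult_right_le_imp_le)
  then show ?thesis using s unfolding S_def[symmetric] by (simp add: field_simps)
qed

lemma resolvent_entry_bound:
  assumes "j < m" "l < m"
  shows "\<bar>res_mat j l\<bar> \<le> 1 / s"
proof -
  have "(res_mat j l)\<^sup>2 \<le> (\<Sum>j<m. (res_mat j l)\<^sup>2)" using assms by (intro member_le_sum) auto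
  also have "\<dots> \<le> (1 / s)\<^sup>2" using resolvent_column_bound[OF assms(2)] by (simp add: power_divide)
  finally show ?thesis using s by (simp add: abs_le_square_iff[symmetric])
qed

text \<open>
  With \<open>K = s + \<kappa> W\<^sup>t W\<close>, the left-hand side is the trace of \<open>K\<^sup>-\<^sup>1 (K - s)\<close>.
\<close>

lemma resolvent_trace_identity:
  "(\<Sum>i<n. \<kappa> * (\<Sum>j<m. W i j * (\<Sum>k<m. res_mat j k * W i k))) = real m - s * (\<Sum>j<m. res_mat j j)"
proof -
  have K1: "\<kappa> * (\<Sum>i<n. W i k * W i j) = reg_mat $$ (k, j) - (if k = j then s else 0)" if "j < m" "k < m" for j k
    using that by (simp add: reg_gram_def)
  have "(\<Sum>i<n. \<kappa> * (\<Sum>j<m. W i j * (\<Sum>k<m. res_mat j k * W i k)))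
      = (\<Sum>i<n. \<Sum>j<m. \<Sum>k<m. res_mat j k * (\<kappa> * (W i k * W i j)))"
    by (simp add: sum_distrib_left mult_ac)
  also have "\<dots> = (\<Sum>j<m. \<Sum>i<n. \<Sum>k<m. res_mat j k * (\<kappa> * (W i k * W i j)))" by (rule sum.swap)
  also have "\<dots> = (\<Sum>j<m. \<Sum>k<m. \<Sum>i<n. res_mat j k * (\<kappa> * (W i k * W i j)))"
    by (intro sum.cong refl sum.swap)
  also have "\<dots> = (\<Sum>j<m. \<Sum>k<m. res_mat j k * (\<kappa> * (\<Sum>i<n. W i k * W i j)))"
    by (simp add: sum_distrib_left)
  also have "\<dots> = (\<Sum>j<m. \<Sum>k<m. res_mat j k * reg_mat $$ (k, j) - (if k = j then s * res_mat j k else 0))"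
    by (intro sum.cong refl, simp only: lessThan_iff K1) (simp add: right_diff_distrib)
  also have "\<dots> = (\<Sum>j<m. 1 - s * res_mat j j)"
    by (intro sum.cong refl) (auto simp: sum_subtractf resolvent_left)
  finally show ?thesis by (simp add: sum_subtractf sum_distrib_left)
qed

end

lemma gram_zero_row:
  assumes i: "i < n" and jk: "j < m" "k < m"
  shows "reg_gram s \<kappa> W n m $$ (j, k) = reg_gram s \<kappa> (zero_row i W) n m $$ (j, k) + \<kappa> * (W i j * W i k)"
proof -
  have "(\<Sum>i'<n. W i' j * W i' k) = W i j * W i k + (\<Sum>i'\<in>{..<n} - {i}. W i' j * W i' k)"
    using i by (intro sum.remove) auto
  moreover have "(\<Sum>i'<n. zero_row i W i' j * zero_row i W i' k) = (\<Sum>i'\<in>{..<n} - {i}. W i' j * W i' k)"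
    using i by (subst sum.remove[of _ i]) (auto simp: zero_row_def intro!: sum.cong)
  ultimately show ?thesis using jk by (simp add: reg_gram_def algebra_simps)
qed

text \<open>
  The quantity \<open>\<tau>\<^sub>i\<close>: the quadratic form of the \<open>i\<close>-th row in the inverse built from the other rows.
\<close>

definition leave_one_form :: "real \<Rightarrow> real \<Rightarrow> (nat \<Rightarrow> nat \<Rightarrow> real) \<Rightarrow> nat \<Rightarrow> nat \<Rightarrow> nat \<Rightarrow> real" where
  "leave_one_form s \<kappa> W n m i =
     \<kappa> * (\<Sum>j<m. W i j * (\<Sum>k<m. resolvent s \<kappa> (zero_row i W) n m j k * W i k))"

text \<open>
  Restoring the \<open>i\<close>-th row is a rank one perturbation. If \<open>v\<close> solves the system without the row, with
  the row as right-hand side, then \<open>v / (1 + \<tau>)\<close> solves the system with the row. The second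
  claim is this Sherman-Morrison formula; the last two follow from it because the
  trace changes by \<open>\<kappa> |v|\<^sup>2 / (1 + \<tau>)\<close>, while coercivity gives \<open>s \<kappa> |v|\<^sup>2 \<le> \<tau>\<close>.
\<close>

lemma leave_one_out:
  fixes W :: "nat \<Rightarrow> nat \<Rightarrow> real" and n m i :: nat
  assumes s: "s > 0" and \<kappa>: "\<kappa> \<ge> 0" and i: "i < n"
  defines "\<tau> \<equiv> leave_one_form s \<kappa> W n m i"
  shows "\<tau> \<ge> 0"
    and "1 - \<kappa> * (\<Sum>j<m. W i j * (\<Sum>k<m. resolvent s \<kappa> W n m j k * W i k)) = 1 / (1 + \<tau>)"
    and "0 \<le> (\<Sum>j<m. resolvent s \<kappa> (zero_row i W) n m j j) - (\<Sum>j<m. resolvent s \<kappa> W n m j j)"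
    and "(\<Sum>j<m. resolvent s \<kappa> (zero_row i W) n m j j) - (\<Sum>j<m. resolvent s \<kappa> W n m j j) \<le> 1 / s"
proof -
  define K where "K = reg_gram s \<kappa> W n m"
  define K' where "K' = reg_gram s \<kappa> (zero_row i W) n m"
  define q where "q = resolvent s \<kappa> W n m"
  define q' where "q' = resolvent s \<kappa> (zero_row i W) n m"
  define r where "r = W i"
  define v where "v = (\<lambda>j. \<Sum>k<m. q' j k * r k)"
  have \<tau>: "\<tau> = \<kappa> * (\<Sum>j<m. r j * v j)" by (simp add: \<tau>_def leave_one_form_def v_def q'_def r_def)
  have KK: "K $$ (j, k) = K' $$ (j, k) + \<kappa> * (r j * r k)" if "j < m" "k < m" for j k
    unfolding K_def K'_def r_def by (rule gram_zero_row[OF i that])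
  have coer: "s * (\<Sum>j<m. (v j)\<^sup>2) \<le> (\<Sum>j<m. r j * v j)"
    using resolvent_coercive[OF s \<kappa>, where m = m and W = "zero_row i W" and n = n and w = r] by (simp add: v_def q'_def)
  have v2: "(\<Sum>j<m. (v j)\<^sup>2) \<ge> 0" by (intro sum_nonneg) auto
  then have "0 \<le> s * (\<Sum>j<m. (v j)\<^sup>2)" using s by simp
  then show \<tau>0: "\<tau> \<ge> 0" unfolding \<tau> using coer \<kappa> by (intro mult_nonneg_nonneg) auto
  have K'v: "(\<Sum>k<m. K' $$ (j, k) * v k) = r j" if "j < m" for j
    using gram_apply_resolvent[OF s \<kappa> that, where W = "zero_row i W" and n = n and w = r] by (simp add: v_def q'_def K'_def)
  have Kv: "(\<Sum>k<m. K $$ (j, k) * v k) = (1 + \<tau>) * r j" if "j < m" for j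
  proof -
    have "(\<Sum>k<m. K $$ (j, k) * v k) = (\<Sum>k<m. K' $$ (j, k) * v k + \<kappa> * r j * (r k * v k))"
      using that by (intro sum.cong) (auto simp: KK algebra_simps)
    also have "\<dots> = r j + \<kappa> * r j * (\<Sum>k<m. r k * v k)"
      using K'v[OF that] by (simp add: sum.distrib sum_distrib_left)
    finally show ?thesis by (simp add: \<tau> algebra_simps)
  qed
  have qr: "(\<Sum>k<m. q j k * r k) = v j / (1 + \<tau>)" if "j < m" for j
  proof -
    have "(\<Sum>k<m. q j k * ((1 + \<tau>) * r k)) = v j"
      using resolvent_solves[OF s \<kappa>, where m = m and W = W and n = n and v = v and w = "\<lambda>j. (1 + \<tau>) * r j" and j = j] Kv that by (simp add: q_def K_def)
    then have "(1 + \<tau>) * (\<Sum>k<m. q j k * r k) = v j" by (simp add: sum_distrib_left mult_ac)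
    then show ?thesis using \<tau>0 by (simp add: field_simps)
  qed
  have "\<kappa> * (\<Sum>j<m. r j * (\<Sum>k<m. q j k * r k)) = \<kappa> * (\<Sum>j<m. r j * v j / (1 + \<tau>))"
    by (intro arg_cong[of _ _ "(*) \<kappa>"] sum.cong refl) (simp add: qr)
  also have "\<dots> = \<tau> / (1 + \<tau>)" by (simp add: \<tau> sum_divide_distrib[symmetric])
  finally show "1 - \<kappa> * (\<Sum>j<m. W i j * (\<Sum>k<m. resolvent s \<kappa> W n m j k * W i k)) = 1 / (1 + \<tau>)"
    using \<tau>0 by (simp add: q_def r_def field_simps)
  have diff: "q' j l - q j l = \<kappa> * (v j / (1 + \<tau>) * v l)" if jl: "j < m" "l < m" for j l
  proof -
    have "q' j l = (\<Sum>k<m. q j k * (\<Sum>p<m. K $$ (k, p) * q' p l))"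
      using resolvent_solves[OF s \<kappa>, where m = m and W = W and n = n and v = "\<lambda>p. q' p l" and w = "\<lambda>k. \<Sum>p<m. K $$ (k, p) * q' p l" and j = j] jl
      by (simp add: q_def K_def)
    also have "\<dots> = (\<Sum>k<m. q j k * ((if k = l then 1 else 0) + \<kappa> * r k * v l))"
    proof (intro sum.cong refl)
      fix k assume "k \<in> {..<m}"
      then have k: "k < m" by simp
      have "(\<Sum>p<m. K $$ (k, p) * q' p l) = (\<Sum>p<m. K' $$ (k, p) * q' p l + \<kappa> * r k * (q' l p * r p))"
        using k jl resolvent_sym[OF s \<kappa>, where m = m and l = l and W = "zero_row i W" and n = n]
        by (intro sum.cong) (auto simp: KK algebra_simps q'_def)
      also have "\<dots> = (if k = l then 1 else 0) + \<kappa> * r k * v l"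
        using resolvent_right[OF s \<kappa> k jl(2), where W = "zero_row i W" and n = n]
        by (simp add: sum.distrib sum_distrib_left[symmetric] v_def q'_def K'_def)
      finally show "q j k * (\<Sum>p<m. K $$ (k, p) * q' p l) = q j k * ((if k = l then 1 else 0) + \<kappa> * r k * v l)" by simp
    qed
    also have "\<dots> = (\<Sum>k<m. (if k = l then q j k else 0)) + (\<kappa> * v l) * (\<Sum>k<m. q j k * r k)"
      unfolding sum_distrib_left sum.distrib[symmetric] by (intro sum.cong) (auto simp: algebra_simps)
    finally show ?thesis using jl qr[OF jl(1)] by (simp add: algebra_simps)
  qed
  have "(\<Sum>j<m. q' j j) - (\<Sum>j<m. q j j) = (\<Sum>j<m. \<kappa> * (v j / (1 + \<tau>) * v j))"
    unfolding sum_subtractf[symmetric] by (intro sum.cong refl diff) auto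
  also have "\<dots> = \<kappa> / (1 + \<tau>) * (\<Sum>j<m. (v j)\<^sup>2)"
    unfolding sum_distrib_left by (intro sum.cong) (auto simp: power2_eq_square)
  finally have tr: "(\<Sum>j<m. q' j j) - (\<Sum>j<m. q j j) = \<kappa> / (1 + \<tau>) * (\<Sum>j<m. (v j)\<^sup>2)" .
  show "0 \<le> (\<Sum>j<m. resolvent s \<kappa> (zero_row i W) n m j j) - (\<Sum>j<m. resolvent s \<kappa> W n m j j)"
    unfolding q_def[symmetric] q'_def[symmetric] tr using \<kappa> \<tau>0 v2 by simp
  have "s * (\<kappa> * (\<Sum>j<m. (v j)\<^sup>2)) \<le> \<tau>"
    unfolding \<tau> using mult_left_mono[OF coer \<kappa>] by (simp add: mult_ac)
  then have "s * (\<kappa> * (\<Sum>j<m. (v j)\<^sup>2)) / (1 + \<tau>) \<le> 1"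
    using \<tau>0 by simp
  then show "(\<Sum>j<m. resolvent s \<kappa> (zero_row i W) n m j j) - (\<Sum>j<m. resolvent s \<kappa> W n m j j) \<le> 1 / s"
    unfolding q_def[symmetric] q'_def[symmetric] tr using s \<tau>0 by (simp add: field_simps)
qed

text \<open>
  The trace identity, in which each summand is rewritten by the Sherman-Morrison formula.
\<close>

theorem resolvent_self_consistent:
  fixes W :: "nat \<Rightarrow> nat \<Rightarrow> real" and n m :: nat
  assumes s: "s > 0" and n: "n \<ge> 1"
  defines "\<kappa> \<equiv> 1 / real n"
  defines "t \<equiv> \<kappa> * (\<Sum>j<m. resolvent s \<kappa> W n m j j)"
  shows "0 \<le> t" "(\<Sum>i<n. 1 / (1 + leave_one_form s \<kappa> W n m i)) / real n = 1 - real m / real n + s * t"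
proof -
  have \<kappa>: "\<kappa> \<ge> 0" by (simp add: \<kappa>_def)
  show "0 \<le> t" unfolding t_def using \<kappa> resolvent_diag_nonneg[OF s \<kappa>] by (intro mult_nonneg_nonneg sum_nonneg) auto
  have "(\<Sum>i<n. 1 / (1 + leave_one_form s \<kappa> W n m i)) =
      (\<Sum>i<n. 1 - \<kappa> * (\<Sum>j<m. W i j * (\<Sum>k<m. resolvent s \<kappa> W n m j k * W i k)))"
    using leave_one_out(2)[OF s \<kappa>] by (intro sum.cong) auto
  also have "\<dots> = real n - (real m - s * (\<Sum>j<m. resolvent s \<kappa> W n m j j))"
    by (simp add: sum_subtractf resolvent_trace_identity[OF s \<kappa>])
  finally have "(\<Sum>i<n. 1 / (1 + leave_one_form s \<kappa> W n m i)) / real n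
      = (real n - (real m - s * (\<Sum>j<m. resolvent s \<kappa> W n m j j))) / real n" by simp
  also have "\<dots> = 1 - real m / real n + s * t"
  proof -
    have "(N - (x - s * T)) / N = 1 - x / N + s * (1 / N * T)" if "N > 0" for N x T :: real
      using that by (simp add: diff_divide_distrib)
    then show ?thesis unfolding t_def \<kappa>_def using n by simp
  qed
  finally show "(\<Sum>i<n. 1 / (1 + leave_one_form s \<kappa> W n m i)) / real n = 1 - real m / real n + s * t" .
qed

text \<open>
  The inverse of \<open>Z = s + \<kappa> W W\<^sup>t\<close> is \<open>(1 - \<kappa> W K\<^sup>-\<^sup>1 W\<^sup>t) / s\<close> with \<open>K = s + \<kappa> W\<^sup>t W\<close>. The claim
  compares its last diagonal entry with the adjugate formula for the same entry.
\<close>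

theorem corner_minor_ratio:
  fixes W :: "nat \<Rightarrow> nat \<Rightarrow> real" and n m :: nat
  assumes s: "s > 0" and \<kappa>: "\<kappa> \<ge> 0" and n: "n \<ge> 1"
  defines "Z \<equiv> reg_gram s \<kappa> (\<lambda>j i. W i j) m n"
  shows "s * det (mat_delete Z (n - 1) (n - 1)) = det Z / (1 + leave_one_form s \<kappa> W n m (n - 1))"
proof -
  define q where "q = resolvent s \<kappa> W n m"
  \<comment> \<open>The matrix \<open>P\<close> is \<open>1 - \<kappa> W K\<^sup>-\<^sup>1 W\<^sup>t\<close>; the vector \<open>u j\<close> is \<open>K\<^sup>-\<^sup>1\<close> applied to row \<open>j\<close>.\<close>
  define u where "u = (\<lambda>j k. \<Sum>l<m. q k l * W j l)"
  define g where "g = (\<lambda>i j. \<Sum>k<m. W i k * u j k)"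
  define P where "P = mat n n (\<lambda>(i, j). (if i = j then 1 else 0) - \<kappa> * g i j)"
  have Z: "Z \<in> carrier_mat n n" by (simp add: Z_def reg_gram_carrier)
  have P: "P \<in> carrier_mat n n" by (simp add: P_def)
  have Ku: "s * u j k + \<kappa> * (\<Sum>p<n. W p k * g p j) = W j k" if "k < m" for j k
    using gram_apply_resolvent[OF s \<kappa> that, where W = W and n = n and w = "W j"] reg_gram_apply[OF that, where s = s and \<kappa> = \<kappa> and W = W and n = n and v = "u j"]
    by (simp add: u_def g_def q_def)
  have "Z * P = s \<cdot>\<^sub>m 1\<^sub>m n"
  proof (rule eq_matI)
    fix i j assume "i < dim_row (s \<cdot>\<^sub>m 1\<^sub>m n)" "j < dim_col (s \<cdot>\<^sub>m 1\<^sub>m n)"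
    then have ij: "i < n" "j < n" by auto
    have "(Z * P) $$ (i, j) = (\<Sum>p<n. Z $$ (i, p) * ((if p = j then 1 else 0) - \<kappa> * g p j))"
      using ij Z P by (simp add: scalar_prod_def atLeast0LessThan P_def)
    also have "\<dots> = s * ((if i = j then 1 else 0) - \<kappa> * g i j)
        + \<kappa> * (\<Sum>k<m. W i k * (\<Sum>p<n. W p k * ((if p = j then 1 else 0) - \<kappa> * g p j)))"
      unfolding Z_def by (rule reg_gram_apply[OF ij(1)])
    also have "(\<Sum>k<m. W i k * (\<Sum>p<n. W p k * ((if p = j then 1 else 0) - \<kappa> * g p j)))
        = (\<Sum>k<m. W i k * (s * u j k))"
    proof (intro sum.cong refl)
      fix k assume "k \<in> {..<m}"
      then have k: "k < m" by simp
      have "(\<Sum>p<n. W p k * ((if p = j then 1 else 0) - \<kappa> * g p j)) =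
          (\<Sum>p<n. (if p = j then W p k else 0)) - \<kappa> * (\<Sum>p<n. W p k * g p j)"
        unfolding sum_distrib_left sum_subtractf[symmetric] by (intro sum.cong) (auto simp: algebra_simps)
      also have "\<dots> = s * u j k" using ij Ku[OF k, of j] by simp
      finally show "W i k * (\<Sum>p<n. W p k * ((if p = j then 1 else 0) - \<kappa> * g p j)) = W i k * (s * u j k)" by simp
    qed
    also have "(\<Sum>k<m. W i k * (s * u j k)) = s * g i j" by (simp add: g_def sum_distrib_left mult_ac)
    finally show "(Z * P) $$ (i, j) = (s \<cdot>\<^sub>m 1\<^sub>m n) $$ (i, j)" using ij by (simp add: algebra_simps)
  qed (use Z P in auto)
  then have "adj_mat Z * (Z * P) = s \<cdot>\<^sub>m adj_mat Z"
    using mult_smult_distrib[OF adj_mat(1)[OF Z] one_carrier_mat, of s] adj_mat(1)[OF Z] by simp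
  moreover have "adj_mat Z * (Z * P) = det Z \<cdot>\<^sub>m P"
  proof -
    have "adj_mat Z * (Z * P) = (adj_mat Z * Z) * P"
      using assoc_mult_mat[OF adj_mat(1)[OF Z] Z P] by simp
    then show ?thesis using adj_mat(3)[OF Z] P mult_smult_assoc_mat[OF one_carrier_mat P] by simp
  qed
  ultimately have "(s \<cdot>\<^sub>m adj_mat Z) $$ (n - 1, n - 1) = (det Z \<cdot>\<^sub>m P) $$ (n - 1, n - 1)" by simp
  then have "s * det (mat_delete Z (n - 1) (n - 1)) = det Z * (1 - \<kappa> * g (n - 1) (n - 1))"
    using n adj_mat(1)[OF Z] Z P by (simp add: adj_mat_def cofactor_def P_def)
  also have "1 - \<kappa> * g (n - 1) (n - 1) = 1 / (1 + leave_one_form s \<kappa> W n m (n - 1))"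
    using leave_one_out(2)[OF s \<kappa>, of "n - 1" n W m] n by (simp add: g_def u_def q_def)
  finally show ?thesis by simp
qed

section \<open>Densities on the half-line and their Stieltjes transforms\<close>

lemma inverse_power_Lipschitz:
  fixes a b :: real
  assumes "0 < s" "s \<le> a" "a < b" "n \<ge> 1"
  shows "\<exists>c. a < c \<and> c < b \<and> (1 / a) ^ n - (1 / b) ^ n = (b - a) * (real n * (1 / c) ^ Suc n)"
proof -
  have "\<exists>c>a. c < b \<and> (1 / b) ^ n - (1 / a) ^ n = (b - a) * (- real n * (1 / c) ^ Suc n)"
  proof (rule MVT2[OF assms(3)])
    fix c assume c: "a \<le> c" "c \<le> b"
    then have c0: "c > 0" using assms by simp
    obtain m where m: "n = Suc m" using assms(4) by (cases n) auto
    have "((\<lambda>t. 1 / t) has_real_derivative - (1 / c\<^sup>2)) (at c)"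
      using c0 by (auto intro!: derivative_eq_intros simp: power2_eq_square)
    from DERIV_power[OF this, of n]
    have "((\<lambda>t. (1 / t) ^ n) has_real_derivative real n * (- (1 / c\<^sup>2) * (1 / c) ^ m)) (at c)"
      by (simp add: m)
    also have "real n * (- (1 / c\<^sup>2) * (1 / c) ^ m) = - real n * (1 / c) ^ Suc n"
      using c0 by (simp add: m power2_eq_square field_simps)
    finally show "((\<lambda>t. (1 / t) ^ n) has_real_derivative - real n * (1 / c) ^ Suc n) (at c)" .
  qed
  then show ?thesis by (auto simp: algebra_simps)
qed

text \<open>
  The next power of \<open>1 / (s + x)\<close> is a limit of difference quotients in \<open>s\<close>, uniformly in \<open>x \<ge> 0\<close>.
\<close>

lemma inverse_power_difference_quotient:
  fixes x :: real
  assumes s: "s > 0" and h: "h > 0" and x: "x \<ge> 0" and n: "n \<ge> 1"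
  shows "\<bar>(1 / (s + x)) ^ Suc n - (1 / (real n * h)) * ((1 / (s + x)) ^ n - (1 / (s + h + x)) ^ n)\<bar>
           \<le> h * (real (Suc n) * (1 / s) ^ Suc (Suc n))"
proof -
  obtain c where c: "s + x < c" "c < s + h + x"
    "(1 / (s + x)) ^ n - (1 / (s + h + x)) ^ n = (s + h + x - (s + x)) * (real n * (1 / c) ^ Suc n)"
    using inverse_power_Lipschitz[of s "s + x" "s + h + x" n] s h x n by auto
  have eq: "(1 / (real n * h)) * ((1 / (s + x)) ^ n - (1 / (s + h + x)) ^ n) = (1 / c) ^ Suc n"
    unfolding c(3) using n h by simp
  obtain d where d: "s + x < d" "d < c"
    "(1 / (s + x)) ^ Suc n - (1 / c) ^ Suc n = (c - (s + x)) * (real (Suc n) * (1 / d) ^ Suc (Suc n))"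
    using inverse_power_Lipschitz[of s "s + x" c "Suc n"] s x c by auto
  have "(1 / d) ^ Suc (Suc n) \<le> (1 / s) ^ Suc (Suc n)"
    using d(1) s x by (intro power_mono) (auto simp: divide_simps)
  then have "(c - (s + x)) * (real (Suc n) * (1 / d) ^ Suc (Suc n)) \<le> h * (real (Suc n) * (1 / s) ^ Suc (Suc n))"
    using c d s x by (intro mult_mono) auto
  moreover have "0 \<le> (c - (s + x)) * (real (Suc n) * (1 / d) ^ Suc (Suc n))"
    using c d s x by (intro mult_nonneg_nonneg) auto
  ultimately show ?thesis unfolding eq d(3) by simp
qed

text \<open>
  Differentiating in \<open>s\<close> produces all powers of \<open>1 / (1 + x)\<close> from the kernels \<open>1 / (s + x)\<close>. A continuous
  function that vanishes for large \<open>x\<close> is a continuous function of \<open>1 / (1 + x) \<in> [0, 1]\<close>, so the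
  Weierstrass theorem applies. The class \<open>C\<close> is abstract because the argument is needed twice, for
  convergence and for measurability.
\<close>

lemma stieltjes_kernels_dense:
  fixes C :: "(real \<Rightarrow> real) set"
  assumes one: "(\<lambda>x. 1) \<in> C"
    and kernel: "\<And>s. s > 0 \<Longrightarrow> (\<lambda>x. 1 / (s + x)) \<in> C"
    and lin: "\<And>f g c d. f \<in> C \<Longrightarrow> g \<in> C \<Longrightarrow> (\<lambda>x. c * f x + d * g x) \<in> C"
    and closed: "\<And>f. continuous_on {0..} f \<Longrightarrow>
      (\<And>\<epsilon>. \<epsilon> > 0 \<Longrightarrow> \<exists>g\<in>C. \<forall>x\<ge>0. \<bar>f x - g x\<bar> \<le> \<epsilon>) \<Longrightarrow> f \<in> C"
    and f: "continuous_on {0..} f" and K: "K \<ge> 0" "\<And>x. x \<ge> K \<Longrightarrow> f x = 0"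
  shows "f \<in> C"
proof -
  have pow: "\<forall>s>0. (\<lambda>x. (1 / (s + x)) ^ Suc k) \<in> C" for k
  proof (induction k)
    case 0
    then show ?case using kernel by simp
  next
    case (Suc k)
    show ?case
    proof (intro allI impI closed)
      fix s :: real assume s: "s > 0"
      show "continuous_on {0..} (\<lambda>x. (1 / (s + x)) ^ Suc (Suc k))"
        using s by (intro continuous_intros) (auto simp: add_nonneg_eq_0_iff)
      fix \<epsilon> :: real assume \<epsilon>: "\<epsilon> > 0"
      define B where "B = real (Suc (Suc k)) * (1 / s) ^ Suc (Suc (Suc k))"
      have B: "B > 0" using s by (simp add: B_def)
      define h where "h = \<epsilon> / B"
      have h: "h > 0" using \<epsilon> B by (simp add: h_def)
      define n where "n = Suc k"
      define g where "g = (\<lambda>x. 1 / (real n * h) * (1 / (s + x)) ^ n + (- (1 / (real n * h))) * (1 / (s + h + x)) ^ n)"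
      have "g \<in> C" unfolding g_def n_def using Suc s h by (intro lin) auto
      moreover have "\<bar>(1 / (s + x)) ^ Suc n - g x\<bar> \<le> \<epsilon>" if "x \<ge> 0" for x
      proof -
        have "\<bar>(1 / (s + x)) ^ Suc n - g x\<bar> \<le> h * B"
          using inverse_power_difference_quotient[OF s h that, of n]
          unfolding g_def B_def n_def by (simp add: algebra_simps)
        then show ?thesis using B by (simp add: h_def)
      qed
      ultimately show "\<exists>g\<in>C. \<forall>x\<ge>0. \<bar>(1 / (s + x)) ^ Suc (Suc k) - g x\<bar> \<le> \<epsilon>"
        unfolding n_def by blast
    qed
  qed
  have poly: "(\<lambda>x. \<Sum>i\<le>n. a i * (1 / (1 + x)) ^ i) \<in> C" for n :: nat and a :: "nat \<Rightarrow> real"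
  proof (induction n)
    case 0
    show ?case using lin[OF one one, of "a 0" 0] by simp
  next
    case (Suc n)
    show ?case
      using lin[OF Suc, of "\<lambda>x. (1 / (1 + x)) ^ Suc n" 1 "a (Suc n)"] pow by (simp add: mult_ac)
  qed
  \<comment> \<open>The function \<open>f\<close> in the variable \<open>u = 1 / (1 + x)\<close>; where \<open>u \<le> 1 / (K + 1)\<close>, one has \<open>x \<ge> K\<close>.\<close>
  define \<phi> where "\<phi> = (\<lambda>u. if u \<in> {0..1 / (K + 1)} then 0 else f (1 / u - 1))"
  have K1: "0 < 1 / (K + 1)" "1 / (K + 1) \<le> 1" using K(1) by (auto simp: divide_simps)
  have "continuous_on ({0..1 / (K + 1)} \<union> {1 / (K + 1)..1}) \<phi>"
    unfolding \<phi>_def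
  proof (intro continuous_on_cases)
    show "continuous_on {1 / (K + 1)..1} (\<lambda>u. f (1 / u - 1))"
    proof (rule continuous_on_compose2[OF f])
      have pos: "0 < u" if "u \<in> {1 / (K + 1)..1}" for u
        using less_le_trans[OF K1(1)] that by auto
      show "continuous_on {1 / (K + 1)..1} (\<lambda>u. 1 / u - 1)"
        by (intro continuous_intros ballI, metis pos less_irrefl)
      show "(\<lambda>u. 1 / u - 1) ` {1 / (K + 1)..1} \<subseteq> {0..}"
        using pos by (auto simp: le_divide_eq_1)
    qed
    show "\<forall>x. x \<in> {0..1 / (K + 1)} \<and> x \<notin> {0..1 / (K + 1)} \<or>
        x \<in> {1 / (K + 1)..1} \<and> x \<in> {0..1 / (K + 1)} \<longrightarrow> 0 = f (1 / x - 1)"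
    proof (intro allI impI)
      fix u assume "u \<in> {0..1 / (K + 1)} \<and> u \<notin> {0..1 / (K + 1)} \<or> u \<in> {1 / (K + 1)..1} \<and> u \<in> {0..1 / (K + 1)}"
      then have "u = 1 / (K + 1)" by auto
      then show "0 = f (1 / u - 1)" using K(2)[of K] by simp
    qed
  qed auto
  moreover have "{0..1 / (K + 1)} \<union> {1 / (K + 1)..1} = {0..1}"
    using K1 by (intro ivl_disj_un_two_touch(4)) linarith+
  ultimately have cont: "continuous_on {0..1} \<phi>" by simp
  show ?thesis
  proof (rule closed[OF f])
    fix \<epsilon> :: real assume \<epsilon>: "\<epsilon> > 0"
    obtain p where p: "real_polynomial_function p" "\<And>u. u \<in> {0..1} \<Longrightarrow> \<bar>\<phi> u - p u\<bar> < \<epsilon>"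
      using Stone_Weierstrass_real_polynomial_function[OF compact_Icc cont \<epsilon>] by blast
    obtain a n where pa: "p = (\<lambda>u. \<Sum>i\<le>n. a i * u ^ i)"
      using p(1) by (auto simp: real_polynomial_function_iff_sum)
    have "\<bar>f x - p (1 / (1 + x))\<bar> \<le> \<epsilon>" if x: "x \<ge> 0" for x
    proof -
      have "\<phi> (1 / (1 + x)) = f x"
        using x K by (cases "x < K") (auto simp: \<phi>_def divide_simps)
      then show ?thesis using p(2)[of "1 / (1 + x)"] x by auto
    qed
    moreover have "(\<lambda>x. p (1 / (1 + x))) \<in> C" unfolding pa by (rule poly)
    ultimately show "\<exists>g\<in>C. \<forall>x\<ge>0. \<bar>f x - g x\<bar> \<le> \<epsilon>" by (intro bexI) auto
  qed
qed

definition unit_density :: "(real \<Rightarrow> real) \<Rightarrow> bool" where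
  "unit_density h \<longleftrightarrow> h \<in> borel_measurable borel \<and> (\<forall>x\<ge>0. 0 \<le> h x \<and> h x \<le> 1) \<and> set_integrable lborel {0..} h"

definition pairing :: "(real \<Rightarrow> real) \<Rightarrow> (real \<Rightarrow> real) \<Rightarrow> real" where
  "pairing h \<phi> = (LINT x:{0..}|lborel. h x * \<phi> x)"

definition test_fun :: "(real \<Rightarrow> real) \<Rightarrow> bool" where
  "test_fun \<phi> \<longleftrightarrow> continuous_on {0..} \<phi> \<and> (\<exists>B. \<forall>x\<ge>0. \<bar>\<phi> x\<bar> \<le> B)"

definition mass_below :: "(real \<Rightarrow> real) \<Rightarrow> real \<Rightarrow> real" where
  "mass_below h x = (LINT t:{0..x}|lborel. h t)"

lemma density_integrable_mult:
  assumes h: "unit_density h" and m: "set_borel_measurable borel {0..} \<phi>" and B: "\<And>x. x \<ge> 0 \<Longrightarrow> \<bar>\<phi> x\<bar> \<le> B"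
  shows "set_integrable lborel {0..} (\<lambda>x. h x * \<phi> x)"
  unfolding set_integrable_def
proof (rule Bochner_Integration.integrable_bound)
  show "integrable lborel (\<lambda>x. B * (indicator {0..} x *\<^sub>R h x))"
    using h unfolding unit_density_def set_integrable_def by (intro integrable_mult_right) auto
  have eq: "(\<lambda>x. indicator {0..} x *\<^sub>R (h x * \<phi> x)) = (\<lambda>x. h x * (indicator {0..} x *\<^sub>R \<phi> x))" by auto
  show "(\<lambda>x. indicator {0..} x *\<^sub>R (h x * \<phi> x)) \<in> borel_measurable lborel"
    unfolding eq using h m unfolding unit_density_def set_borel_measurable_def
    by (intro borel_measurable_times) simp_all
  show "AE x in lborel. norm (indicator {0..} x *\<^sub>R (h x * \<phi> x)) \<le> norm (B * (indicator {0..} x *\<^sub>R h x))"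
  proof (intro AE_I2)
    fix x :: real
    show "norm (indicator {0..} x *\<^sub>R (h x * \<phi> x)) \<le> norm (B * (indicator {0..} x *\<^sub>R h x))"
    proof (cases "x \<ge> 0")
      case True
      then have "h x \<ge> 0" using h by (simp add: unit_density_def)
      moreover have "\<bar>\<phi> x\<bar> \<le> \<bar>B\<bar>" using B[OF True] by simp
      ultimately have "h x * \<bar>\<phi> x\<bar> \<le> h x * \<bar>B\<bar>" "\<bar>h x\<bar> = h x" by (auto intro: mult_left_mono)
      then show ?thesis using True by (simp add: abs_mult mult.commute[of "\<bar>B\<bar>"])
    qed simp
  qed
qed

lemma test_fun_integrable:
  assumes "unit_density h" "test_fun \<phi>"
  shows "set_integrable lborel {0..} (\<lambda>x. h x * \<phi> x)"
proof -
  obtain B where "\<And>x. x \<ge> 0 \<Longrightarrow> \<bar>\<phi> x\<bar> \<le> B" using assms(2) by (auto simp: test_fun_def)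
  moreover have "set_borel_measurable borel {0..} \<phi>"
    using assms(2) unfolding set_borel_measurable_def
    by (intro borel_measurable_continuous_on_indicator) (auto simp: test_fun_def)
  ultimately show ?thesis using density_integrable_mult assms(1) by blast
qed

lemma test_fun_one: "test_fun (\<lambda>x. 1)"
  by (auto simp: test_fun_def)

lemma test_fun_kernel:
  assumes "s > 0"
  shows "test_fun (\<lambda>x. 1 / (s + x))"
proof -
  have "\<bar>1 / (s + x)\<bar> \<le> 1 / s" if "x \<ge> 0" for x using that assms by (auto simp: divide_simps)
  moreover have "continuous_on {0..} (\<lambda>x. 1 / (s + x))"
    using assms by (intro continuous_intros) (auto simp: add_nonneg_eq_0_iff)
  ultimately show ?thesis unfolding test_fun_def by blast
qed

lemma test_fun_lin:
  assumes "test_fun f" "test_fun g"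
  shows "test_fun (\<lambda>x. c * f x + d * g x)"
proof -
  obtain A B where AB: "\<And>x. x \<ge> 0 \<Longrightarrow> \<bar>f x\<bar> \<le> A" "\<And>x. x \<ge> 0 \<Longrightarrow> \<bar>g x\<bar> \<le> B"
    using assms by (auto simp: test_fun_def)
  have "\<bar>c * f x + d * g x\<bar> \<le> \<bar>c\<bar> * A + \<bar>d\<bar> * B" if "x \<ge> 0" for x
    using AB[OF that] by (intro order.trans[OF abs_triangle_ineq] add_mono) (auto simp: abs_mult intro: mult_left_mono)
  then show ?thesis using assms unfolding test_fun_def by (auto intro!: continuous_intros)
qed

lemma test_fun_approx:
  assumes "continuous_on {0..} f" "test_fun g" "\<forall>x\<ge>0. \<bar>f x - g x\<bar> \<le> \<epsilon>"
  shows "test_fun f"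
proof -
  obtain B where B: "\<And>x. x \<ge> 0 \<Longrightarrow> \<bar>g x\<bar> \<le> B" using assms(2) by (auto simp: test_fun_def)
  have "\<bar>f x\<bar> \<le> B + \<epsilon>" if "x \<ge> 0" for x using B[OF that] assms(3) that by fastforce
  then show ?thesis using assms(1) by (auto simp: test_fun_def)
qed

lemma pairing_lin:
  assumes "unit_density h" "test_fun f" "test_fun g"
  shows "pairing h (\<lambda>x. c * f x + d * g x) = c * pairing h f + d * pairing h g"
proof -
  have "pairing h (\<lambda>x. c * f x + d * g x) = (LINT x:{0..}|lborel. c * (h x * f x) + d * (h x * g x))"
    unfolding pairing_def by (simp add: algebra_simps)
  also have "\<dots> = c * pairing h f + d * pairing h g"
    unfolding pairing_def using assms test_fun_integrable
    by (subst set_integral_add) auto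
  finally show ?thesis .
qed

lemma pairing_one: "pairing h (\<lambda>x. 1) = (LINT x:{0..}|lborel. h x)"
  by (simp add: pairing_def)

lemma pairing_approx:
  assumes h: "unit_density h" and f: "test_fun f" and g: "test_fun g" and d: "\<forall>x\<ge>0. \<bar>f x - g x\<bar> \<le> \<epsilon>"
  shows "\<bar>pairing h f - pairing h g\<bar> \<le> \<epsilon> * pairing h (\<lambda>x. 1)"
proof -
  have "pairing h f - pairing h g = pairing h (\<lambda>x. 1 * f x + (- 1) * g x)"
    by (subst pairing_lin[OF h f g]) simp
  also have "\<bar>\<dots>\<bar> \<le> (LINT x:{0..}|lborel. \<bar>h x * (1 * f x + (- 1) * g x)\<bar>)"
    unfolding pairing_def using set_integral_norm_bound[OF test_fun_integrable[OF h test_fun_lin[OF f g]]]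
    by (simp only: real_norm_def)
  also have "\<dots> \<le> (LINT x:{0..}|lborel. \<epsilon> * (h x * 1))"
  proof (rule set_integral_mono)
    show "set_integrable lborel {0..} (\<lambda>x. \<bar>h x * (1 * f x + (- 1) * g x)\<bar>)"
      using set_integrable_norm[OF test_fun_integrable[OF h test_fun_lin[OF f g]]] by (simp only: real_norm_def)
    show "set_integrable lborel {0..} (\<lambda>x. \<epsilon> * (h x * 1))"
      using test_fun_integrable[OF h test_fun_one] by auto
    fix x :: real assume "x \<in> {0..}"
    then have "0 \<le> h x" "\<bar>f x - g x\<bar> \<le> \<epsilon>" using h d by (auto simp: unit_density_def)
    then show "\<bar>h x * (1 * f x + (- 1) * g x)\<bar> \<le> \<epsilon> * (h x * 1)"
      by (simp add: abs_mult mult_left_mono mult.commute[of \<epsilon>])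
  qed
  also have "\<dots> = \<epsilon> * pairing h (\<lambda>x. 1)" unfolding pairing_def by simp
  finally show ?thesis .
qed

definition ramp :: "real \<Rightarrow> real \<Rightarrow> real \<Rightarrow> real" where
  "ramp x \<eta> t = max 0 (min 1 ((x + \<eta> - t) / \<eta>))"

lemma test_fun_ramp: "\<eta> > 0 \<Longrightarrow> test_fun (ramp x \<eta>)"
  unfolding test_fun_def ramp_def by (intro conjI continuous_intros exI[of _ 1]) auto

lemma set_integrable_density_subset:
  assumes "unit_density h" "A \<subseteq> {0..}" "A \<in> sets borel"
  shows "set_integrable lborel A h"
  using assms by (intro set_integrable_subset[of lborel "{0..}" h A]) (auto simp: unit_density_def)

text \<open>
  The ramp differs from the indicator of \<open>[0, x]\<close> only on an interval of length \<open>\<eta>\<close>, where the density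
  is at most \<open>1\<close>.
\<close>

lemma pairing_ramp_near_mass:
  assumes h: "unit_density h" and \<eta>: "\<eta> > 0" and x: "x \<ge> 0"
  shows "\<bar>pairing h (ramp x \<eta>) - mass_below h x\<bar> \<le> \<eta>"
proof -
  have hb: "0 \<le> h t \<and> h t \<le> 1" if "t \<ge> 0" for t using h that by (simp add: unit_density_def)
  have r1: "ramp x \<eta> t = 1" if "t \<le> x" for t using that \<eta> by (simp add: ramp_def divide_simps)
  have r0: "ramp x \<eta> t = 0" if "t \<ge> x + \<eta>" for t using that \<eta> by (simp add: ramp_def divide_simps)
  have rb: "0 \<le> ramp x \<eta> t \<and> ramp x \<eta> t \<le> 1" for t by (simp add: ramp_def)
  have i1: "integrable lborel (\<lambda>t. indicator {0..} t *\<^sub>R (h t * ramp x \<eta> t))"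
    using test_fun_integrable[OF h test_fun_ramp[OF \<eta>]] by (simp add: set_integrable_def)
  have i2: "integrable lborel (\<lambda>t. indicator {0..x} t *\<^sub>R h t)"
    using set_integrable_density_subset[OF h, of "{0..x}"] by (auto simp: set_integrable_def)
  have i3: "integrable lborel (\<lambda>t. indicator {x..x + \<eta>} t :: real)"
    by (intro integrable_real_indicator) (auto simp: emeasure_lborel_Icc_eq)
  have ptw: "indicator {0..x} t *\<^sub>R h t \<le> indicator {0..} t *\<^sub>R (h t * ramp x \<eta> t)"
    "indicator {0..} t *\<^sub>R (h t * ramp x \<eta> t) - indicator {0..x} t *\<^sub>R h t \<le> indicator {x..x + \<eta>} t" for t
    using hb[of t] r1[of t] r0[of t] rb[of t] x \<eta> mult_le_one[of "h t" "ramp x \<eta> t"]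
    by (auto simp: indicator_def not_le)
  have "mass_below h x \<le> pairing h (ramp x \<eta>)"
    unfolding mass_below_def pairing_def set_lebesgue_integral_def
    by (intro integral_mono i1 i2 ptw)
  moreover have "pairing h (ramp x \<eta>) - mass_below h x \<le> (LINT t|lborel. indicator {x..x + \<eta>} t)"
    unfolding mass_below_def pairing_def set_lebesgue_integral_def
      Bochner_Integration.integral_diff[OF i1 i2, symmetric]
    by (intro integral_mono Bochner_Integration.integrable_diff i1 i2 i3 ptw)
  ultimately show ?thesis using \<eta> by simp
qed

lemma mass_below_mono_Lipschitz:
  assumes h: "unit_density h" and x: "0 \<le> x" "x \<le> y"
  shows "mass_below h x \<le> mass_below h y" "mass_below h y \<le> mass_below h x + (y - x)"
    "mass_below h x \<le> pairing h (\<lambda>x. 1)"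
proof -
  have hb: "0 \<le> h t \<and> h t \<le> 1" if "t \<ge> 0" for t using h that by (simp add: unit_density_def)
  have i: "integrable lborel (\<lambda>t. indicator {0..z} t *\<^sub>R h t)" for z
    using set_integrable_density_subset[OF h, of "{0..z}"] by (auto simp: set_integrable_def)
  have i0: "integrable lborel (\<lambda>t. indicator {0..} t *\<^sub>R h t)"
    using h by (auto simp: set_integrable_def unit_density_def)
  show "mass_below h x \<le> mass_below h y"
    unfolding mass_below_def set_lebesgue_integral_def
    by (intro integral_mono i) (use hb x in \<open>auto simp: indicator_def\<close>)
  show "mass_below h x \<le> pairing h (\<lambda>x. 1)"
    unfolding mass_below_def pairing_one set_lebesgue_integral_def
    by (intro integral_mono i i0) (use hb x in \<open>auto simp: indicator_def\<close>)
  have i1: "integrable lborel (\<lambda>t. indicator {x..y} t :: real)"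
    by (intro integrable_real_indicator) (auto simp: emeasure_lborel_Icc_eq)
  have ptw: "indicator {0..y} t *\<^sub>R h t - indicator {0..x} t *\<^sub>R h t \<le> indicator {x..y} t" for t
    using hb[of t] x by (auto simp: indicator_def)
  have "mass_below h y - mass_below h x \<le> (LINT t|lborel. indicator {x..y} t)"
    unfolding mass_below_def set_lebesgue_integral_def
      Bochner_Integration.integral_diff[OF i i, symmetric]
    by (intro integral_mono Bochner_Integration.integrable_diff i i1 ptw)
  then show "mass_below h y \<le> mass_below h x + (y - x)" using x by simp
qed

lemma mass_below_tendsto_total:
  assumes h: "unit_density h"
  shows "(\<lambda>n. mass_below h (real n)) \<longlonglongrightarrow> pairing h (\<lambda>x. 1)"
proof -
  have hb: "0 \<le> h t \<and> h t \<le> 1" if "t \<ge> 0" for t using h that by (simp add: unit_density_def)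
  have hm: "h \<in> borel_measurable borel" using h by (simp add: unit_density_def)
  show ?thesis
    unfolding mass_below_def pairing_one set_lebesgue_integral_def
  proof (rule integral_dominated_convergence[where w = "\<lambda>t. indicator {0..} t *\<^sub>R h t"])
    show "integrable lborel (\<lambda>t. indicator {0..} t *\<^sub>R h t)"
      using h by (auto simp: set_integrable_def unit_density_def)
    show "AE t in lborel. (\<lambda>n. indicator {0..real n} t *\<^sub>R h t) \<longlonglongrightarrow> indicator {0..} t *\<^sub>R h t"
    proof (intro AE_I2 tendsto_eventually)
      fix t :: real
      obtain m :: nat where "t \<le> real m" using real_arch_simple by blast
      then show "\<forall>\<^sub>F n in sequentially. indicator {0..real n} t *\<^sub>R h t = indicator {0..} t *\<^sub>R h t"
        by (intro eventually_sequentiallyI[of m]) (auto simp: indicator_def)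
    qed
  qed (use hb hm in \<open>auto simp: indicator_def\<close>)
qed

text \<open>
  The functions against which the pairings converge form a class as in \<open>stieltjes_kernels_dense\<close>;
  it is closed under uniform limits because the masses converge and so are eventually bounded.
\<close>

lemma pairing_continuity:
  assumes dens: "eventually (\<lambda>\<omega>. unit_density (h \<omega>)) F" and h0: "unit_density h0"
    and mass: "((\<lambda>\<omega>. pairing (h \<omega>) (\<lambda>x. 1)) \<longlongrightarrow> pairing h0 (\<lambda>x. 1)) F"
    and kernel: "\<And>s. s > 0 \<Longrightarrow>
      ((\<lambda>\<omega>. pairing (h \<omega>) (\<lambda>x. 1 / (s + x))) \<longlongrightarrow> pairing h0 (\<lambda>x. 1 / (s + x))) F"
    and f: "continuous_on {0..} f" and K: "K \<ge> 0" "\<And>x. x \<ge> K \<Longrightarrow> f x = 0"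
  shows "((\<lambda>\<omega>. pairing (h \<omega>) f) \<longlongrightarrow> pairing h0 f) F"
proof -
  define C where "C = {\<phi>. test_fun \<phi> \<and> ((\<lambda>\<omega>. pairing (h \<omega>) \<phi>) \<longlongrightarrow> pairing h0 \<phi>) F}"
  have "f \<in> C"
  proof (rule stieltjes_kernels_dense[where K=K])
    show "(\<lambda>x. 1) \<in> C" using mass test_fun_one by (simp add: C_def)
    show "(\<lambda>x. 1 / (s + x)) \<in> C" if "s > 0" for s using kernel test_fun_kernel that by (simp add: C_def)
    show "(\<lambda>x. c * f x + d * g x) \<in> C" if fg: "f \<in> C" "g \<in> C" for f g c d
    proof -
      have "((\<lambda>\<omega>. c * pairing (h \<omega>) f + d * pairing (h \<omega>) g) \<longlongrightarrow> c * pairing h0 f + d * pairing h0 g) F"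
        using fg by (auto simp: C_def intro!: tendsto_intros)
      then have "((\<lambda>\<omega>. pairing (h \<omega>) (\<lambda>x. c * f x + d * g x)) \<longlongrightarrow> c * pairing h0 f + d * pairing h0 g) F"
        by (rule Lim_transform_eventually)
           (use dens fg in \<open>auto simp: C_def pairing_lin elim!: eventually_mono\<close>)
      then show ?thesis using fg h0 by (simp add: C_def pairing_lin test_fun_lin)
    qed
    fix f assume cf: "continuous_on {0..} f"
      and approx: "\<And>\<epsilon>. \<epsilon> > 0 \<Longrightarrow> \<exists>g\<in>C. \<forall>x\<ge>0. \<bar>f x - g x\<bar> \<le> \<epsilon>"
    have tf: "test_fun f" using approx[of 1] test_fun_approx[OF cf] by (auto simp: C_def)
    define m where "m = pairing h0 (\<lambda>x. 1)"
    have m0: "m \<ge> 0"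
      unfolding m_def pairing_one using h0
      by (auto simp: set_lebesgue_integral_def unit_density_def indicator_def intro!: integral_nonneg_AE)
    have "((\<lambda>\<omega>. pairing (h \<omega>) f) \<longlongrightarrow> pairing h0 f) F"
    proof (rule tendstoI)
      fix e :: real assume e: "e > 0"
      define \<epsilon> where "\<epsilon> = e / 3 / (m + 1)"
      have m1: "m + 1 \<noteq> 0" using m0 by simp
      have \<epsilon>: "\<epsilon> > 0" using e m0 by (simp add: \<epsilon>_def)
      have \<epsilon>m: "\<epsilon> * (m + 1) = e / 3" unfolding \<epsilon>_def using m1 by (metis nonzero_divide_eq_eq)
      obtain g where g: "g \<in> C" "\<forall>x\<ge>0. \<bar>f x - g x\<bar> \<le> \<epsilon>" using approx[OF \<epsilon>] by blast
      have tg: "test_fun g" and lg: "((\<lambda>\<omega>. pairing (h \<omega>) g) \<longlongrightarrow> pairing h0 g) F"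
        using g by (auto simp: C_def)
      have "eventually (\<lambda>\<omega>. pairing (h \<omega>) (\<lambda>x. 1) < m + 1) F"
        using mass unfolding m_def by (rule order_tendstoD) simp
      moreover have "eventually (\<lambda>\<omega>. dist (pairing (h \<omega>) g) (pairing h0 g) < e / 3) F"
        using lg e by (intro tendstoD) auto
      ultimately show "eventually (\<lambda>\<omega>. dist (pairing (h \<omega>) f) (pairing h0 f) < e) F"
        using dens
      proof eventually_elim
        case (elim \<omega>)
        have "\<bar>pairing (h \<omega>) f - pairing (h \<omega>) g\<bar> \<le> \<epsilon> * pairing (h \<omega>) (\<lambda>x. 1)"
          by (rule pairing_approx[OF elim(3) tf tg g(2)])
        also have "\<dots> \<le> \<epsilon> * (m + 1)" using elim(1) \<epsilon> by (intro mult_left_mono) auto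
        finally have 1: "\<bar>pairing (h \<omega>) f - pairing (h \<omega>) g\<bar> \<le> e / 3" using \<epsilon>m by simp
        have "\<bar>pairing h0 f - pairing h0 g\<bar> \<le> \<epsilon> * m"
          unfolding m_def by (rule pairing_approx[OF h0 tf tg g(2)])
        also have "\<dots> \<le> \<epsilon> * (m + 1)" using \<epsilon> by (intro mult_left_mono) auto
        finally have "\<bar>pairing h0 f - pairing h0 g\<bar> \<le> e / 3" using \<epsilon>m by simp
        then show ?case using 1 elim(2) unfolding dist_real_def by linarith
      qed
    qed
    then show "f \<in> C" using tf by (simp add: C_def)
  qed (use f K in auto)
  then show ?thesis by (simp add: C_def)
qed

lemma continuous_ramp: "\<eta> > 0 \<Longrightarrow> continuous_on {0..} (ramp x \<eta>)"
  by (auto dest: test_fun_ramp simp: test_fun_def)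

lemma ramp_zero: "\<eta> > 0 \<Longrightarrow> t \<ge> max 0 (x + \<eta>) \<Longrightarrow> ramp x \<eta> t = 0"
  by (simp add: ramp_def divide_simps)

text \<open>
  A continuity theorem for Stieltjes transforms. Uniformity comes from a finite grid: between
  grid points all distribution functions vary by at most the mesh, and beyond the last point almost all
  the mass is used up, by the convergence of the total masses. The statement is for an
  arbitrary filter so that it applies to convergence in probability.
\<close>

theorem stieltjes_continuity:
  assumes dens: "eventually (\<lambda>\<omega>. unit_density (h \<omega>)) F" and h0: "unit_density h0"
    and mass: "((\<lambda>\<omega>. pairing (h \<omega>) (\<lambda>x. 1)) \<longlongrightarrow> pairing h0 (\<lambda>x. 1)) F"
    and kernel: "\<And>s. s > 0 \<Longrightarrow>
      ((\<lambda>\<omega>. pairing (h \<omega>) (\<lambda>x. 1 / (s + x))) \<longlongrightarrow> pairing h0 (\<lambda>x. 1 / (s + x))) F"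
    and e: "\<epsilon> > 0"
  shows "eventually (\<lambda>\<omega>. \<forall>x\<ge>0. \<bar>mass_below (h \<omega>) x - mass_below h0 x\<bar> \<le> \<epsilon>) F"
proof -
  define \<eta> where "\<eta> = \<epsilon> / 5"
  have \<eta>: "\<eta> > 0" using e by (simp add: \<eta>_def)
  have point: "eventually (\<lambda>\<omega>. \<bar>mass_below (h \<omega>) x - mass_below h0 x\<bar> \<le> 3 * \<eta>) F" if x: "x \<ge> 0" for x
  proof -
    have "((\<lambda>\<omega>. pairing (h \<omega>) (ramp x \<eta>)) \<longlongrightarrow> pairing h0 (ramp x \<eta>)) F"
      by (rule pairing_continuity[OF dens h0 mass kernel continuous_ramp[OF \<eta>], where K = "max 0 (x + \<eta>)"])
         (use \<eta> in \<open>auto intro: ramp_zero\<close>)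
    then have "eventually (\<lambda>\<omega>. dist (pairing (h \<omega>) (ramp x \<eta>)) (pairing h0 (ramp x \<eta>)) < \<eta>) F"
      using \<eta> by (intro tendstoD)
    then show ?thesis using dens
    proof eventually_elim
      case (elim \<omega>)
      show ?case
        using elim(1) pairing_ramp_near_mass[OF elim(2) \<eta> x] pairing_ramp_near_mass[OF h0 \<eta> x]
        unfolding dist_real_def by linarith
    qed
  qed
  have "eventually (\<lambda>n. dist (mass_below h0 (real n)) (pairing h0 (\<lambda>x. 1)) < \<eta>) sequentially"
    using mass_below_tendsto_total[OF h0] \<eta> by (rule tendstoD)
  then obtain n where n: "dist (mass_below h0 (real n)) (pairing h0 (\<lambda>x. 1)) < \<eta>"
    by (auto simp: eventually_sequentially)
  define K where "K = real n"
  have K: "K \<ge> 0" "\<bar>mass_below h0 K - pairing h0 (\<lambda>x. 1)\<bar> < \<eta>" using n by (auto simp: K_def dist_real_def)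
  obtain m :: nat where m: "K / \<eta> \<le> real m" using real_arch_simple by blast
  have "eventually (\<lambda>\<omega>. \<forall>i\<in>{..m}. \<bar>mass_below (h \<omega>) (real i * \<eta>) - mass_below h0 (real i * \<eta>)\<bar> \<le> 3 * \<eta>) F"
    using point \<eta> by (intro eventually_ball_finite) auto
  moreover have "eventually (\<lambda>\<omega>. \<bar>mass_below (h \<omega>) K - mass_below h0 K\<bar> \<le> 3 * \<eta>) F" using point K by auto
  moreover have "eventually (\<lambda>\<omega>. dist (pairing (h \<omega>) (\<lambda>x. 1)) (pairing h0 (\<lambda>x. 1)) < \<eta>) F"
    using mass \<eta> by (rule tendstoD)
  ultimately show ?thesis using dens
  proof eventually_elim
    case (elim \<omega>)
    show ?case
    proof (intro allI impI)
      fix x :: real assume x: "x \<ge> 0"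
      show "\<bar>mass_below (h \<omega>) x - mass_below h0 x\<bar> \<le> \<epsilon>"
      proof (cases "x \<le> K")
        case True
        define i where "i = nat \<lfloor>x / \<eta>\<rfloor>"
        have "real i = of_int \<lfloor>x / \<eta>\<rfloor>" using x \<eta> by (simp add: i_def)
        then have i: "real i \<le> x / \<eta>" "x / \<eta> < real i + 1" by linarith+
        have ix: "real i * \<eta> \<le> x" "x < real i * \<eta> + \<eta>" using i \<eta> by (auto simp: field_simps)
        have "x / \<eta> \<le> K / \<eta>" using True \<eta> by (simp add: divide_right_mono)
        then have "real i \<le> real m" using i(1) m by linarith
        then have "i \<in> {..m}" by simp
        then have "\<bar>mass_below (h \<omega>) (real i * \<eta>) - mass_below h0 (real i * \<eta>)\<bar> \<le> 3 * \<eta>" using elim(1) by blast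
        moreover have i0: "0 \<le> real i * \<eta>" using \<eta> by simp
        moreover note mass_below_mono_Lipschitz(1,2)[OF elim(4) i0 ix(1)] mass_below_mono_Lipschitz(1,2)[OF h0 i0 ix(1)]
        ultimately have "\<bar>mass_below (h \<omega>) x - mass_below h0 x\<bar> \<le> 5 * \<eta>"
          using ix(2) by linarith
        then show ?thesis by (simp add: \<eta>_def)
      next
        case False
        then have Kx: "K \<le> x" by simp
        note mass_below_mono_Lipschitz(1)[OF elim(4) K(1) Kx] mass_below_mono_Lipschitz(1)[OF h0 K(1) Kx]
          mass_below_mono_Lipschitz(3)[OF elim(4) x order_refl] mass_below_mono_Lipschitz(3)[OF h0 x order_refl]
        then have "\<bar>mass_below (h \<omega>) x - mass_below h0 x\<bar> \<le> 5 * \<eta>"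
          using elim(2,3) K(2) unfolding dist_real_def by linarith
        then show ?thesis by (simp add: \<eta>_def)
      qed
    qed
  qed
qed


text \<open>
  The functions \<open>s / (s + x)\<close> tend to \<open>1\<close> as \<open>s \<rightarrow> \<infinity>\<close> and are bounded by \<open>1\<close>. The index is shifted to keep
  \<open>s\<close> positive.
\<close>

lemma kernel_tendsto_total:
  assumes h: "unit_density h"
  shows "(\<lambda>n. real (Suc n) * pairing h (\<lambda>x. 1 / (real (Suc n) + x))) \<longlonglongrightarrow> pairing h (\<lambda>x. 1)"
proof -
  have hb: "0 \<le> h t \<and> h t \<le> 1" if "t \<ge> 0" for t using h that by (simp add: unit_density_def)
  have hm: "h \<in> borel_measurable borel" using h by (simp add: unit_density_def)
  have eq: "real (Suc n) * pairing h (\<lambda>x. 1 / (real (Suc n) + x)) =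
      (LINT t|lborel. indicator {0..} t *\<^sub>R (h t * (real (Suc n) / (real (Suc n) + t))))" for n
    unfolding pairing_def set_lebesgue_integral_def
    by (subst integral_mult_right_zero[symmetric]) (simp add: mult_ac)
  show ?thesis
    unfolding eq pairing_one set_lebesgue_integral_def
  proof (rule integral_dominated_convergence[where w = "\<lambda>t. indicator {0..} t *\<^sub>R h t"])
    show "integrable lborel (\<lambda>t. indicator {0..} t *\<^sub>R h t)"
      using h by (auto simp: set_integrable_def unit_density_def)
    show "AE t in lborel. (\<lambda>n. indicator {0..} t *\<^sub>R (h t * (real (Suc n) / (real (Suc n) + t))))
        \<longlonglongrightarrow> indicator {0..} t *\<^sub>R h t"
    proof (intro AE_I2)
      fix t :: real
      have "(\<lambda>n. real (Suc n) / (real (Suc n) + t)) \<longlonglongrightarrow> 1" by real_asymp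
      then have "(\<lambda>n. indicator {0..} t *\<^sub>R (h t * (real (Suc n) / (real (Suc n) + t))))
        \<longlonglongrightarrow> indicator {0..} t *\<^sub>R (h t * 1)" by (intro tendsto_intros)
      then show "(\<lambda>n. indicator {0..} t *\<^sub>R (h t * (real (Suc n) / (real (Suc n) + t))))
        \<longlonglongrightarrow> indicator {0..} t *\<^sub>R h t" by simp
    qed
    show "AE t in lborel. norm (indicator {0..} t *\<^sub>R (h t * (real (Suc n) / (real (Suc n) + t)))) \<le> indicator {0..} t *\<^sub>R h t" for n
    proof (intro AE_I2)
      fix t :: real
      show "norm (indicator {0..} t *\<^sub>R (h t * (real (Suc n) / (real (Suc n) + t)))) \<le> indicator {0..} t *\<^sub>R h t"
      proof (cases "t \<ge> 0")
        case True
        define q where "q = real (Suc n) / (real (Suc n) + t)"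
        have q: "0 \<le> q" "q \<le> 1" using True by (auto simp: q_def)
        then have "h t * q \<le> h t" using hb[OF True] by (simp add: mult_left_le)
        then show ?thesis unfolding q_def[symmetric] using hb[OF True] q True by (simp add: abs_mult)
      qed simp
    qed
  qed (use hm in measurable)
qed

text \<open>
  The functions whose pairing with the random density is measurable form a class as in
  \<open>stieltjes_kernels_dense\<close>.
\<close>

theorem stieltjes_measurability:
  assumes h: "\<And>\<omega>. \<omega> \<in> space M \<Longrightarrow> unit_density (h \<omega>)"
    and kernel: "\<And>s. s > 0 \<Longrightarrow> (\<lambda>\<omega>. pairing (h \<omega>) (\<lambda>x. 1 / (s + x))) \<in> borel_measurable M"
  shows "(\<lambda>\<omega>. pairing (h \<omega>) (\<lambda>x. 1)) \<in> borel_measurable M"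
    and "x \<ge> 0 \<Longrightarrow> (\<lambda>\<omega>. mass_below (h \<omega>) x) \<in> borel_measurable M"
proof -
  show one: "(\<lambda>\<omega>. pairing (h \<omega>) (\<lambda>x. 1)) \<in> borel_measurable M"
    by (rule borel_measurable_LIMSEQ_real[OF kernel_tendsto_total[OF h]])
       (auto intro!: borel_measurable_times kernel)
  define C where "C = {\<phi>. test_fun \<phi> \<and> (\<lambda>\<omega>. pairing (h \<omega>) \<phi>) \<in> borel_measurable M}"
  have mem: "f \<in> C" if f: "continuous_on {0..} f" and K: "K \<ge> 0" "\<And>x. x \<ge> K \<Longrightarrow> f x = 0" for f K
  proof (rule stieltjes_kernels_dense[where K=K])
    show "(\<lambda>x. 1) \<in> C" using one test_fun_one by (simp add: C_def)
    show "(\<lambda>x. 1 / (s + x)) \<in> C" if "s > 0" for s using kernel test_fun_kernel that by (simp add: C_def)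
    show "(\<lambda>x. c * f x + d * g x) \<in> C" if fg: "f \<in> C" "g \<in> C" for f g c d
    proof -
      have "(\<lambda>\<omega>. c * pairing (h \<omega>) f + d * pairing (h \<omega>) g) \<in> borel_measurable M"
        using fg by (auto simp: C_def)
      also have "?this \<longleftrightarrow> (\<lambda>\<omega>. pairing (h \<omega>) (\<lambda>x. c * f x + d * g x)) \<in> borel_measurable M"
        by (rule measurable_cong) (use fg h in \<open>auto simp: C_def pairing_lin\<close>)
      finally show ?thesis using fg by (simp add: C_def test_fun_lin)
    qed
    fix f assume cf: "continuous_on {0..} f"
      and approx: "\<And>\<epsilon>. \<epsilon> > 0 \<Longrightarrow> \<exists>g\<in>C. \<forall>x\<ge>0. \<bar>f x - g x\<bar> \<le> \<epsilon>"
    have tf: "test_fun f" using approx[of 1] test_fun_approx[OF cf] by (auto simp: C_def)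
    have "\<forall>n. \<exists>g\<in>C. \<forall>x\<ge>0. \<bar>f x - g x\<bar> \<le> 1 / real (Suc n)" using approx by simp
    then obtain g where g: "\<And>n. g n \<in> C" "\<And>n. \<forall>x\<ge>0. \<bar>f x - g n x\<bar> \<le> 1 / real (Suc n)"
      by metis
    have "(\<lambda>\<omega>. pairing (h \<omega>) f) \<in> borel_measurable M"
    proof (rule borel_measurable_LIMSEQ_real)
      show "(\<lambda>\<omega>. pairing (h \<omega>) (g n)) \<in> borel_measurable M" for n using g(1) by (simp add: C_def)
      fix \<omega> assume \<omega>: "\<omega> \<in> space M"
      have bound: "\<bar>pairing (h \<omega>) (g n) - pairing (h \<omega>) f\<bar> \<le> 1 / real (Suc n) * pairing (h \<omega>) (\<lambda>x. 1)" for n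
        using pairing_approx[OF h[OF \<omega>] tf _ g(2)[of n]] g(1)[of n] by (simp add: C_def abs_minus_commute)
      have lim: "(\<lambda>n. 1 / real (Suc n) * m) \<longlonglongrightarrow> 0" for m :: real by real_asymp
      have "(\<lambda>n. pairing (h \<omega>) (g n) - pairing (h \<omega>) f) \<longlonglongrightarrow> 0"
      proof (rule Lim_null_comparison[OF _ lim])
        show "\<forall>\<^sub>F n in sequentially. norm (pairing (h \<omega>) (g n) - pairing (h \<omega>) f) \<le> 1 / real (Suc n) * pairing (h \<omega>) (\<lambda>x. 1)"
          unfolding real_norm_def by (rule always_eventually, rule allI, rule bound)
      qed
      then show "(\<lambda>n. pairing (h \<omega>) (g n)) \<longlonglongrightarrow> pairing (h \<omega>) f" by (rule LIM_zero_cancel)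
    qed
    then show "f \<in> C" using tf by (simp add: C_def)
  qed (use f K in auto)
  assume x: "x \<ge> 0"
  show "(\<lambda>\<omega>. mass_below (h \<omega>) x) \<in> borel_measurable M"
  proof (rule borel_measurable_LIMSEQ_real)
    show "(\<lambda>\<omega>. pairing (h \<omega>) (ramp x (1 / real (Suc n)))) \<in> borel_measurable M" for n
    proof -
      have \<eta>: "1 / real (Suc n) > 0" by simp
      have "ramp x (1 / real (Suc n)) \<in> C"
      proof (rule mem[where K = "max 0 (x + 1 / real (Suc n))"])
        show "continuous_on {0..} (ramp x (1 / real (Suc n)))" by (rule continuous_ramp[OF \<eta>])
        show "0 \<le> max 0 (x + 1 / real (Suc n))" by simp
        show "ramp x (1 / real (Suc n)) t = 0" if "max 0 (x + 1 / real (Suc n)) \<le> t" for t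
          by (rule ramp_zero[OF \<eta> that])
      qed
      then show ?thesis by (simp add: C_def)
    qed
    fix \<omega> assume \<omega>: "\<omega> \<in> space M"
    have bound: "\<bar>pairing (h \<omega>) (ramp x (1 / real (Suc n))) - mass_below (h \<omega>) x\<bar> \<le> 1 / real (Suc n)" for n
      using pairing_ramp_near_mass[OF h[OF \<omega>] _ x] by simp
    have lim: "(\<lambda>n. 1 / real (Suc n)) \<longlonglongrightarrow> 0" by real_asymp
    have "(\<lambda>n. pairing (h \<omega>) (ramp x (1 / real (Suc n))) - mass_below (h \<omega>) x) \<longlonglongrightarrow> 0"
    proof (rule Lim_null_comparison[OF _ lim])
      show "\<forall>\<^sub>F n in sequentially. norm (pairing (h \<omega>) (ramp x (1 / real (Suc n))) - mass_below (h \<omega>) x) \<le> 1 / real (Suc n)"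
        unfolding real_norm_def by (rule always_eventually, rule allI, rule bound)
    qed
    then show "(\<lambda>n. pairing (h \<omega>) (ramp x (1 / real (Suc n)))) \<longlonglongrightarrow> mass_below (h \<omega>) x"
      by (rule LIM_zero_cancel)
  qed
qed

section \<open>Eigenvalues of Gram matrices\<close>

lemma poly_prod_linear: "poly (\<Prod>a\<in>#X. [:- a, 1:]) x = (\<Prod>a\<in>#X. x - a)"
  for x :: "'a :: comm_ring_1"
  by (induction X) (auto simp: algebra_simps)

lemma char_val_prod:
  assumes A: "A \<in> carrier_mat n n"
    and sym: "\<And>i j. i < n \<Longrightarrow> j < n \<Longrightarrow> A $$ (i, j) = A $$ (j, i)"
  shows "char_val A z = (\<Prod>a\<in>#eigenvalues_mset A. z - of_real a)"
proof -
  interpret poly_of_real: map_poly_inj_comm_ring_hom "of_real :: real \<Rightarrow> complex" ..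
  have "map_poly of_real (\<Prod>a\<in>#X. [:- a, 1:]) = (\<Prod>a\<in>#X. [:- complex_of_real a, 1:])" for X :: "real multiset"
    by (induction X) (simp_all add: poly_of_real.hom_mult del: mult_pCons_left)
  moreover have "poly (\<Prod>a\<in>#X. [:- complex_of_real a, 1:]) z = (\<Prod>a\<in>#X. z - of_real a)" for X
    by (induction X) (auto simp: algebra_simps)
  ultimately show ?thesis
    unfolding char_val_def by (subst symmetric_char_poly_splits(2)[OF A sym]) auto
qed

definition gram_mat :: "(nat \<Rightarrow> nat \<Rightarrow> real) \<Rightarrow> nat \<Rightarrow> nat \<Rightarrow> real mat" where
  "gram_mat W n m = mat n n (\<lambda>(i, j). \<Sum>l<m. W i l * W j l)"

text \<open>
  These are the eigenvalues of \<open>\<kappa> W W\<^sup>t\<close>. The eigenvalues are scaled, not the matrix, because the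
  diagram is rescaled in the same way.
\<close>

definition scaled_eigenvalues :: "real \<Rightarrow> (nat \<Rightarrow> nat \<Rightarrow> real) \<Rightarrow> nat \<Rightarrow> nat \<Rightarrow> real multiset" where
  "scaled_eigenvalues \<kappa> W n m = image_mset (\<lambda>a. \<kappa> * a) (eigenvalues_mset (gram_mat W n m))"

lemma gram_mat_carrier: "gram_mat W n m \<in> carrier_mat n n"
  by (simp add: gram_mat_def)

lemma gram_mat_sym: "i < n \<Longrightarrow> j < n \<Longrightarrow> gram_mat W n m $$ (i, j) = gram_mat W n m $$ (j, i)"
  by (simp add: gram_mat_def mult.commute)

lemma size_gram_eigenvalues: "size (eigenvalues_mset (gram_mat W n m)) = n"
  by (rule symmetric_char_poly_splits(1)[OF gram_mat_carrier gram_mat_sym])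

text \<open>
  The corner of a Gram matrix is the Gram matrix of fewer rows, so statements about Gram matrices apply
  to both matrices at once.
\<close>

lemma gram_mat_delete:
  "n \<ge> 1 \<Longrightarrow> mat_delete (gram_mat W n m) (n - 1) (n - 1) = gram_mat W (n - 1) m"
  by (rule eq_matI) (auto simp: mat_delete_def gram_mat_def)

lemma reg_gram_delete:
  "n \<ge> 1 \<Longrightarrow> mat_delete (reg_gram s \<kappa> (\<lambda>j i. W i j) m n) (n - 1) (n - 1) = reg_gram s \<kappa> (\<lambda>j i. W i j) m (n - 1)"
  by (rule eq_matI) (auto simp: mat_delete_def reg_gram_def)

lemma size_scaled_eigenvalues: "size (scaled_eigenvalues \<kappa> W n m) = n"
  by (simp add: scaled_eigenvalues_def size_gram_eigenvalues)

lemma prod_scaled_eigenvalues: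
  assumes \<kappa>: "\<kappa> > 0"
  shows "(\<Prod>a\<in>#scaled_eigenvalues \<kappa> W n m. s + a) = det (reg_gram s \<kappa> (\<lambda>j i. W i j) m n)"
proof -
  let ?A = "gram_mat W n m" and ?E = "eigenvalues_mset (gram_mat W n m)"
  \<comment> \<open>The characteristic polynomial of \<open>W W\<^sup>t\<close> at this point, times \<open>(-\<kappa>)\<^sup>n\<close>, is \<open>det (s + \<kappa> W W\<^sup>t)\<close>.\<close>
  define x where "x = - (s / \<kappa>)"
  have sx: "s = - (\<kappa> * x)" using \<kappa> by (simp add: x_def)
  have "(\<Prod>a\<in>#X. s + \<kappa> * a) = (- \<kappa>) ^ size X * (\<Prod>a\<in>#X. x - a)" for X
    unfolding sx by (induction X) (auto simp: algebra_simps)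
  then have "(\<Prod>a\<in>#scaled_eigenvalues \<kappa> W n m. s + a) = (- \<kappa>) ^ n * (\<Prod>a\<in>#?E. x - a)"
    by (simp add: size_gram_eigenvalues scaled_eigenvalues_def image_mset.compositionality o_def)
  also have "(\<Prod>a\<in>#?E. x - a) = poly (char_poly ?A) x"
    by (subst symmetric_char_poly_splits(2)[OF gram_mat_carrier gram_mat_sym]) (auto simp: poly_prod_linear)
  also have "\<dots> = det (mat n n (\<lambda>(i, j). (if i = j then x else 0) - ?A $$ (i, j)))"
    by (rule poly_char_poly_eq_det[OF gram_mat_carrier])
  also have "(- \<kappa>) ^ n * \<dots> = det ((- \<kappa>) \<cdot>\<^sub>m mat n n (\<lambda>(i, j). (if i = j then x else 0) - ?A $$ (i, j)))"
    by simp
  also have "(- \<kappa>) \<cdot>\<^sub>m mat n n (\<lambda>(i, j). (if i = j then x else 0) - ?A $$ (i, j)) = reg_gram s \<kappa> (\<lambda>j i. W i j) m n"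
    by (rule eq_matI) (auto simp: reg_gram_def gram_mat_def sx algebra_simps)
  finally show ?thesis .
qed

text \<open>
  A negative eigenvalue \<open>a\<close> would make \<open>\<kappa> W W\<^sup>t - a\<close> singular, although it is positive definite.
\<close>

lemma scaled_eigenvalues_nonneg:
  assumes \<kappa>: "\<kappa> > 0" and a: "a \<in># scaled_eigenvalues \<kappa> W n m"
  shows "a \<ge> 0"
proof (rule ccontr)
  assume "\<not> a \<ge> 0"
  then have "det (reg_gram (- a) \<kappa> (\<lambda>j i. W i j) m n) \<noteq> 0"
    using det_reg_gram_nonzero[of "- a" \<kappa>] \<kappa> by simp
  moreover have "(\<Prod>b\<in>#scaled_eigenvalues \<kappa> W n m. - a + b) = 0"
    using a by (auto simp: prod_mset_zero_iff)
  ultimately show False using prod_scaled_eigenvalues[OF \<kappa>, of "- a" W n m] by simp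
qed

lemma scaled_eigenvalues_interlace:
  fixes W :: "nat \<Rightarrow> nat \<Rightarrow> real" and n m :: nat
  assumes \<kappa>: "\<kappa> > 0" and n: "n \<ge> 1"
  defines "X \<equiv> scaled_eigenvalues \<kappa> W n m" and "Y \<equiv> scaled_eigenvalues \<kappa> W (n - 1) m"
  shows "size (filter_mset (\<lambda>b. x < b) Y) \<le> size (filter_mset (\<lambda>a. x < a) X)"
    and "size (filter_mset (\<lambda>a. x < a) X) \<le> size (filter_mset (\<lambda>b. x < b) Y) + 1"
proof -
  let ?X = "eigenvalues_mset (gram_mat W n m)" and ?Y = "eigenvalues_mset (gram_mat W (n - 1) m)"
  have sz: "size ?X = size ?Y + 1"
    using n by (simp add: size_gram_eigenvalues)
  have "Im ((\<Prod>b\<in>#?Y. z - of_real b) / (\<Prod>a\<in>#?X. z - of_real a)) < 0" if "Im z > 0" for z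
    using Im_resolvent_corner_neg[OF gram_mat_carrier n gram_mat_sym that, of W m]
    unfolding gram_mat_delete[OF n] by (simp add: char_val_prod[OF gram_mat_carrier gram_mat_sym])
  note ic = interlacing_counts[OF sz this, of "x / \<kappa>"]
  have "size (filter_mset (\<lambda>b. x < b) (image_mset (\<lambda>a. \<kappa> * a) Z)) = size (filter_mset (\<lambda>b. x / \<kappa> < b) Z)" for Z
    using \<kappa> by (induction Z) (auto simp: field_simps)
  then show "size (filter_mset (\<lambda>b. x < b) Y) \<le> size (filter_mset (\<lambda>a. x < a) X)"
    and "size (filter_mset (\<lambda>a. x < a) X) \<le> size (filter_mset (\<lambda>b. x < b) Y) + 1"
    using ic by (simp_all add: X_def Y_def scaled_eigenvalues_def)
qed

section \<open>The density of a rectangular diagram\<close>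

text \<open>
  As a function of \<open>x\<close> this is a sum of indicators of half-lines, so its integrals are sums over the
  multiset.
\<close>

definition excess :: "real multiset \<Rightarrow> real \<Rightarrow> real" where
  "excess X x = real (size (filter_mset (\<lambda>a. x < a) X))"

text \<open>
  This is \<open>(1 - w') / 2\<close> for the rectangular diagram \<open>w\<close> with minima \<open>X\<close> and maxima \<open>Y\<close>, away from its
  extrema, if \<open>X\<close> has one element more than \<open>Y\<close>.
\<close>

definition diagram_density :: "real multiset \<Rightarrow> real multiset \<Rightarrow> real \<Rightarrow> real" where
  "diagram_density X Y x = excess X x - excess Y x"

lemma excess_add: "excess (add_mset a X) x = indicator {..<a} x + excess X x"
  by (simp add: excess_def)

lemma excess_measurable [measurable]: "excess X \<in> borel_measurable borel"
proof (induction X)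
  case empty
  then show ?case by (simp add: excess_def)
next
  case (add a X)
  have "excess (add_mset a X) = (\<lambda>x. indicator {..<a} x + excess X x)" by (auto simp: excess_add)
  then show ?case using add by simp
qed

lemma LINT_below:
  fixes a :: real and \<phi> :: "real \<Rightarrow> real"
  assumes a: "a \<ge> 0" and \<phi>: "continuous_on {0..} \<phi>"
  shows "set_integrable lborel {0..} (\<lambda>x. indicator {..<a} x * \<phi> x)"
    and "(LINT x:{0..}|lborel. indicator {..<a} x * \<phi> x) = integral {0..a} \<phi>"
proof -
  have i: "set_integrable lborel {0..a} \<phi>"
    by (rule borel_integrable_atLeastAtMost') (auto intro: continuous_on_subset[OF \<phi>])
  have i': "set_integrable lborel {0..<a} \<phi>" by (rule set_integrable_subset[OF i]) auto
  have eq: "(\<lambda>x. indicator {0..} x *\<^sub>R (indicator {..<a} x * \<phi> x)) = (\<lambda>x. indicator {0..<a} x *\<^sub>R \<phi> x)"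
    by (auto simp: indicator_def)
  show "set_integrable lborel {0..} (\<lambda>x. indicator {..<a} x * \<phi> x)"
    using i' unfolding set_integrable_def eq .
  have "(LINT x:{0..}|lborel. indicator {..<a} x * \<phi> x) = (LINT x:{0..<a}|lborel. \<phi> x)"
    unfolding set_lebesgue_integral_def eq ..
  also have "\<dots> = (LINT x:{0..a}|lborel. \<phi> x)"
  proof (rule set_integral_cong_set)
    show "set_borel_measurable lborel {0..a} \<phi>" "set_borel_measurable lborel {0..<a} \<phi>"
      using i i' by (auto simp: set_integrable_def set_borel_measurable_def)
    have "AE x in lborel. x \<noteq> a" by (rule AE_lborel_singleton)
    then show "AE x in lborel. (x \<in> {0..a}) = (x \<in> {0..<a})" by eventually_elim auto
  qed
  also have "\<dots> = integral {0..a} \<phi>" using i by (rule set_borel_integral_eq_integral(2))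
  finally show "(LINT x:{0..}|lborel. indicator {..<a} x * \<phi> x) = integral {0..a} \<phi>" .
qed

lemma pairing_excess:
  assumes X: "\<And>a. a \<in># X \<Longrightarrow> a \<ge> 0" and \<phi>: "continuous_on {0..} \<phi>"
  shows "set_integrable lborel {0..} (\<lambda>x. excess X x * \<phi> x)"
    and "pairing (excess X) \<phi> = (\<Sum>a\<in>#X. integral {0..a} \<phi>)"
proof -
  have "set_integrable lborel {0..} (\<lambda>x. excess X x * \<phi> x) \<and> pairing (excess X) \<phi> = (\<Sum>a\<in>#X. integral {0..a} \<phi>)"
    using X
  proof (induction X)
    case empty
    then show ?case by (simp add: excess_def pairing_def set_integrable_def)
  next
    case (add a X)
    have a: "a \<ge> 0" and IH: "set_integrable lborel {0..} (\<lambda>x. excess X x * \<phi> x)"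
      "pairing (excess X) \<phi> = (\<Sum>a\<in>#X. integral {0..a} \<phi>)"
      using add by auto
    have "excess (add_mset a X) x * \<phi> x = indicator {..<a} x * \<phi> x + excess X x * \<phi> x" for x
      by (simp add: excess_add algebra_simps)
    then show ?case
      using LINT_below[OF a \<phi>] IH set_integral_add[OF LINT_below(1)[OF a \<phi>] IH(1)]
      by (simp add: pairing_def)
  qed
  then show "set_integrable lborel {0..} (\<lambda>x. excess X x * \<phi> x)"
    and "pairing (excess X) \<phi> = (\<Sum>a\<in>#X. integral {0..a} \<phi>)" by auto
qed

lemma mass_below_excess:
  assumes X: "\<And>a. a \<in># X \<Longrightarrow> a \<ge> 0" and x: "x \<ge> 0"
  shows "set_integrable lborel {0..x} (excess X)" "mass_below (excess X) x = (\<Sum>a\<in>#X. min x a)"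
proof -
  have "set_integrable lborel {0..x} (excess X) \<and> mass_below (excess X) x = (\<Sum>a\<in>#X. min x a)"
    using X
  proof (induction X)
    case empty
    then show ?case by (simp add: excess_def[abs_def] mass_below_def set_integrable_def)
  next
    case (add a X)
    have a: "a \<ge> 0" and IH: "set_integrable lborel {0..x} (excess X)" "mass_below (excess X) x = (\<Sum>a\<in>#X. min x a)"
      using add by auto
    have eq: "(\<lambda>t. indicator {0..x} t *\<^sub>R indicator {..<a} t) = (indicator ({0..x} \<inter> {..<a}) :: real \<Rightarrow> real)"
      by (auto simp: indicator_def)
    have cases: "{0..x} \<inter> {..<a} = (if x < a then {0..x} else {0..<a})" by auto
    have i: "set_integrable lborel {0..x} (indicator {..<a} :: real \<Rightarrow> real)"
      unfolding set_integrable_def eq cases using a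
      by (intro integrable_real_indicator) (auto simp: emeasure_lborel_Icc_eq)
    have v: "(LINT t:{0..x}|lborel. indicator {..<a} t :: real) = min x a"
      unfolding set_lebesgue_integral_def eq cases using a x by auto
    have "excess (add_mset a X) = (\<lambda>t. indicator {..<a} t + excess X t)" by (auto simp: excess_add)
    then show ?case
      using set_integral_add[OF i IH(1)] v IH by (simp add: mass_below_def)
  qed
  then show "set_integrable lborel {0..x} (excess X)" "mass_below (excess X) x = (\<Sum>a\<in>#X. min x a)" by auto
qed

lemma pairing_diagram:
  assumes X: "\<And>a. a \<in># X \<Longrightarrow> a \<ge> 0" and Y: "\<And>b. b \<in># Y \<Longrightarrow> b \<ge> 0" and \<phi>: "continuous_on {0..} \<phi>"
  shows "pairing (diagram_density X Y) \<phi> = (\<Sum>a\<in>#X. integral {0..a} \<phi>) - (\<Sum>b\<in>#Y. integral {0..b} \<phi>)"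
proof -
  have "pairing (diagram_density X Y) \<phi> = (LINT x:{0..}|lborel. excess X x * \<phi> x - excess Y x * \<phi> x)"
    by (simp add: pairing_def diagram_density_def algebra_simps)
  also have "\<dots> = pairing (excess X) \<phi> - pairing (excess Y) \<phi>"
    unfolding pairing_def by (rule set_integral_diff) (intro pairing_excess X Y \<phi>; assumption)+
  finally show ?thesis using pairing_excess(2)[OF X \<phi>] pairing_excess(2)[OF Y \<phi>] by simp
qed

locale interlacing_multisets =
  fixes X Y :: "real multiset"
  assumes X: "\<And>a. a \<in># X \<Longrightarrow> a \<ge> 0" and Y: "\<And>b. b \<in># Y \<Longrightarrow> b \<ge> 0"
    and size: "size X = size Y + 1"
    and interlace: "\<And>x. size (filter_mset (\<lambda>b. x < b) Y) \<le> size (filter_mset (\<lambda>a. x < a) X)"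
      "\<And>x. size (filter_mset (\<lambda>a. x < a) X) \<le> size (filter_mset (\<lambda>b. x < b) Y) + 1"
begin

lemma unit_density_diagram: "unit_density (diagram_density X Y)"
proof -
  have "set_integrable lborel {0..} (excess X)" "set_integrable lborel {0..} (excess Y)"
    using pairing_excess(1)[OF X, of X "\<lambda>_. 1"] pairing_excess(1)[OF Y, of Y "\<lambda>_. 1"] by simp_all
  then have "set_integrable lborel {0..} (diagram_density X Y)"
    unfolding diagram_density_def[abs_def] by (rule set_integral_diff)
  moreover have "0 \<le> diagram_density X Y x \<and> diagram_density X Y x \<le> 1" for x
  proof -
    have "real (size (filter_mset (\<lambda>b. x < b) Y)) \<le> real (size (filter_mset (\<lambda>a. x < a) X))"
      "real (size (filter_mset (\<lambda>a. x < a) X)) \<le> real (size (filter_mset (\<lambda>b. x < b) Y) + 1)"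
      using interlace[of x] by (simp_all only: of_nat_le_iff)
    then show ?thesis by (simp add: diagram_density_def excess_def)
  qed
  moreover have "diagram_density X Y \<in> borel_measurable borel"
    unfolding diagram_density_def[abs_def] by measurable
  ultimately show ?thesis by (simp add: unit_density_def)
qed

lemma mass_diagram: "pairing (diagram_density X Y) (\<lambda>x. 1) = (\<Sum>a\<in>#X. a) - (\<Sum>b\<in>#Y. b)"
proof -
  have "(\<Sum>a\<in>#Z. integral {0..a} (\<lambda>x. 1)) = (\<Sum>a\<in>#Z. a)" if "\<And>a. a \<in># Z \<Longrightarrow> a \<ge> 0" for Z :: "real multiset"
    using that by (induction Z) auto
  then show ?thesis using pairing_diagram[OF X Y, of X Y "\<lambda>x. 1"] X Y by simp
qed

lemma mass_below_diagram: "x \<ge> 0 \<Longrightarrow> mass_below (diagram_density X Y) x = (\<Sum>a\<in>#X. min x a) - (\<Sum>b\<in>#Y. min x b)"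
  using mass_below_excess[OF X, of X x] mass_below_excess[OF Y, of Y x]
    set_integral_diff[of lborel "{0..x}" "excess X" "excess Y"]
  by (simp add: mass_below_def diagram_density_def)

text \<open>
  For \<open>x, a \<ge> 0\<close> one has \<open>\<bar>x - a\<bar> = a + x - 2 * min x a\<close>, and \<open>min x a\<close> is the integral over \<open>[0, x]\<close> of
  the indicator of \<open>t < a\<close>.
\<close>

lemma rect_diagram_nonneg:
  assumes x: "x \<ge> 0"
  shows "rect_diagram X Y x = pairing (diagram_density X Y) (\<lambda>x. 1) + x - 2 * mass_below (diagram_density X Y) x"
proof -
  have "(\<Sum>a\<in>#Z. \<bar>x - a\<bar>) = (\<Sum>a\<in>#Z. a) + real (size Z) * x - 2 * (\<Sum>a\<in>#Z. min x a)" for Z :: "real multiset"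
    by (induction Z) (auto simp: algebra_simps min_def)
  then show ?thesis
    unfolding rect_diagram_def mass_diagram mass_below_diagram[OF x] by (simp add: size algebra_simps)
qed

lemma rect_diagram_neg:
  assumes x: "x < 0"
  shows "rect_diagram X Y x = pairing (diagram_density X Y) (\<lambda>x. 1) - x"
proof -
  have "(\<Sum>a\<in>#Z. \<bar>x - a\<bar>) = (\<Sum>a\<in>#Z. a) - real (size Z) * x" if "\<And>a. a \<in># Z \<Longrightarrow> a \<ge> 0" for Z :: "real multiset"
    using that
  proof (induction Z)
    case (add a Z)
    then have "a \<ge> 0" by simp
    then have "\<bar>x - a\<bar> = a - x" using x by simp
    then show ?case using add by (simp add: algebra_simps)
  qed simp
  from this[of X] this[of Y] X Y show ?thesis
    unfolding rect_diagram_def mass_diagram by (simp add: size algebra_simps)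
qed

text \<open>
  An element \<open>a\<close> contributes the integral of \<open>1 / (s + x)\<close> over \<open>[0, a]\<close>, which is \<open>ln (s + a) - ln s\<close>.
  The extra factor \<open>s\<close> in the denominator is there because \<open>X\<close> has one element more than \<open>Y\<close>.
\<close>

lemma kernel_diagram:
  assumes s: "s > 0"
  shows "pairing (diagram_density X Y) (\<lambda>x. 1 / (s + x)) = ln ((\<Prod>a\<in>#X. s + a) / (s * (\<Prod>b\<in>#Y. s + b)))"
proof -
  have i: "integral {0..a} (\<lambda>x. 1 / (s + x)) = ln (s + a) - ln s" if "a \<ge> 0" for a
  proof -
    have "((\<lambda>x. 1 / (s + x)) has_integral (ln (s + a) - ln (s + 0))) {0..a}"
      using s that
      by (intro fundamental_theorem_of_calculus)
        (auto intro!: derivative_eq_intros simp: has_real_derivative_iff_has_vector_derivative[symmetric])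
    then show ?thesis by (simp add: integral_unique)
  qed
  have "(\<Sum>a\<in>#Z. integral {0..a} (\<lambda>x. 1 / (s + x))) = ln (\<Prod>a\<in>#Z. s + a) - real (size Z) * ln s \<and> (\<Prod>a\<in>#Z. s + a) > 0"
    if "\<And>a. a \<in># Z \<Longrightarrow> a \<ge> 0" for Z :: "real multiset"
    using that
  proof (induction Z)
    case (add a Z)
    then have "a \<ge> 0" by simp
    then have "s + a > 0" using s by simp
    moreover define P where "P = (\<Prod>a\<in>#Z. s + a)"
    moreover have "(\<Sum>a\<in>#Z. integral {0..a} (\<lambda>x. 1 / (s + x))) = ln P - real (size Z) * ln s" "P > 0"
      using add by (auto simp: P_def)
    ultimately show ?case
      using i[OF \<open>a \<ge> 0\<close>] ln_mult[of "s + a" P] mult_pos_pos[of "s + a" P] by (simp add: P_def[symmetric] distrib_right)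
  qed simp
  note key = this
  define P R where "P = (\<Prod>a\<in>#X. s + a)" and "R = (\<Prod>b\<in>#Y. s + b)"
  have P: "(\<Sum>a\<in>#X. integral {0..a} (\<lambda>x. 1 / (s + x))) = ln P - real (size X) * ln s" "P > 0"
    using key[of X] X by (auto simp: P_def)
  have R: "(\<Sum>a\<in>#Y. integral {0..a} (\<lambda>x. 1 / (s + x))) = ln R - real (size Y) * ln s" "R > 0"
    using key[of Y] Y by (auto simp: R_def)
  have "continuous_on {0..} (\<lambda>x. 1 / (s + x))" using test_fun_kernel[OF s] by (simp add: test_fun_def)
  then have pd: "pairing (diagram_density X Y) (\<lambda>x. 1 / (s + x)) =
      (\<Sum>a\<in>#X. integral {0..a} (\<lambda>x. 1 / (s + x))) - (\<Sum>a\<in>#Y. integral {0..a} (\<lambda>x. 1 / (s + x)))"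
    by (intro pairing_diagram X Y)
  show ?thesis
    unfolding pd P(1) R(1) P_def[symmetric] R_def[symmetric]
    using s P(2) R(2) by (simp add: ln_div ln_mult size distrib_right)
qed

end

lemma scaled_interlacing:
  assumes "\<kappa> > 0" "n \<ge> 1"
  shows "interlacing_multisets (scaled_eigenvalues \<kappa> W n m) (scaled_eigenvalues \<kappa> W (n - 1) m)"
  by standard
    (use assms scaled_eigenvalues_nonneg scaled_eigenvalues_interlace in \<open>auto simp: size_scaled_eigenvalues\<close>)

text \<open>
  The products over the eigenvalues are determinants, and \<open>corner_minor_ratio\<close> evaluates their
  quotient.
\<close>

theorem kernel_gram:
  assumes s: "s > 0" and \<kappa>: "\<kappa> > 0" and n: "n \<ge> 1"
  shows "pairing (diagram_density (scaled_eigenvalues \<kappa> W n m) (scaled_eigenvalues \<kappa> W (n - 1) m)) (\<lambda>x. 1 / (s + x))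
    = ln (1 + leave_one_form s \<kappa> W n m (n - 1))"
proof -
  interpret interlacing_multisets "scaled_eigenvalues \<kappa> W n m" "scaled_eigenvalues \<kappa> W (n - 1) m"
    using scaled_interlacing[OF \<kappa> n] .
  define Z where "Z = reg_gram s \<kappa> (\<lambda>j i. W i j) m n"
  define \<tau> where "\<tau> = leave_one_form s \<kappa> W n m (n - 1)"
  have "det Z \<noteq> 0" using det_reg_gram_nonzero[OF s] \<kappa> by (simp add: Z_def)
  moreover have "\<tau> \<ge> 0" using leave_one_out(1)[OF s, of \<kappa>] \<kappa> n by (simp add: \<tau>_def)
  moreover have "s * (\<Prod>b\<in>#scaled_eigenvalues \<kappa> W (n - 1) m. s + b) = det Z / (1 + \<tau>)"
    using corner_minor_ratio[OF s less_imp_le[OF \<kappa>] n, of W m] reg_gram_delete[OF n, of s \<kappa> W m]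
    by (simp add: prod_scaled_eigenvalues[OF \<kappa>] Z_def \<tau>_def)
  ultimately show ?thesis
    unfolding kernel_diagram[OF s] prod_scaled_eigenvalues[OF \<kappa>, of s W n m] Z_def[symmetric] \<tau>_def[symmetric] by simp
qed

section \<open>The limit shape and its Stieltjes transform\<close>

definition lower_edge :: "real \<Rightarrow> real" where "lower_edge \<alpha> = (\<alpha> + 1) - 2 * sqrt \<alpha>"
definition upper_edge :: "real \<Rightarrow> real" where "upper_edge \<alpha> = (\<alpha> + 1) + 2 * sqrt \<alpha>"

text \<open>
  The inversion \<open>y \<mapsto> A B / y\<close> exchanges the endpoints of \<open>[A, B]\<close>; this function is the inversion followed by
  the decreasing affine map of \<open>[A, B]\<close> onto \<open>[-1, 1]\<close>. For \<open>A = 0 < B\<close> it is constantly \<open>1\<close>,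
  also at \<open>y = 0\<close>, because division by zero gives zero.
\<close>

definition edge_ratio :: "real \<Rightarrow> real \<Rightarrow> real \<Rightarrow> real" where
  "edge_ratio A B y = ((A + B) - 2 * (A * B) / y) / (B - A)"

text \<open>
  The increasing affine map of \<open>[A, B]\<close> onto \<open>[-1, 1]\<close>.
\<close>

definition centred :: "real \<Rightarrow> real \<Rightarrow> real \<Rightarrow> real" where
  "centred A B y = (2 * y - (A + B)) / (B - A)"

lemma abs_le_one_of_square:
  fixes w :: real
  assumes "1 - w\<^sup>2 \<ge> 0"
  shows "-1 \<le> w" "w \<le> 1"
  using assms abs_square_le_1[of w] by (auto simp: abs_le_iff)

lemma abs_less_one_of_square:
  fixes w :: real
  assumes "1 - w\<^sup>2 > 0"
  shows "-1 < w" "w < 1"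
  using assms abs_square_less_1[of w] by (auto simp: abs_less_iff)

lemma one_minus_centred_square:
  assumes "A < (B :: real)"
  shows "1 - (centred A B y)\<^sup>2 = 4 * ((y - A) * (B - y)) / (B - A)\<^sup>2"
proof -
  have "1 - (centred A B y)\<^sup>2 = ((B - A)\<^sup>2 - (2 * y - (A + B))\<^sup>2) / (B - A)\<^sup>2"
    using assms unfolding centred_def power_divide by (simp add: diff_divide_distrib)
  also have "(B - A)\<^sup>2 - (2 * y - (A + B))\<^sup>2 = 4 * ((y - A) * (B - y))"
    by (simp add: power2_eq_square algebra_simps)
  finally show ?thesis .
qed

lemma one_minus_edge_ratio_square:
  assumes "A < (B :: real)" "y \<noteq> 0"
  shows "1 - (edge_ratio A B y)\<^sup>2 = 4 * (A * B) * ((y - A) * (B - y)) / ((B - A)\<^sup>2 * y\<^sup>2)"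
proof -
  have "edge_ratio A B y = ((A + B) * y - 2 * (A * B)) / ((B - A) * y)"
    using assms by (simp add: edge_ratio_def field_simps)
  moreover have "1 - (p / q)\<^sup>2 = (q\<^sup>2 - p\<^sup>2) / q\<^sup>2" if "q \<noteq> 0" for p q :: real
    using that by (simp add: power_divide diff_divide_distrib)
  ultimately have "1 - (edge_ratio A B y)\<^sup>2 = (((B - A) * y)\<^sup>2 - ((A + B) * y - 2 * (A * B))\<^sup>2) / ((B - A) * y)\<^sup>2"
    using assms by simp
  also have "((B - A) * y)\<^sup>2 - ((A + B) * y - 2 * (A * B))\<^sup>2 = 4 * (A * B) * ((y - A) * (B - y))"
    by (simp add: power2_eq_square algebra_simps)
  finally show ?thesis by (simp add: power_mult_distrib)
qed

lemma centred_bounds: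
  assumes "A < (B :: real)" "A \<le> y" "y \<le> B"
  shows "-1 \<le> centred A B y" "centred A B y \<le> 1"
  by (rule abs_le_one_of_square, use assms in \<open>simp add: one_minus_centred_square\<close>)+

lemma edge_ratio_bounds:
  assumes "A < (B :: real)" "0 \<le> A" "A \<le> y" "y \<le> B"
  shows "-1 \<le> edge_ratio A B y" "edge_ratio A B y \<le> 1"
proof -
  have "1 - (edge_ratio A B y)\<^sup>2 \<ge> 0"
  proof (cases "y = 0")
    case True
    then show ?thesis using assms by (simp add: edge_ratio_def)
  next
    case False
    then show ?thesis using assms by (simp add: one_minus_edge_ratio_square)
  qed
  then show "-1 \<le> edge_ratio A B y" "edge_ratio A B y \<le> 1" by (rule abs_le_one_of_square)+
qed

lemma arcsin_centred_deriv:
  assumes "A < y" "y < (B :: real)"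
  shows "((\<lambda>y. arcsin (centred A B y)) has_real_derivative 1 / sqrt ((y - A) * (B - y))) (at y)"
proof -
  have R: "(y - A) * (B - y) > 0" using assms by simp
  have p: "1 - (centred A B y)\<^sup>2 > 0" using R assms by (simp add: one_minus_centred_square)
  have "(centred A B has_real_derivative 2 / (B - A)) (at y)"
    unfolding centred_def by (rule DERIV_cdivide) (auto intro!: derivative_eq_intros)
  then have "((\<lambda>y. arcsin (centred A B y)) has_real_derivative
      inverse (sqrt (1 - (centred A B y)\<^sup>2)) * (2 / (B - A))) (at y)"
    using abs_less_one_of_square[OF p] by (intro DERIV_chain2[OF DERIV_arcsin]) auto
  also have "sqrt (1 - (centred A B y)\<^sup>2) = 2 * sqrt ((y - A) * (B - y)) / (B - A)"
    using assms by (simp add: one_minus_centred_square real_sqrt_divide real_sqrt_mult)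
  also have "inverse (2 * sqrt ((y - A) * (B - y)) / (B - A)) * (2 / (B - A)) = 1 / sqrt ((y - A) * (B - y))"
  proof -
    have eq: "inverse (2 * r / d) * (2 / d) = 1 / r" if "r > 0" "d > 0" for r d :: real
      using that by (simp add: field_simps)
    show ?thesis by (rule eq) (use R assms in auto)
  qed
  finally show ?thesis .
qed

text \<open>
  Primitives of \<open>1 / (y * sqrt ((y - A) * (B - y)))\<close> are needed on the interval between the edges and
  on its translates by \<open>s\<close>; hence the general \<open>A\<close> and \<open>B\<close>.
\<close>

lemma arcsin_edge_ratio_deriv:
  assumes "0 < A" "A < y" "y < (B :: real)"
  shows "((\<lambda>y. arcsin (edge_ratio A B y)) has_real_derivative
    sqrt (A * B) / (y * sqrt ((y - A) * (B - y)))) (at y)"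
proof -
  define R where "R = (y - A) * (B - y)"
  have R: "R > 0" using assms by (simp add: R_def)
  have AB: "A * B > 0" using assms by simp
  have y: "y > 0" using assms by simp
  have p: "1 - (edge_ratio A B y)\<^sup>2 > 0"
    using R AB y assms by (simp add: one_minus_edge_ratio_square R_def)
  have "(edge_ratio A B has_real_derivative 2 * (A * B) / y\<^sup>2 / (B - A)) (at y)"
    unfolding edge_ratio_def using assms y
    by (auto intro!: derivative_eq_intros simp: power2_eq_square)
  then have "((\<lambda>y. arcsin (edge_ratio A B y)) has_real_derivative
      inverse (sqrt (1 - (edge_ratio A B y)\<^sup>2)) * (2 * (A * B) / y\<^sup>2 / (B - A))) (at y)"
    using abs_less_one_of_square[OF p] by (intro DERIV_chain2[OF DERIV_arcsin]) auto
  also have "sqrt (1 - (edge_ratio A B y)\<^sup>2) = 2 * sqrt (A * B) * sqrt R / ((B - A) * y)"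
  proof -
    have "1 - (edge_ratio A B y)\<^sup>2 = (2 * sqrt (A * B) * sqrt R / ((B - A) * y))\<^sup>2"
      using R AB y assms
      by (simp add: one_minus_edge_ratio_square R_def[symmetric] power_divide power_mult_distrib
          del: real_sqrt_mult)
    then show ?thesis using R AB y assms by simp
  qed
  also have "inverse (2 * sqrt (A * B) * sqrt R / ((B - A) * y)) * (2 * (A * B) / y\<^sup>2 / (B - A))
      = sqrt (A * B) / (y * sqrt R)"
  proof -
    have "A * B = sqrt (A * B) * sqrt (A * B)" using AB by simp
    moreover have "inverse (2 * q * r / (d * y)) * (2 * (q * q) / y\<^sup>2 / d) = q / (y * r)"
      if "q > 0" "r > 0" "d > 0" for q r d
      using that y by (simp add: field_simps power2_eq_square)
    moreover have "sqrt (A * B) > 0" "sqrt R > 0" "B - A > 0" using AB R assms by auto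
    ultimately show ?thesis by metis
  qed
  finally show ?thesis unfolding R_def .
qed

lemma continuous_on_arcsin_centred:
  "A < (B :: real) \<Longrightarrow> continuous_on {A..B} (\<lambda>y. arcsin (centred A B y))"
  using centred_bounds unfolding centred_def
  by (intro continuous_on_arcsin continuous_intros) auto

lemma continuous_on_arcsin_edge_ratio:
  assumes "A < (B :: real)" "0 \<le> A"
  shows "continuous_on {A..B} (\<lambda>y. arcsin (edge_ratio A B y))"
proof (cases "A = 0")
  case True
  then show ?thesis using assms by (simp add: edge_ratio_def)
next
  case False
  then show ?thesis using assms edge_ratio_bounds[of A B] unfolding edge_ratio_def
    by (intro continuous_on_arcsin continuous_intros) auto
qed

lemma edge_ratio_at_edges:
  assumes "0 < A" "A < (B :: real)"
  shows "edge_ratio A B A = -1" "edge_ratio A B B = 1"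
  using assms by (auto simp: edge_ratio_def field_simps)

lemma edge_facts:
  assumes \<alpha>: "\<alpha> \<ge> 1"
  shows "0 \<le> lower_edge \<alpha>" "lower_edge \<alpha> < upper_edge \<alpha>" "lower_edge \<alpha> \<le> \<alpha>" "\<alpha> \<le> upper_edge \<alpha>"
    "lower_edge \<alpha> + upper_edge \<alpha> = 2 * (\<alpha> + 1)" "lower_edge \<alpha> * upper_edge \<alpha> = (\<alpha> - 1)\<^sup>2"
    "upper_edge \<alpha> - lower_edge \<alpha> = 4 * sqrt \<alpha>" "\<alpha> > 1 \<Longrightarrow> 0 < lower_edge \<alpha>" "\<alpha> = 1 \<Longrightarrow> lower_edge \<alpha> = 0"
proof -
  have s2: "sqrt \<alpha> * sqrt \<alpha> = \<alpha>" and s1: "sqrt \<alpha> \<ge> 1" using \<alpha> by auto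
  have eq: "lower_edge \<alpha> = (sqrt \<alpha> - 1)\<^sup>2"
    using \<alpha> by (simp add: lower_edge_def power2_eq_square algebra_simps)
  show "0 \<le> lower_edge \<alpha>" by (simp add: eq)
  show "lower_edge \<alpha> < upper_edge \<alpha>" "lower_edge \<alpha> \<le> \<alpha>" "\<alpha> \<le> upper_edge \<alpha>"
    using s1 unfolding lower_edge_def upper_edge_def by linarith+
  show "lower_edge \<alpha> + upper_edge \<alpha> = 2 * (\<alpha> + 1)" "upper_edge \<alpha> - lower_edge \<alpha> = 4 * sqrt \<alpha>"
    by (simp_all add: lower_edge_def upper_edge_def)
  show "lower_edge \<alpha> * upper_edge \<alpha> = (\<alpha> - 1)\<^sup>2"
    using s2 by (simp add: lower_edge_def upper_edge_def power2_eq_square algebra_simps)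
  show "0 < lower_edge \<alpha>" if "\<alpha> > 1" using that by (simp add: eq)
  show "lower_edge \<alpha> = 0" if "\<alpha> = 1" using that by (simp add: lower_edge_def)
qed

text \<open>
  The function \<open>(1 - \<Omega>') / 2\<close> between the two edges: its derivative is \<open>-\<Omega>'' / 2\<close>, and it vanishes at the
  upper edge.
\<close>

definition limit_bulk :: "real \<Rightarrow> real \<Rightarrow> real" where
  "limit_bulk \<alpha> x = (arccos (centred (lower_edge \<alpha>) (upper_edge \<alpha>) x)
     + arccos (edge_ratio (lower_edge \<alpha>) (upper_edge \<alpha>) x)) / (2 * pi)"

definition limit_density :: "real \<Rightarrow> real \<Rightarrow> real" where
  "limit_density \<alpha> x = (if x < lower_edge \<alpha> then 1 else if x \<le> upper_edge \<alpha> then limit_bulk \<alpha> x else 0)"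

text \<open>
  Obtained from \<open>limit_bulk\<close> by integration by parts.
\<close>

definition limit_bulk_primitive :: "real \<Rightarrow> real \<Rightarrow> real" where
  "limit_bulk_primitive \<alpha> x = x * limit_bulk \<alpha> x +
     (2 * \<alpha> * arcsin (centred (lower_edge \<alpha>) (upper_edge \<alpha>) x)
       - sqrt ((x - lower_edge \<alpha>) * (upper_edge \<alpha> - x))) / (2 * pi)"

text \<open>
  The limit of the normalized trace \<open>t\<close>: the positive root of \<open>1 / (1 + t) = s t - (\<alpha> - 1)\<close>.
\<close>

definition mp_trace :: "real \<Rightarrow> real \<Rightarrow> real" where
  "mp_trace \<alpha> s = (s + (\<alpha> - 1) + sqrt ((s + lower_edge \<alpha>) * (s + upper_edge \<alpha>))) / (2 * s) - 1"

context
  fixes \<alpha> a b c :: real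
  assumes \<alpha>: "\<alpha> \<ge> 1"
  defines "a \<equiv> lower_edge \<alpha>" and "b \<equiv> upper_edge \<alpha>" and "c \<equiv> \<alpha> - 1"
begin

lemmas edges = edge_facts[OF \<alpha>, folded a_def b_def c_def]

lemma gap_nonneg: "c \<ge> 0" using \<alpha> by (simp add: c_def)

lemma sqrt_ab: "sqrt (a * b) = c" using edges(6) gap_nonneg by simp

lemma bulk_eq: "a \<le> x \<Longrightarrow> x \<le> b \<Longrightarrow>
    limit_bulk \<alpha> x = 1 / 2 - (arcsin (centred a b x) + arcsin (edge_ratio a b x)) / (2 * pi)"
  unfolding limit_bulk_def a_def[symmetric] b_def[symmetric]
  using centred_bounds[OF edges(2), of x] edge_ratio_bounds[OF edges(2,1), of x]
  by (simp add: arccos_arcsin_eq field_simps)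

lemma bulk_bounds: "a \<le> x \<Longrightarrow> x \<le> b \<Longrightarrow> 0 \<le> limit_bulk \<alpha> x \<and> limit_bulk \<alpha> x \<le> 1"
  unfolding limit_bulk_def a_def[symmetric] b_def[symmetric]
  using centred_bounds[OF edges(2), of x] edge_ratio_bounds[OF edges(2,1), of x]
    arccos_bounded[of "centred a b x"] arccos_bounded[of "edge_ratio a b x"]
  by (auto simp: divide_simps)

lemma bulk_cont: "continuous_on {a..b} (limit_bulk \<alpha>)"
proof -
  have "continuous_on {a..b} (\<lambda>x. 1 / 2 - (arcsin (centred a b x) + arcsin (edge_ratio a b x)) / (2 * pi))"
    by (intro continuous_intros continuous_on_arcsin_centred continuous_on_arcsin_edge_ratio edges) auto
  then show ?thesis by (rule continuous_on_eq) (auto simp: bulk_eq)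
qed

lemma edge_ratio_arcsin_deriv:
  assumes x: "a < x" "x < b"
  shows "((\<lambda>x. arcsin (edge_ratio a b x)) has_real_derivative c / (x * sqrt ((x - a) * (b - x)))) (at x)"
proof (cases "\<alpha> = 1")
  case True
  then have "a = 0" "c = 0" using edges(9) by (auto simp: c_def)
  then show ?thesis using edges(2) by (simp add: edge_ratio_def)
next
  case False
  then have "0 < a" using \<alpha> edges(8) by simp
  then show ?thesis using arcsin_edge_ratio_deriv[of a x b] x sqrt_ab by simp
qed

lemma bulk_deriv:
  assumes x: "a < x" "x < b"
  shows "(limit_bulk \<alpha> has_real_derivative - ((x + c) / (2 * pi * x * sqrt ((x - a) * (b - x))))) (at x)"
proof -
  have x0: "x > 0" and R: "sqrt ((x - a) * (b - x)) > 0" using x edges(1) by auto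
  have "((\<lambda>x. 1 / 2 - (arcsin (centred a b x) + arcsin (edge_ratio a b x)) / (2 * pi)) has_real_derivative
      0 - (1 / sqrt ((x - a) * (b - x)) + c / (x * sqrt ((x - a) * (b - x)))) / (2 * pi)) (at x)"
    by (intro DERIV_diff DERIV_const DERIV_cdivide DERIV_add arcsin_centred_deriv edge_ratio_arcsin_deriv x)
  also have "0 - (1 / sqrt ((x - a) * (b - x)) + c / (x * sqrt ((x - a) * (b - x)))) / (2 * pi)
     = - ((x + c) / (2 * pi * x * sqrt ((x - a) * (b - x))))"
  proof -
    have "0 - (1 / r + c / (x * r)) / (2 * pi) = - ((x + c) / (2 * pi * x * r))" if "r > 0" for r
      using that x0 by (simp add: field_simps)
    then show ?thesis using R by blast
  qed
  finally show ?thesis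
    by (rule has_field_derivative_transform_within_open[where S = "{a<..<b}"])
      (use x in \<open>auto simp: bulk_eq\<close>)
qed

lemma primitive_deriv:
  assumes x: "a < x" "x < b"
  shows "(limit_bulk_primitive \<alpha> has_real_derivative limit_bulk \<alpha> x) (at x)"
proof -
  define r where "r = sqrt ((x - a) * (b - x))"
  have x0: "x > 0" and R: "(x - a) * (b - x) > 0" using x edges(1) by auto
  then have r: "r > 0" by (simp add: r_def)
  have d: "((\<lambda>x. (x - a) * (b - x)) has_real_derivative (a + b - 2 * x)) (at x)"
    by (auto intro!: derivative_eq_intros)
  have "((\<lambda>x. sqrt ((x - a) * (b - x))) has_real_derivative (inverse r / 2) * (a + b - 2 * x)) (at x)"
    unfolding r_def using R by (intro DERIV_chain2[OF DERIV_real_sqrt d])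
  then have "(limit_bulk_primitive \<alpha> has_real_derivative
     (1 * limit_bulk \<alpha> x + (- ((x + c) / (2 * pi * x * r))) * x) +
      (2 * \<alpha> * (1 / r) - (inverse r / 2) * (a + b - 2 * x)) / (2 * pi)) (at x)"
    unfolding limit_bulk_primitive_def a_def[symmetric] b_def[symmetric]
    using bulk_deriv[OF x, folded r_def] arcsin_centred_deriv[OF x, folded r_def]
    by (intro DERIV_diff DERIV_const DERIV_cdivide DERIV_add DERIV_cmult DERIV_mult DERIV_ident)
  also have "(1 * limit_bulk \<alpha> x + (- ((x + c) / (2 * pi * x * r))) * x) +
      (2 * \<alpha> * (1 / r) - (inverse r / 2) * (a + b - 2 * x)) / (2 * pi) = limit_bulk \<alpha> x"
    unfolding edges(5) c_def using x0 r by (simp add: field_simps)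
  finally show ?thesis .
qed

lemma primitive_cont: "continuous_on {a..b} (limit_bulk_primitive \<alpha>)"
  unfolding limit_bulk_primitive_def a_def[symmetric] b_def[symmetric]
  by (intro continuous_intros bulk_cont continuous_on_arcsin_centred edges) auto

lemma centred_edges: "centred a b a = -1" "centred a b b = 1"
  using edges(2) by (auto simp: centred_def field_simps)

lemma edge_ratio_upper: "edge_ratio a b b = 1"
  using edges(1,2) by (simp add: edge_ratio_def)

lemma edge_ratio_lower: "a > 0 \<Longrightarrow> edge_ratio a b a = -1"
  using edges(2) by (simp add: edge_ratio_def field_simps)

lemma bulk_upper: "limit_bulk \<alpha> b = 0"
  using edges(2) by (simp add: bulk_eq centred_edges edge_ratio_upper)

lemma bulk_lower: "a > 0 \<Longrightarrow> limit_bulk \<alpha> a = 1"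
  using edges(2) by (simp add: bulk_eq centred_edges edge_ratio_lower)

lemma primitive_edges: "limit_bulk_primitive \<alpha> a = a - \<alpha> / 2" "limit_bulk_primitive \<alpha> b = \<alpha> / 2"
proof -
  have "a * limit_bulk \<alpha> a = a" using bulk_lower edges(1) by (cases "a = 0") auto
  then show "limit_bulk_primitive \<alpha> a = a - \<alpha> / 2" "limit_bulk_primitive \<alpha> b = \<alpha> / 2"
    unfolding limit_bulk_primitive_def a_def[symmetric] b_def[symmetric]
    by (simp_all add: centred_edges bulk_upper)
qed

text \<open>
  The right-hand side satisfies the defining conditions of \<open>\<Omega>\<^sub>\<alpha>\<close>, which determine it uniquely. The values of
  the primitive at the two edges are exactly those that make it continuous.
\<close>

lemma Omega_eq_explicit:
  "Omega \<alpha> x = (if a \<le> x \<and> x \<le> b then x - 2 * limit_bulk_primitive \<alpha> x else \<bar>x - \<alpha>\<bar>)"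
proof -
  define \<Omega> where "\<Omega> = (\<lambda>x. if x \<in> {a..b} then x - 2 * limit_bulk_primitive \<alpha> x else \<bar>x - \<alpha>\<bar>)"
  have edge: "a - 2 * limit_bulk_primitive \<alpha> a = \<bar>a - \<alpha>\<bar>" "b - 2 * limit_bulk_primitive \<alpha> b = \<bar>b - \<alpha>\<bar>"
    using edges(3,4) by (simp_all add: primitive_edges)
  have "continuous_on ({a..b} \<union> ({..a} \<union> {b..})) \<Omega>"
    unfolding \<Omega>_def
  proof (rule continuous_on_cases)
    show "continuous_on {a..b} (\<lambda>x. x - 2 * limit_bulk_primitive \<alpha> x)"
      by (intro continuous_intros primitive_cont)
    show "continuous_on ({..a} \<union> {b..}) (\<lambda>x. \<bar>x - \<alpha>\<bar>)" by (intro continuous_intros)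
    show "\<forall>x. x \<in> {a..b} \<and> x \<notin> {a..b} \<or> x \<in> {..a} \<union> {b..} \<and> x \<in> {a..b} \<longrightarrow>
        x - 2 * limit_bulk_primitive \<alpha> x = \<bar>x - \<alpha>\<bar>"
    proof (intro allI impI)
      fix x assume "x \<in> {a..b} \<and> x \<notin> {a..b} \<or> x \<in> {..a} \<union> {b..} \<and> x \<in> {a..b}"
      then have "x = a \<or> x = b" by auto
      then show "x - 2 * limit_bulk_primitive \<alpha> x = \<bar>x - \<alpha>\<bar>" using edge by blast
    qed
  qed (intro closed_Un closed_atLeastAtMost closed_atMost closed_atLeast)+
  also have "{a..b} \<union> ({..a} \<union> {b..}) = UNIV" by auto
  finally have cont: "continuous_on UNIV \<Omega>" .
  have "is_Omega \<alpha> \<Omega>"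
    unfolding is_Omega_def lower_edge_def[symmetric] upper_edge_def[symmetric] a_def[symmetric] b_def[symmetric]
  proof (intro conjI cont exI[of _ "\<lambda>x. 1 - 2 * limit_bulk \<alpha> x"] ballI)
    fix x assume x: "x \<in> {a<..<b}"
    then have x': "a < x" "x < b" by auto
    have "((\<lambda>x. x - 2 * limit_bulk_primitive \<alpha> x) has_real_derivative 1 - 2 * limit_bulk \<alpha> x) (at x)"
      by (intro DERIV_diff DERIV_ident DERIV_cmult primitive_deriv x')
    then show "(\<Omega> has_real_derivative 1 - 2 * limit_bulk \<alpha> x) (at x)"
      by (rule has_field_derivative_transform_within_open[where S = "{a<..<b}"])
        (use x in \<open>auto simp: \<Omega>_def\<close>)
    have "4 * \<alpha> - (x - (\<alpha> + 1))\<^sup>2 = (a + b) * x - x\<^sup>2 - a * b"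
      unfolding edges(5,6) by (simp add: c_def power2_eq_square algebra_simps)
    also have "\<dots> = (x - a) * (b - x)" by (simp add: power2_eq_square algebra_simps)
    finally have R: "4 * \<alpha> - (x - (\<alpha> + 1))\<^sup>2 = (x - a) * (b - x)" .
    have "((\<lambda>x. 1 - 2 * limit_bulk \<alpha> x) has_real_derivative
        0 - 2 * (- ((x + c) / (2 * pi * x * sqrt ((x - a) * (b - x)))))) (at x)"
      by (intro DERIV_diff DERIV_const DERIV_cmult bulk_deriv x')
    moreover have "0 - 2 * (- (p / (2 * q))) = p / q" for p q :: real by simp
    ultimately show "((\<lambda>x. 1 - 2 * limit_bulk \<alpha> x) has_real_derivative
        (x + (\<alpha> - 1)) / (pi * x * sqrt (4 * \<alpha> - (x - (\<alpha> + 1))\<^sup>2))) (at x)"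
      unfolding R c_def[symmetric] by (simp only: mult.assoc)
  next
    fix x assume "x \<in> {..a} \<union> {b..}"
    then consider "x = a" | "x = b" | "x < a" | "x > b" by fastforce
    then show "\<Omega> x = \<bar>x - \<alpha>\<bar>" using edge edges(2) by cases (auto simp: \<Omega>_def)
  qed
  then have "Omega \<alpha> = \<Omega>" using is_Omega_unique[OF \<alpha>] is_Omega_Omega[OF \<alpha>] by blast
  then show ?thesis by (simp add: \<Omega>_def)
qed

lemma limit_density_eq:
  "limit_density \<alpha> x = (if x < a then 1 else if x \<le> b then limit_bulk \<alpha> x else 0)"
  by (simp add: limit_density_def a_def b_def)

lemma limit_density_bounds: "0 \<le> limit_density \<alpha> x \<and> limit_density \<alpha> x \<le> 1"
  using bulk_bounds[of x] by (auto simp: limit_density_eq)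

lemma unit_density_limit: "unit_density (limit_density \<alpha>)"
proof -
  have "limit_density \<alpha> = (\<lambda>x. indicator {..<a} x + indicator {a..b} x *\<^sub>R limit_bulk \<alpha> x)"
    using edges(2) by (auto simp: limit_density_eq fun_eq_iff indicator_def)
  then have m: "limit_density \<alpha> \<in> borel_measurable borel"
    using borel_measurable_continuous_on_indicator[OF _ bulk_cont] by simp
  have "set_integrable lborel {0..} (limit_density \<alpha>)"
    unfolding set_integrable_def
  proof (rule Bochner_Integration.integrable_bound)
    show "integrable lborel (\<lambda>x. indicator {0..b} x :: real)"
      by (intro integrable_real_indicator) (auto simp: emeasure_lborel_Icc_eq)
    show "AE x in lborel. norm (indicator {0..} x *\<^sub>R limit_density \<alpha> x) \<le> norm (indicator {0..b} x :: real)"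
    proof (intro AE_I2)
      fix x :: real
      show "norm (indicator {0..} x *\<^sub>R limit_density \<alpha> x) \<le> norm (indicator {0..b} x :: real)"
        using limit_density_bounds[of x] edges(2) by (auto simp: indicator_def limit_density_eq)
    qed
  qed (use m in simp)
  then show ?thesis using m limit_density_bounds by (auto simp: unit_density_def)
qed

lemma limit_density_bulk: "a \<le> x \<Longrightarrow> x \<le> b \<Longrightarrow> limit_density \<alpha> x = limit_bulk \<alpha> x"
  by (simp add: limit_density_eq)

lemma limit_density_zero: "b < x \<Longrightarrow> limit_density \<alpha> x = 0"
  using edges(2) by (simp add: limit_density_eq)

lemma has_integral_below:
  assumes "x \<le> a" "(\<phi> has_integral I) {0..x}"
  shows "((\<lambda>t. limit_density \<alpha> t * \<phi> t) has_integral I) {0..x}"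
  by (rule has_integral_spike_finite[OF _ _ assms(2), of "{a}"]) (use assms in \<open>auto simp: limit_density_eq\<close>)

lemma has_integral_bulk:
  assumes "x \<le> b" "((\<lambda>t. limit_bulk \<alpha> t * \<phi> t) has_integral I) {a..x}"
  shows "((\<lambda>t. limit_density \<alpha> t * \<phi> t) has_integral I) {a..x}"
  by (rule has_integral_eq[OF _ assms(2)]) (use assms in \<open>auto simp: limit_density_bulk\<close>)

lemma mass_below_integral: "mass_below (limit_density \<alpha>) x = integral {0..x} (limit_density \<alpha>)"
  unfolding mass_below_def
  by (rule set_borel_integral_eq_integral(2), rule set_integrable_density_subset[OF unit_density_limit]) auto

lemma mass_below_limit:
  assumes x: "x \<ge> 0"
  shows "Omega \<alpha> x = \<alpha> + x - 2 * mass_below (limit_density \<alpha>) x"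
proof -
  have low: "(limit_density \<alpha> has_integral y) {0..y}" if "0 \<le> y" "y \<le> a" for y
    using has_integral_below[of y "\<lambda>_. 1" y] has_integral_const_real[of "1::real" 0 y] that by simp
  have bulk: "(limit_density \<alpha> has_integral (limit_bulk_primitive \<alpha> y - (a - \<alpha> / 2))) {a..y}"
    if y: "a \<le> y" "y \<le> b" for y
  proof -
    have "(limit_bulk \<alpha> has_integral (limit_bulk_primitive \<alpha> y - limit_bulk_primitive \<alpha> a)) {a..y}"
    proof (rule fundamental_theorem_of_calculus_interior[OF y(1)])
      show "continuous_on {a..y} (limit_bulk_primitive \<alpha>)"
        using primitive_cont y by (auto intro: continuous_on_subset)
      show "(limit_bulk_primitive \<alpha> has_vector_derivative limit_bulk \<alpha> t) (at t)" if "t \<in> {a<..<y}" for t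
        using primitive_deriv[of t] that y
        by (simp add: has_real_derivative_iff_has_vector_derivative)
    qed
    then show ?thesis
      using has_integral_bulk[OF y(2), of "\<lambda>_. 1"] primitive_edges by simp
  qed
  have high: "(limit_density \<alpha> has_integral 0) {b..x}" if "b \<le> x"
    by (rule has_integral_spike_finite[of "{b}" _ _ "\<lambda>_. 0"]) (auto simp: limit_density_zero)
  note O = Omega_eq_explicit
  consider "x < a" | "a \<le> x" "x \<le> b" | "b < x" by linarith
  then show ?thesis
  proof cases
    case 1
    then show ?thesis using low[of x] x edges(3) by (simp add: O mass_below_integral integral_unique)
  next
    case 2
    have "(limit_density \<alpha> has_integral (a + (limit_bulk_primitive \<alpha> x - (a - \<alpha> / 2)))) {0..x}"
      using low[of a] bulk[of x] edges(1) 2 by (intro has_integral_combine[of 0 a x]) auto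
    then show ?thesis using 2 by (simp add: O mass_below_integral integral_unique)
  next
    case 3
    have "(limit_density \<alpha> has_integral (a + (limit_bulk_primitive \<alpha> b - (a - \<alpha> / 2)))) {0..b}"
      using low[of a] bulk[of b] edges(1,2) by (intro has_integral_combine[of 0 a b]) auto
    then have "(limit_density \<alpha> has_integral ((a + (limit_bulk_primitive \<alpha> b - (a - \<alpha> / 2))) + 0)) {0..x}"
      using high 3 edges(1,2) by (intro has_integral_combine[of 0 b x]) auto
    then show ?thesis using 3 edges(1,2,4) primitive_edges
      by (simp add: O mass_below_integral integral_unique)
  qed
qed

lemma Omega_negative: "x < 0 \<Longrightarrow> Omega \<alpha> x = \<alpha> - x"
  using Omega_eq_explicit[of x] edges(1) \<alpha> by (simp add: a_def)

lemma limit_pairing_split: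
  assumes \<phi>: "test_fun \<phi>"
  shows "pairing (limit_density \<alpha>) \<phi> = integral {0..a} \<phi> + integral {a..b} (\<lambda>x. limit_bulk \<alpha> x * \<phi> x)"
proof -
  have c\<phi>: "continuous_on {0..} \<phi>" using \<phi> by (simp add: test_fun_def)
  have "(\<phi> has_integral integral {0..a} \<phi>) {0..a}"
    by (intro integrable_integral integrable_continuous_interval continuous_on_subset[OF c\<phi>]) auto
  then have 1: "((\<lambda>t. limit_density \<alpha> t * \<phi> t) has_integral integral {0..a} \<phi>) {0..a}"
    by (rule has_integral_below[OF order_refl])
  have "((\<lambda>x. limit_bulk \<alpha> x * \<phi> x) has_integral integral {a..b} (\<lambda>x. limit_bulk \<alpha> x * \<phi> x)) {a..b}"
    using edges(1)
    by (intro integrable_integral integrable_continuous_interval continuous_intros bulk_cont continuous_on_subset[OF c\<phi>]) auto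
  then have 2: "((\<lambda>t. limit_density \<alpha> t * \<phi> t) has_integral integral {a..b} (\<lambda>x. limit_bulk \<alpha> x * \<phi> x)) {a..b}"
    by (rule has_integral_bulk[OF order_refl])
  have "pairing (limit_density \<alpha>) \<phi> = (LINT x:{0..b}|lborel. limit_density \<alpha> x * \<phi> x)"
    unfolding pairing_def set_lebesgue_integral_def
    by (intro Bochner_Integration.integral_cong) (auto simp: indicator_def limit_density_zero)
  also have "\<dots> = integral {0..b} (\<lambda>x. limit_density \<alpha> x * \<phi> x)"
    by (rule set_borel_integral_eq_integral(2), rule set_integrable_subset[OF test_fun_integrable[OF unit_density_limit \<phi>]]) auto
  also have "\<dots> = integral {0..a} \<phi> + integral {a..b} (\<lambda>x. limit_bulk \<alpha> x * \<phi> x)"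
    using has_integral_combine[OF edges(1) less_imp_le[OF edges(2)] 1 2] by (rule integral_unique)
  finally show ?thesis .
qed

definition "edge_disc s = sqrt ((s + a) * (s + b))"

lemma edge_disc_pos: "s > 0 \<Longrightarrow> edge_disc s > 0"
  using edges(1,2) by (simp add: edge_disc_def)

lemma edge_disc_square: "s > 0 \<Longrightarrow> edge_disc s * edge_disc s = s * s + 2 * (\<alpha> + 1) * s + c * c"
proof -
  assume "s > 0"
  then have "edge_disc s * edge_disc s = (s + a) * (s + b)" using edges(1,2) by (simp add: edge_disc_def)
  also have "\<dots> = s * s + (a + b) * s + a * b" by (simp add: algebra_simps)
  finally show ?thesis unfolding edges(5,6) by (simp add: power2_eq_square)
qed

text \<open>
  An explicit primitive exists by integration by parts and the partial fraction decomposition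
  \<open>(x + c) / (x (s + x)) = (c / s) / x + (1 - c / s) / (s + x)\<close>. The result has the same form for
  \<open>\<alpha> = 1\<close>, where the lower edge is \<open>0\<close> and the density is \<open>1/2\<close> there instead of \<open>1\<close>.
\<close>

lemma bulk_kernel_square_integral:
  assumes s: "s > 0"
  shows "((\<lambda>x. limit_bulk \<alpha> x / (s + x)\<^sup>2) has_integral
     (1 / (s + a) - (1 / s + (1 - c / s) / edge_disc s) / 2)) {a..b}"
proof -
  define A B where "A = s + a" and "B = s + b"
  have AB: "0 < A" "A < B" using s edges(1,2) by (auto simp: A_def B_def)
  define k where "k = (1 - c / s) / edge_disc s"
  define T where "T = (\<lambda>x. - (limit_bulk \<alpha> x / (s + x)) -
    ((1 / s) * arcsin (edge_ratio a b x) + k * arcsin (edge_ratio A B (s + x))) / (2 * pi))"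
  have "((\<lambda>x. limit_bulk \<alpha> x / (s + x)\<^sup>2) has_integral (T b - T a)) {a..b}"
  proof (rule fundamental_theorem_of_calculus_interior[OF less_imp_le[OF edges(2)]])
    have c2: "continuous_on {a..b} (\<lambda>x. arcsin (edge_ratio A B (s + x)))"
      by (rule continuous_on_compose2[OF continuous_on_arcsin_edge_ratio[OF AB(2)]])
         (use AB in \<open>auto intro!: continuous_intros simp: A_def B_def\<close>)
    have c1: "continuous_on {a..b} (\<lambda>x. arcsin (edge_ratio a b x))"
      by (intro continuous_on_arcsin_edge_ratio edges)
    have c0: "continuous_on {a..b} (\<lambda>x. limit_bulk \<alpha> x / (s + x))"
      using s edges(1) by (intro continuous_intros bulk_cont) auto
    show "continuous_on {a..b} T"
      unfolding T_def
      by (intro continuous_on_diff continuous_on_minus continuous_on_divide[OF _ continuous_on_const]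
          continuous_on_add continuous_on_mult continuous_on_const c0 c1 c2) auto
    fix x assume x: "x \<in> {a<..<b}"
    then have x': "a < x" "x < b" by auto
    define r where "r = sqrt ((x - a) * (b - x))"
    have r: "r > 0" using x' by (simp add: r_def)
    have x0: "x > 0" using x' edges(1) by simp
    have "((\<lambda>x. arcsin (edge_ratio A B (s + x))) has_real_derivative
       (sqrt (A * B) / ((s + x) * sqrt ((s + x - A) * (B - (s + x)))) * 1)) (at x)"
      by (rule DERIV_chain2[OF arcsin_edge_ratio_deriv])
         (use AB x' in \<open>auto intro!: derivative_eq_intros simp: A_def B_def\<close>)
    also have "sqrt ((s + x - A) * (B - (s + x))) = r" by (simp add: A_def B_def r_def)
    also have "sqrt (A * B) = edge_disc s" by (simp add: A_def B_def edge_disc_def)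
    finally have d2: "((\<lambda>x. arcsin (edge_ratio A B (s + x))) has_real_derivative (edge_disc s / ((s + x) * r))) (at x)"
      by simp
    have d1: "((\<lambda>x. arcsin (edge_ratio a b x)) has_real_derivative c / (x * r)) (at x)"
      using edge_ratio_arcsin_deriv[OF x'] by (simp add: r_def)
    have d0: "((\<lambda>x. limit_bulk \<alpha> x / (s + x)) has_real_derivative
       ((- ((x + c) / (2 * pi * x * r))) * (s + x) - limit_bulk \<alpha> x * 1) / ((s + x) * (s + x))) (at x)"
      using bulk_deriv[OF x', folded r_def] s x0
      by (intro DERIV_divide) (auto intro!: derivative_eq_intros)
    have "(T has_real_derivative
       - (((- ((x + c) / (2 * pi * x * r))) * (s + x) - limit_bulk \<alpha> x * 1) / ((s + x) * (s + x))) -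
       ((1 / s) * (c / (x * r)) + k * (edge_disc s / ((s + x) * r))) / (2 * pi)) (at x)"
      unfolding T_def by (intro DERIV_diff DERIV_minus DERIV_cdivide DERIV_add DERIV_cmult d0 d1 d2)
    also have "- (((- ((x + c) / (2 * pi * x * r))) * (s + x) - limit_bulk \<alpha> x * 1) / ((s + x) * (s + x))) -
       ((1 / s) * (c / (x * r)) + k * (edge_disc s / ((s + x) * r))) / (2 * pi) = limit_bulk \<alpha> x / (s + x)\<^sup>2"
    proof -
      have k: "k * (edge_disc s / ((s + x) * r)) = (1 - c / s) / ((s + x) * r)"
        using edge_disc_pos[OF s] by (simp add: k_def)
      have "- (((- ((x + c) / (2 * p * x * r))) * z - l * 1) / (z * z)) -
         ((1 / s) * (c / (x * r)) + (1 - c / s) / (z * r)) / (2 * p) = l / z\<^sup>2"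
        if "z = s + x" "p > 0" for z l p
      proof -
        have z: "z > 0" using that s x0 by simp
        have pf: "(x + c) / (x * z) = (c / s) / x + (1 - c / s) / z"
        proof -
          have "(c / s) / x + (1 - c / s) / z = (c * z + (s - c) * x) / (s * x * z)"
            using z s x0 by (simp add: field_simps)
          also have "c * z + (s - c) * x = s * (x + c)"
            unfolding that(1) by (simp add: algebra_simps)
          also have "s * (x + c) / (s * x * z) = (x + c) / (x * z)" using s by simp
          finally show ?thesis ..
        qed
        have "- (((- ((x + c) / (2 * p * x * r))) * z - l * 1) / (z * z)) = (x + c) / (x * z) / (2 * p * r) + l / z\<^sup>2"
          using z x0 r that(2) by (simp add: field_simps power2_eq_square)
        moreover have "((1 / s) * (c / (x * r)) + (1 - c / s) / (z * r)) / (2 * p) = ((c / s) / x + (1 - c / s) / z) / (2 * p * r)"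
          using z x0 r that(2) s by (simp add: field_simps)
        ultimately show ?thesis unfolding pf by simp
      qed
      from this[OF refl pi_gt_zero] show ?thesis unfolding k .
    qed
    finally show "(T has_vector_derivative limit_bulk \<alpha> x / (s + x)\<^sup>2) (at x)"
      by (simp add: has_real_derivative_iff_has_vector_derivative)
  qed
  moreover have "T b - T a = 1 / (s + a) - (1 / s + k) / 2"
  proof -
    have B1: "edge_ratio A B (s + b) = 1" "edge_ratio A B (s + a) = -1"
      using edge_ratio_at_edges[OF AB] by (simp_all add: A_def B_def)
    have Tb: "T b = - ((1 / s) / 4 + k / 4)"
      unfolding T_def B1 bulk_upper edge_ratio_upper
      by (simp add: field_simps)
    have Ta: "T a = - (1 / (s + a)) + (1 / s) / 4 + k / 4"
    proof (cases "a = 0")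
      case True
      have "centred a b a = -1" using centred_edges by simp
      moreover have "edge_ratio a b a = 1" using True edges(2) by (simp add: edge_ratio_def)
      ultimately have "limit_bulk \<alpha> a = 1 / 2" "edge_ratio a b a = 1"
        using bulk_eq[of a] edges(2) by simp_all
      then show ?thesis unfolding T_def B1 using True s by (simp add: field_simps)
    next
      case False
      then have "a > 0" using edges(1) by simp
      moreover have "- x - (y * (- (pi / 2)) + k * (- (pi / 2))) / (2 * pi) = - x + y / 4 + k / 4" for x y k :: real
        by (simp add: field_simps)
      ultimately show ?thesis
        unfolding T_def B1 using bulk_lower edge_ratio_lower
        by (simp only: arcsin_minus_1)
    qed
    have "- (y / 4 + k / 4) - (- x + y / 4 + k / 4) = x - (y + k) / 2" for x y k :: real
      by (simp add: field_simps)
    then show ?thesis unfolding Ta Tb .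
  qed
  ultimately show ?thesis by (simp add: k_def)
qed

lemma integral_shifted_inverse:
  assumes "s > 0"
  shows "integral {0..a} (\<lambda>x. 1 / (s + x)) = ln (s + a) - ln s"
proof -
  have "((\<lambda>x. 1 / (s + x)) has_integral (ln (s + a) - ln (s + 0))) {0..a}"
    using assms edges(1)
    by (intro fundamental_theorem_of_calculus)
      (auto intro!: derivative_eq_intros simp: has_real_derivative_iff_has_vector_derivative[symmetric])
  then show ?thesis by (simp add: integral_unique)
qed

definition "limit_transform s = ln (s + a) - ln s + integral {a..b} (\<lambda>x. limit_bulk \<alpha> x / (s + x))"

lemma limit_transform_eq: "s > 0 \<Longrightarrow> pairing (limit_density \<alpha>) (\<lambda>x. 1 / (s + x)) = limit_transform s"
  by (simp add: limit_pairing_split[OF test_fun_kernel] integral_shifted_inverse limit_transform_def)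

lemma limit_transform_deriv:
  assumes s: "s > 0"
  shows "(limit_transform has_real_derivative - ((1 / s - (1 - c / s) / edge_disc s) / 2)) (at s)"
proof -
  define J where "J = integral {a..b} (\<lambda>x. limit_bulk \<alpha> x / (s + x)\<^sup>2)"
  have J: "J = 1 / (s + a) - (1 / s + (1 - c / s) / edge_disc s) / 2"
    unfolding J_def by (rule integral_unique[OF bulk_kernel_square_integral[OF s]])
  have nz: "t + x \<noteq> 0" if "t \<in> {0<..}" "x \<in> cbox a b" for t x
    using that edges(1) by (auto simp: box_real)
  have "((\<lambda>t. integral (cbox a b) (\<lambda>x. limit_bulk \<alpha> x / (t + x))) has_real_derivative
      integral (cbox a b) (\<lambda>x. - (limit_bulk \<alpha> x / (s + x)\<^sup>2))) (at s within {0<..})"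
  proof (rule leibniz_rule_field_derivative)
    show "((\<lambda>t. limit_bulk \<alpha> x / (t + x)) has_real_derivative - (limit_bulk \<alpha> x / (t + x)\<^sup>2)) (at t within {0<..})"
      if "t \<in> {0<..}" "x \<in> cbox a b" for t x
      using nz[OF that] by (auto intro!: derivative_eq_intros simp: power2_eq_square)
    show "(\<lambda>x. limit_bulk \<alpha> x / (t + x)) integrable_on cbox a b" if "t \<in> {0<..}" for t
      using nz[OF that] bulk_cont
      by (intro integrable_continuous continuous_intros) (auto simp: box_real)
    have "continuous_on ({0<..} \<times> cbox a b) (\<lambda>z. limit_bulk \<alpha> (snd z))"
      by (rule continuous_on_compose2[OF bulk_cont]) (auto intro!: continuous_intros simp: box_real)
    then show "continuous_on ({0<..} \<times> cbox a b) (\<lambda>(t, x). - (limit_bulk \<alpha> x / (t + x)\<^sup>2))"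
      unfolding case_prod_beta using nz by (intro continuous_intros) auto
  qed (use s in auto)
  then have "((\<lambda>t. integral {a..b} (\<lambda>x. limit_bulk \<alpha> x / (t + x))) has_real_derivative - J) (at s)"
    using s by (simp add: at_within_open[of s "{0<..}"] J_def box_real)
  then have "(limit_transform has_real_derivative (1 / (s + a) - 1 / s + (- J))) (at s)"
    unfolding limit_transform_def using s edges(1)
    by (intro DERIV_add DERIV_diff) (auto intro!: derivative_eq_intros)
  moreover have "1 / (s + a) - 1 / s + (- J) = - ((1 / s - (1 - c / s) / edge_disc s) / 2)"
  proof -
    have "x - y + (- (x - (y + k) / 2)) = - ((y - k) / 2)" for x y k :: real by (simp add: field_simps)
    then show ?thesis unfolding J .
  qed
  ultimately show ?thesis by simp
qed

lemma mp_trace_shift: "s > 0 \<Longrightarrow> 1 + mp_trace \<alpha> s = (s + c + edge_disc s) / (2 * s)"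
  by (simp add: mp_trace_def edge_disc_def a_def b_def c_def)

lemma mp_log_deriv:
  assumes s: "s > 0"
  shows "((\<lambda>s. ln ((s + c + edge_disc s) / (2 * s))) has_real_derivative - ((1 / s - (1 - c / s) / edge_disc s) / 2)) (at s)"
proof -
  define D where "D = edge_disc s"
  have D: "D > 0" "D * D = s * s + 2 * (\<alpha> + 1) * s + c * c" using edge_disc_pos edge_disc_square s by (auto simp: D_def)
  have c0: "c \<ge> 0" using \<alpha> by (simp add: c_def)
  have pos: "(s + a) * (s + b) > 0" using s edges(1,2) by simp
  have *: "((\<lambda>s. (s + a) * (s + b)) has_real_derivative (2 * s + (a + b))) (at s)"
    by (auto intro!: derivative_eq_intros)
  have "(edge_disc has_real_derivative inverse D / 2 * (2 * s + (a + b))) (at s)"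
    unfolding edge_disc_def[abs_def] D_def
    by (rule DERIV_chain2[where f = sqrt and g = "\<lambda>s. (s + a) * (s + b)", OF DERIV_real_sqrt[OF pos] *])
  also have "inverse D / 2 * (2 * s + (a + b)) = (s + \<alpha> + 1) / D"
    unfolding edges(5) using D(1) by (simp add: field_simps)
  finally have dD: "(edge_disc has_real_derivative (s + \<alpha> + 1) / D) (at s)" .
  have N: "s + c + D > 0" using s c0 D by simp
  have "((\<lambda>s. ln (s + c + edge_disc s) - ln (2 * s)) has_real_derivative
      (1 + (s + \<alpha> + 1) / D) / (s + c + D) - 1 / s) (at s)"
  proof (rule DERIV_diff)
    have "((\<lambda>s. s + c + edge_disc s) has_real_derivative (1 + 0) + (s + \<alpha> + 1) / D) (at s)"
      by (intro DERIV_add DERIV_ident DERIV_const dD)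
    from DERIV_chain2[where f = ln and g = "\<lambda>s. s + c + edge_disc s", OF DERIV_ln_divide this] N
    show "((\<lambda>s. ln (s + c + edge_disc s)) has_real_derivative (1 + (s + \<alpha> + 1) / D) / (s + c + D)) (at s)"
      by (simp add: D_def)
    show "((\<lambda>s. ln (2 * s)) has_real_derivative 1 / s) (at s)"
      using s by (auto intro!: derivative_eq_intros)
  qed
  also have "(1 + (s + \<alpha> + 1) / D) / (s + c + D) - 1 / s = - ((1 / s - (1 - c / s) / D) / 2)"
  proof -
    have "(1 + p / D) / n - 1 / s = (s * (D + p) - D * n) / (s * D * n)" if "n > 0" for n p
      using that s D(1) by (simp add: field_simps)
    from this[OF N] have "(1 + (s + \<alpha> + 1) / D) / (s + c + D) - 1 / s
        = (s * (D + (s + \<alpha> + 1)) - D * (s + c + D)) / (s * D * (s + c + D))" .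
    also have "s * (D + (s + \<alpha> + 1)) - D * (s + c + D) = - (D - (s - c)) * (s + c + D) / 2"
    proof -
      have "2 * (s * (D + (s + \<alpha> + 1)) - D * (s + c + D)) - (- (D - (s - c)) * (s + c + D))
          = s * s + 2 * (\<alpha> + 1) * s + c * c - D * D"
        by (simp add: c_def algebra_simps)
      then show ?thesis using D(2) by simp
    qed
    also have "- (D - (s - c)) * (s + c + D) / 2 / (s * D * (s + c + D)) = - (D - (s - c)) / (2 * (s * D))"
      using N by simp
    also have "\<dots> = - ((1 / s - (1 - c / s) / D) / 2)"
      using s D(1) by (simp add: field_simps)
    finally show ?thesis .
  qed
  finally have deriv: "((\<lambda>s. ln (s + c + edge_disc s) - ln (2 * s)) has_real_derivative - ((1 / s - (1 - c / s) / edge_disc s) / 2)) (at s)"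
    by (simp add: D_def)
  show ?thesis
  proof (rule has_field_derivative_transform_within_open[OF deriv, where S = "{0<..}"])
    fix t :: real assume "t \<in> {0<..}"
    then have "t > 0" "t + c + edge_disc t > 0" using c0 edge_disc_pos[of t] by auto
    then show "ln (t + c + edge_disc t) - ln (2 * t) = ln ((t + c + edge_disc t) / (2 * t))"
      by (simp add: ln_div)
  qed (use s in auto)
qed

lemma limit_transform_limit: "(limit_transform \<longlongrightarrow> 0) at_top"
proof -
  have "(limit_transform \<longlongrightarrow> 0 + 0) at_top"
    unfolding limit_transform_def
  proof (rule tendsto_add)
    show "((\<lambda>s. ln (s + a) - ln s) \<longlongrightarrow> 0) at_top" by real_asymp
    show "((\<lambda>s. integral {a..b} (\<lambda>x. limit_bulk \<alpha> x / (s + x))) \<longlongrightarrow> 0) at_top"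
    proof (rule Lim_null_comparison)
      show "((\<lambda>s. (1 / s) * (b - a)) \<longlongrightarrow> 0) at_top" by real_asymp
      show "\<forall>\<^sub>F s in at_top. norm (integral {a..b} (\<lambda>x. limit_bulk \<alpha> x / (s + x))) \<le> (1 / s) * (b - a)"
      proof (rule eventually_mono[OF eventually_gt_at_top[of 0]])
        fix s :: real assume s: "s > 0"
        show "norm (integral {a..b} (\<lambda>x. limit_bulk \<alpha> x / (s + x))) \<le> (1 / s) * (b - a)"
        proof (rule integral_bound)
          show "a \<le> b" using edges(2) by simp
          show "continuous_on {a..b} (\<lambda>x. limit_bulk \<alpha> x / (s + x))"
            using s edges(1) by (intro continuous_intros bulk_cont) auto
          fix x assume x: "x \<in> {a..b}"
          then have "\<bar>limit_bulk \<alpha> x\<bar> \<le> 1" "s \<le> s + x" using bulk_bounds[of x] edges(1) by auto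
          then show "norm (limit_bulk \<alpha> x / (s + x)) \<le> 1 / s"
            using s x edges(1) by (auto simp: abs_divide intro!: frac_le)
        qed
      qed
    qed
  qed
  then show ?thesis by simp
qed

lemma mp_log_limit: "((\<lambda>s. ln ((s + c + edge_disc s) / (2 * s))) \<longlongrightarrow> 0) at_top"
proof -
  have "((\<lambda>s. (s + c + sqrt ((s + a) * (s + b))) / (2 * s)) \<longlongrightarrow> 1) at_top" by real_asymp
  from tendsto_ln[OF this] show ?thesis by (simp add: edge_disc_def)
qed

text \<open>
  Both sides have the same derivative in \<open>s\<close> and tend to \<open>0\<close> as \<open>s \<rightarrow> \<infinity>\<close>.
\<close>

theorem limit_stieltjes:
  assumes s: "s > 0"
  shows "pairing (limit_density \<alpha>) (\<lambda>x. 1 / (s + x)) = ln (1 + mp_trace \<alpha> s)"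
proof -
  define G where "G = (\<lambda>s. limit_transform s - ln ((s + c + edge_disc s) / (2 * s)))"
  have d: "(G has_real_derivative 0) (at t)" if "t > 0" for t
    unfolding G_def using DERIV_diff[OF limit_transform_deriv[OF that] mp_log_deriv[OF that]] by simp
  have const: "G t = G s" if "t \<ge> s" for t
  proof (cases "s = t")
    case False
    have "continuous_on {s..t} G"
      using d s by (intro DERIV_continuous_on[where D = "\<lambda>_. 0"]) (auto intro: has_field_derivative_at_within)
    then show ?thesis using DERIV_isconst2[of s t G t] d that s False by auto
  qed simp
  have lim0: "(G \<longlongrightarrow> 0 - 0) at_top" unfolding G_def by (intro tendsto_diff limit_transform_limit mp_log_limit)
  have "(G \<longlongrightarrow> G s) at_top"
    by (rule tendsto_eventually, rule eventually_mono[OF eventually_ge_at_top[of s]], rule const)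
  then have "G s = 0 - 0" by (rule tendsto_unique[OF trivial_limit_at_top_linorder _ lim0])
  then show ?thesis using s by (simp add: G_def limit_transform_eq mp_trace_shift)
qed

lemma mp_trace_equation:
  assumes s: "s > 0"
  shows "mp_trace \<alpha> s > 0" "1 / (1 + mp_trace \<alpha> s) = s * mp_trace \<alpha> s - (\<alpha> - 1)"
proof -
  define D where "D = edge_disc s"
  have D: "D > 0" "D * D = s * s + 2 * (\<alpha> + 1) * s + c * c" using edge_disc_pos edge_disc_square s by (auto simp: D_def)
  have c0: "c \<ge> 0" using \<alpha> by (simp add: c_def)
  have t: "1 + mp_trace \<alpha> s = (s + c + D) / (2 * s)" using mp_trace_shift[OF s] by (simp add: D_def)
  have "(s + c) * (s + c) < D * D" unfolding D(2) using s by (simp add: c_def algebra_simps)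
  then have lt: "s + c < D" using D(1) mult_mono[of D "s + c" D "s + c"] by fastforce
  have N: "s + c + D > 0" using s c0 D by simp
  have mt: "mp_trace \<alpha> s = (D + c - s) / (2 * s)" using t s by (simp add: field_simps)
  then show "mp_trace \<alpha> s > 0" using lt c0 s by simp
  have "s * mp_trace \<alpha> s - c = (D - s - c) / 2" unfolding mt using s by (simp add: field_simps)
  moreover have "1 / (1 + mp_trace \<alpha> s) = (D - s - c) / 2"
  proof -
    have "(D - s - c) * (s + c + D) = D * D - (s + c) * (s + c)" by (simp add: algebra_simps)
    also have "\<dots> = 4 * s" unfolding D(2) by (simp add: c_def algebra_simps)
    finally show ?thesis unfolding t using N s by (simp add: field_simps)
  qed
  ultimately show "1 / (1 + mp_trace \<alpha> s) = s * mp_trace \<alpha> s - (\<alpha> - 1)" by (simp add: c_def)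
qed

end

section \<open>Quadratic forms in independent variables\<close>

lemma det_measurable:
  fixes A :: "'x \<Rightarrow> real mat"
  assumes A: "\<And>z. A z \<in> carrier_mat n n"
    and m: "\<And>i j. i < n \<Longrightarrow> j < n \<Longrightarrow> (\<lambda>z. A z $$ (i, j)) \<in> borel_measurable M"
  shows "(\<lambda>z. det (A z)) \<in> borel_measurable M"
  unfolding det_def'[OF A]
  by (intro borel_measurable_sum borel_measurable_times borel_measurable_prod borel_measurable_const m)
     (auto simp: permutes_in_image[of _ "{0..<n}", unfolded atLeastLessThan_iff])

lemma reg_gram_measurable:
  assumes "\<And>a b. a < n \<Longrightarrow> b < m \<Longrightarrow> (\<lambda>z. V z a b) \<in> borel_measurable M" "j < m" "k < m"
  shows "(\<lambda>z. reg_gram s \<kappa> (V z) n m $$ (j, k)) \<in> borel_measurable M"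
proof -
  have eq: "reg_gram s \<kappa> (V z) n m $$ (j, k) = (if j = k then s else 0) + \<kappa> * (\<Sum>i<n. V z i j * V z i k)" for z
    using assms(2,3) by (simp add: reg_gram_def)
  show ?thesis
    unfolding eq
    by (intro borel_measurable_add borel_measurable_const borel_measurable_times borel_measurable_sum assms) auto
qed

lemma resolvent_measurable:
  assumes V: "\<And>a b. a < n \<Longrightarrow> b < m \<Longrightarrow> (\<lambda>z. V z a b) \<in> borel_measurable M" and jk: "j < m" "k < m"
  shows "(\<lambda>z. resolvent s \<kappa> (V z) n m j k) \<in> borel_measurable M"
proof -
  have m: "(\<lambda>z. reg_gram s \<kappa> (V z) n m $$ (a, b)) \<in> borel_measurable M" if "a < m" "b < m" for a b
    using reg_gram_measurable[OF V that] .
  have d: "(\<lambda>z. det (reg_gram s \<kappa> (V z) n m)) \<in> borel_measurable M"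
    by (rule det_measurable[OF reg_gram_carrier m])
  have "(\<lambda>z. det (mat_delete (reg_gram s \<kappa> (V z) n m) k j)) \<in> borel_measurable M"
  proof (rule det_measurable)
    show "mat_delete (reg_gram s \<kappa> (V z) n m) k j \<in> carrier_mat (m - 1) (m - 1)" for z
      by (rule mat_delete_carrier[OF reg_gram_carrier])
    fix a b assume ab: "a < m - 1" "b < m - 1"
    define a' b' where "a' = (if a < k then a else Suc a)" and "b' = (if b < j then b else Suc b)"
    have eq: "mat_delete (reg_gram s \<kappa> (V z) n m) k j $$ (a, b) = reg_gram s \<kappa> (V z) n m $$ (a', b')" for z
      using ab reg_gram_carrier[of s \<kappa> "V z" n m] by (simp add: mat_delete_def a'_def b'_def)
    have "a' < m" "b' < m" using ab by (auto simp: a'_def b'_def)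
    then show "(\<lambda>z. mat_delete (reg_gram s \<kappa> (V z) n m) k j $$ (a, b)) \<in> borel_measurable M"
      unfolding eq by (rule m)
  qed
  note c = this
  have eq: "resolvent s \<kappa> (V z) n m j k =
      (- 1) ^ (k + j) * det (mat_delete (reg_gram s \<kappa> (V z) n m) k j) / det (reg_gram s \<kappa> (V z) n m)" for z
    using jk reg_gram_carrier[of s \<kappa> "V z" n m] by (simp add: resolvent_def adj_mat_def cofactor_def)
  show ?thesis
    unfolding eq by (intro borel_measurable_divide borel_measurable_times borel_measurable_const c d)
qed

lemma resolvent_cong:
  assumes "\<And>a b. a < n \<Longrightarrow> b < m \<Longrightarrow> V a b = V' a b"
  shows "resolvent s \<kappa> V n m = resolvent s \<kappa> V' n m"
proof -
  have "reg_gram s \<kappa> V n m = reg_gram s \<kappa> V' n m"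
    using assms by (intro eq_matI) (auto simp: reg_gram_def intro!: sum.cong)
  then show ?thesis by (simp add: resolvent_def[abs_def])
qed

text \<open>
  The entries of \<open>x x\<^sup>t - 1\<close>, which have mean zero if the \<open>x\<^sub>j\<close> are independent with mean \<open>0\<close> and
  variance \<open>1\<close>.
\<close>

definition centred_product :: "(nat \<Rightarrow> real) \<Rightarrow> nat \<Rightarrow> nat \<Rightarrow> real" where
  "centred_product x j k = x j * x k - (if j = k then 1 else 0)"

lemma prod_power_delta:
  assumes "finite I" "j \<in> I"
  shows "(\<Prod>i\<in>I. (x i :: real) ^ (if i = j then 1 else 0)) = x j"
proof -
  have "(\<Prod>i\<in>I. x i ^ (if i = j then 1 else 0)) = (\<Prod>i\<in>I. if i = j then x i else 1)"
    by (intro prod.cong) auto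
  then show ?thesis using assms by simp
qed

context prob_space
begin

lemma expectation_prod_powers:
  fixes x :: "nat \<Rightarrow> 'a \<Rightarrow> real"
  assumes indep: "indep_vars (\<lambda>_. borel) x {..<m}"
    and int: "\<And>j k. j < m \<Longrightarrow> integrable M (\<lambda>\<omega>. x j \<omega> ^ k)"
    and mom: "\<And>j k. j < m \<Longrightarrow> expectation (\<lambda>\<omega>. x j \<omega> ^ k) = mom k"
  shows "expectation (\<lambda>\<omega>. \<Prod>i<m. x i \<omega> ^ e i) = (\<Prod>i<m. mom (e i))"
    and "integrable M (\<lambda>\<omega>. \<Prod>i<m. x i \<omega> ^ e i)"
proof -
  have ind: "indep_vars (\<lambda>_. borel) (\<lambda>i \<omega>. x i \<omega> ^ e i) {..<m}"
    by (rule indep_vars_compose2[OF indep]) auto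
  have "expectation (\<lambda>\<omega>. \<Prod>i<m. x i \<omega> ^ e i) = (\<Prod>i<m. expectation (\<lambda>\<omega>. x i \<omega> ^ e i))"
    by (rule indep_vars_lebesgue_integral[OF _ ind]) (auto intro: int)
  then show "expectation (\<lambda>\<omega>. \<Prod>i<m. x i \<omega> ^ e i) = (\<Prod>i<m. mom (e i))" by (simp add: mom)
  show "integrable M (\<lambda>\<omega>. \<Prod>i<m. x i \<omega> ^ e i)"
    by (rule indep_vars_integrable[OF _ ind]) (auto intro: int)
qed

context
  fixes x :: "nat \<Rightarrow> 'a \<Rightarrow> real" and m :: nat and mom :: "nat \<Rightarrow> real"
  assumes indep: "indep_vars (\<lambda>_. borel) x {..<m}"
    and int: "\<And>j k. j < m \<Longrightarrow> integrable M (\<lambda>\<omega>. x j \<omega> ^ k)"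
    and mom: "\<And>j k. j < m \<Longrightarrow> expectation (\<lambda>\<omega>. x j \<omega> ^ k) = mom k"
    and mom1: "mom 1 = 0" and mom2: "mom 2 = 1"
begin

lemma quadruple_power_product:
  assumes "j < m" "k < m" "l < m" "p < m"
  shows "x j \<omega> * x k \<omega> * (x l \<omega> * x p \<omega>) =
    (\<Prod>i<m. x i \<omega> ^ ((if i = j then 1 else 0) + (if i = k then 1 else 0)
       + ((if i = l then 1 else 0) + (if i = p then 1 else 0))))"
  unfolding power_add prod.distrib using assms by (simp only: prod_power_delta finite_lessThan lessThan_iff)

lemma mom0: "0 < m \<Longrightarrow> mom 0 = 1"
  using mom[of 0 0] by (simp add: prob_space)

lemma mom4: "0 < m \<Longrightarrow> 0 \<le> mom 4"
  using mom[of 0 4] by (metis integral_nonneg_AE AE_I2 zero_le_even_power even_numeral)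

lemma quadruple_integrable:
  assumes "j < m" "k < m" "l < m" "p < m"
  shows "integrable M (\<lambda>\<omega>. x j \<omega> * x k \<omega> * (x l \<omega> * x p \<omega>))"
  unfolding quadruple_power_product[OF assms] by (rule expectation_prod_powers(2)[OF indep int mom])

text \<open>
  The expectation is the product over all indices \<open>i\<close> of the moments of order \<open>e i\<close>, where \<open>e i\<close> counts
  how often \<open>i\<close> occurs among \<open>j, k, l, p\<close>. An index that occurs exactly once makes it vanish.
\<close>

lemma quadruple_moment:
  assumes jklp: "j < m" "k < m" "l < m" "p < m"
  shows "expectation (\<lambda>\<omega>. x j \<omega> * x k \<omega> * (x l \<omega> * x p \<omega>)) =
    (if j = k \<and> l = p \<and> j = l then mom 4
     else if j = k \<and> l = p \<or> j = l \<and> k = p \<or> j = p \<and> k = l then 1 else 0)"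
proof -
  define e where "e = (\<lambda>i. ((if i = j then 1 else 0) + (if i = k then 1 else 0)
       + ((if i = l then 1 else 0) + (if i = p then 1 else 0))) :: nat)"
  have E: "expectation (\<lambda>\<omega>. x j \<omega> * x k \<omega> * (x l \<omega> * x p \<omega>)) = (\<Prod>i<m. mom (e i))"
    unfolding quadruple_power_product[OF jklp] e_def
    by (rule expectation_prod_powers(1)[OF indep int mom])
  have m0: "mom 0 = 1" using mom0 jklp by simp
  consider (all) "j = k" "l = p" "j = l"
    | (pairs) "\<not> (j = k \<and> l = p \<and> j = l)" "j = k \<and> l = p \<or> j = l \<and> k = p \<or> j = p \<and> k = l"
    | (single) "\<not> (j = k \<and> l = p \<or> j = l \<and> k = p \<or> j = p \<and> k = l)" by blast
  then show ?thesis
  proof cases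
    case all
    then have "(\<Prod>i<m. mom (e i)) = (\<Prod>i<m. if i = j then mom 4 else 1)"
      by (intro prod.cong) (auto simp: e_def m0 numeral_eq_Suc)
    then show ?thesis unfolding E using all jklp by simp
  next
    case pairs
    then have "e i = 0 \<or> e i = 2" for i unfolding e_def by auto
    then have "mom (e i) = 1" for i using m0 mom2 by metis
    then have P: "(\<Prod>i<m. mom (e i)) = 1" by simp
    show ?thesis unfolding E P using pairs by auto
  next
    case single
    then have "\<exists>i\<in>{j, k, l, p}. e i = 1" unfolding e_def by auto
    then have "\<exists>i<m. mom (e i) = 0" using jklp mom1 by auto
    then have "(\<Prod>i<m. mom (e i)) = 0" by (auto simp: prod_zero_iff)
    then show ?thesis unfolding E using single by auto
  qed
qed

lemma pair_integrable: "j < m \<Longrightarrow> k < m \<Longrightarrow> integrable M (\<lambda>\<omega>. x j \<omega> * x k \<omega>)"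
  and pair_moment: "j < m \<Longrightarrow> k < m \<Longrightarrow> expectation (\<lambda>\<omega>. x j \<omega> * x k \<omega>) = (if j = k then 1 else 0)"
proof -
  assume jk: "j < m" "k < m"
  define e where "e = (\<lambda>i. ((if i = j then 1 else 0) + (if i = k then 1 else 0)) :: nat)"
  have eq: "x j \<omega> * x k \<omega> = (\<Prod>i<m. x i \<omega> ^ e i)" for \<omega>
    unfolding e_def power_add prod.distrib using jk by (simp only: prod_power_delta finite_lessThan lessThan_iff)
  show "integrable M (\<lambda>\<omega>. x j \<omega> * x k \<omega>)"
    unfolding eq by (rule expectation_prod_powers(2)[OF indep int mom])
  have E: "expectation (\<lambda>\<omega>. x j \<omega> * x k \<omega>) = (\<Prod>i<m. mom (e i))"
    unfolding eq by (rule expectation_prod_powers(1)[OF indep int mom])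
  have m0: "mom 0 = 1" using mom0 jk by simp
  show "expectation (\<lambda>\<omega>. x j \<omega> * x k \<omega>) = (if j = k then 1 else 0)"
  proof (cases "j = k")
    case True
    then have "e i = 0 \<or> e i = 2" for i unfolding e_def by auto
    then have "mom (e i) = 1" for i using m0 mom2 by metis
    then show ?thesis unfolding E using True by simp
  next
    case False
    then have "e j = 1" by (simp add: e_def)
    then have "\<exists>i<m. mom (e i) = 0" using jk mom1 by auto
    then have "(\<Prod>i<m. mom (e i)) = 0" by (auto simp: prod_zero_iff)
    then show ?thesis unfolding E using False by simp
  qed
qed

text \<open>
  Entries of \<open>x x\<^sup>t - 1\<close> are uncorrelated unless they agree up to transposition.
\<close>

lemma centred_product_covariance:
  assumes jklp: "j < m" "k < m" "l < m" "p < m"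
  defines "\<xi> \<equiv> \<lambda>j k \<omega>. centred_product (\<lambda>i. x i \<omega>) j k"
  shows "integrable M (\<lambda>\<omega>. \<xi> j k \<omega> * \<xi> l p \<omega>)"
    and "\<not> (l = j \<and> p = k \<or> l = k \<and> p = j) \<Longrightarrow> expectation (\<lambda>\<omega>. \<xi> j k \<omega> * \<xi> l p \<omega>) = 0"
    and "\<bar>expectation (\<lambda>\<omega>. \<xi> j k \<omega> * \<xi> l p \<omega>)\<bar> \<le> mom 4 + 1"
proof -
  define a b where "a = (if j = k then 1 else 0 :: real)" and "b = (if l = p then 1 else 0 :: real)"
  have eq: "\<xi> j k \<omega> * \<xi> l p \<omega> = x j \<omega> * x k \<omega> * (x l \<omega> * x p \<omega>) - (b * (x j \<omega> * x k \<omega>) + a * (x l \<omega> * x p \<omega>) - a * b)" for \<omega>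
    by (simp add: \<xi>_def centred_product_def a_def[symmetric] b_def[symmetric] algebra_simps)
  note ints = quadruple_integrable[OF jklp] pair_integrable[OF jklp(1,2)] pair_integrable[OF jklp(3,4)]
  show "integrable M (\<lambda>\<omega>. \<xi> j k \<omega> * \<xi> l p \<omega>)"
    unfolding eq by (intro Bochner_Integration.integrable_diff Bochner_Integration.integrable_add integrable_mult_right ints integrable_const)
  have "expectation (\<lambda>\<omega>. \<xi> j k \<omega> * \<xi> l p \<omega>) = expectation (\<lambda>\<omega>. x j \<omega> * x k \<omega> * (x l \<omega> * x p \<omega>)) - (b * a + a * b - a * b)"
    unfolding eq
    using ints pair_moment[OF jklp(1,2)] pair_moment[OF jklp(3,4)]
    by (simp add: a_def[symmetric] b_def[symmetric] prob_space)
  then have E: "expectation (\<lambda>\<omega>. \<xi> j k \<omega> * \<xi> l p \<omega>) =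
    (if j = k \<and> l = p \<and> j = l then mom 4
     else if j = k \<and> l = p \<or> j = l \<and> k = p \<or> j = p \<and> k = l then 1 else 0) - (if j = k \<and> l = p then 1 else 0)"
    unfolding quadruple_moment[OF jklp] by (simp add: a_def b_def)
  show "\<not> (l = j \<and> p = k \<or> l = k \<and> p = j) \<Longrightarrow> expectation (\<lambda>\<omega>. \<xi> j k \<omega> * \<xi> l p \<omega>) = 0"
    unfolding E by auto
  show "\<bar>expectation (\<lambda>\<omega>. \<xi> j k \<omega> * \<xi> l p \<omega>)\<bar> \<le> mom 4 + 1"
    unfolding E using mom4 jklp by auto
qed

text \<open>
  Expanding the square gives a sum over \<open>j, k, l, p\<close>. By independence, the expectations factor, and
  only \<open>(l, p) = (j, k)\<close> and \<open>(l, p) = (k, j)\<close> survive, by \<open>centred_product_covariance\<close>.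
\<close>

lemma quadratic_form_second_moment:
  fixes q :: "nat \<Rightarrow> nat \<Rightarrow> 'a \<Rightarrow> real"
  defines "\<xi> \<equiv> \<lambda>j k \<omega>. centred_product (\<lambda>i. x i \<omega>) j k"
  assumes ind: "\<And>j k l p. j < m \<Longrightarrow> k < m \<Longrightarrow> l < m \<Longrightarrow> p < m \<Longrightarrow>
      indep_var borel (\<lambda>\<omega>. q j k \<omega> * q l p \<omega>) borel (\<lambda>\<omega>. \<xi> j k \<omega> * \<xi> l p \<omega>)"
    and qint: "\<And>j k l p. j < m \<Longrightarrow> k < m \<Longrightarrow> l < m \<Longrightarrow> p < m \<Longrightarrow> integrable M (\<lambda>\<omega>. q j k \<omega> * q l p \<omega>)"
    and qsym: "\<And>j k \<omega>. j < m \<Longrightarrow> k < m \<Longrightarrow> \<omega> \<in> space M \<Longrightarrow> q j k \<omega> = q k j \<omega>"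
  shows "integrable M (\<lambda>\<omega>. (\<Sum>j<m. \<Sum>k<m. q j k \<omega> * \<xi> j k \<omega>)\<^sup>2)"
    and "expectation (\<lambda>\<omega>. (\<Sum>j<m. \<Sum>k<m. q j k \<omega> * \<xi> j k \<omega>)\<^sup>2)
      \<le> 2 * (mom 4 + 1) * (\<Sum>j<m. \<Sum>k<m. expectation (\<lambda>\<omega>. (q j k \<omega>)\<^sup>2))"
proof -
  define T where "T = (\<lambda>j k l p \<omega>. (q j k \<omega> * q l p \<omega>) * (\<xi> j k \<omega> * \<xi> l p \<omega>))"
  have cov: "integrable M (\<lambda>\<omega>. \<xi> j k \<omega> * \<xi> l p \<omega>)"
    "\<not> (l = j \<and> p = k \<or> l = k \<and> p = j) \<Longrightarrow> expectation (\<lambda>\<omega>. \<xi> j k \<omega> * \<xi> l p \<omega>) = 0"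
    "\<bar>expectation (\<lambda>\<omega>. \<xi> j k \<omega> * \<xi> l p \<omega>)\<bar> \<le> mom 4 + 1"
    if "j < m" "k < m" "l < m" "p < m" for j k l p
    using centred_product_covariance[OF that] unfolding \<xi>_def by blast+
  have Tint: "integrable M (T j k l p)"
    and TE: "expectation (T j k l p) = expectation (\<lambda>\<omega>. q j k \<omega> * q l p \<omega>) * expectation (\<lambda>\<omega>. \<xi> j k \<omega> * \<xi> l p \<omega>)"
    if "j < m" "k < m" "l < m" "p < m" for j k l p
    unfolding T_def
    by (rule indep_var_integrable[OF ind[OF that] qint[OF that] cov(1)[OF that]],
        rule indep_var_lebesgue_integral[OF ind[OF that] qint[OF that] cov(1)[OF that]])
  have sq: "(\<Sum>j<m. \<Sum>k<m. q j k \<omega> * \<xi> j k \<omega>)\<^sup>2 = (\<Sum>j<m. \<Sum>k<m. \<Sum>l<m. \<Sum>p<m. T j k l p \<omega>)" for \<omega>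
  proof -
    define S where "S = (\<Sum>l<m. \<Sum>p<m. q l p \<omega> * \<xi> l p \<omega>)"
    have aS: "a * S = (\<Sum>l<m. \<Sum>p<m. a * (q l p \<omega> * \<xi> l p \<omega>))" for a
      unfolding S_def sum_distrib_left ..
    have "(\<Sum>j<m. \<Sum>k<m. q j k \<omega> * \<xi> j k \<omega> * S) = (\<Sum>j<m. \<Sum>k<m. \<Sum>l<m. \<Sum>p<m. T j k l p \<omega>)"
      unfolding aS T_def by (intro sum.cong refl) (simp only: mult_ac)
    moreover have "S * S = (\<Sum>j<m. \<Sum>k<m. q j k \<omega> * \<xi> j k \<omega> * S)"
      by (subst (1) S_def) (simp only: sum_distrib_right)
    ultimately show ?thesis by (simp add: S_def power2_eq_square)
  qed
  show "integrable M (\<lambda>\<omega>. (\<Sum>j<m. \<Sum>k<m. q j k \<omega> * \<xi> j k \<omega>)\<^sup>2)"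
    unfolding sq by (intro Bochner_Integration.integrable_sum Tint) auto
  have "expectation (\<lambda>\<omega>. (\<Sum>j<m. \<Sum>k<m. q j k \<omega> * \<xi> j k \<omega>)\<^sup>2)
      = (\<Sum>j<m. \<Sum>k<m. \<Sum>l<m. \<Sum>p<m. expectation (T j k l p))"
  proof -
    have 1: "expectation (\<lambda>\<omega>. \<Sum>p<m. T j k l p \<omega>) = (\<Sum>p<m. expectation (T j k l p))"
      if "j < m" "k < m" "l < m" for j k l
      by (rule Bochner_Integration.integral_sum) (use Tint that in auto)
    have 2: "expectation (\<lambda>\<omega>. \<Sum>l<m. \<Sum>p<m. T j k l p \<omega>) = (\<Sum>l<m. \<Sum>p<m. expectation (T j k l p))"
      if "j < m" "k < m" for j k
      by (subst Bochner_Integration.integral_sum)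
         (use Tint that 1 in \<open>auto intro!: Bochner_Integration.integrable_sum sum.cong\<close>)
    have 3: "expectation (\<lambda>\<omega>. \<Sum>k<m. \<Sum>l<m. \<Sum>p<m. T j k l p \<omega>) = (\<Sum>k<m. \<Sum>l<m. \<Sum>p<m. expectation (T j k l p))"
      if "j < m" for j
      by (subst Bochner_Integration.integral_sum)
         (use Tint that 2 in \<open>auto intro!: Bochner_Integration.integrable_sum sum.cong\<close>)
    show ?thesis
      unfolding sq by (subst Bochner_Integration.integral_sum)
         (use Tint 3 in \<open>auto intro!: Bochner_Integration.integrable_sum sum.cong\<close>)
  qed
  also have "\<dots> \<le> (\<Sum>j<m. \<Sum>k<m. 2 * (mom 4 + 1) * expectation (\<lambda>\<omega>. (q j k \<omega>)\<^sup>2))"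
  proof (intro sum_mono)
    fix j k assume "j \<in> {..<m}" "k \<in> {..<m}"
    then have jk: "j < m" "k < m" by auto
    define B where "B = (mom 4 + 1) * expectation (\<lambda>\<omega>. (q j k \<omega>)\<^sup>2)"
    have "0 \<le> mom 4" using mom4 jk by simp
    then have B0: "B \<ge> 0" unfolding B_def by (intro mult_nonneg_nonneg) auto
    have bound: "expectation (T j k l p) \<le> (if l = j \<and> p = k then B else 0) + (if l = k \<and> p = j then B else 0)"
      if lp: "l < m" "p < m" for l p
    proof (cases "l = j \<and> p = k \<or> l = k \<and> p = j")
      case True
      have eq: "expectation (\<lambda>\<omega>. q j k \<omega> * q l p \<omega>) = expectation (\<lambda>\<omega>. (q j k \<omega>)\<^sup>2)"
        by (rule Bochner_Integration.integral_cong[OF refl]) (use True qsym jk in \<open>auto simp: power2_eq_square\<close>)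
      have le: "expectation (\<lambda>\<omega>. \<xi> j k \<omega> * \<xi> l p \<omega>) \<le> mom 4 + 1" using cov(3)[OF jk lp] by simp
      have "expectation (\<lambda>\<omega>. (q j k \<omega>)\<^sup>2) \<ge> 0" by simp
      then have "expectation (T j k l p) \<le> B"
        unfolding TE[OF jk lp] B_def eq mult.commute[of "mom 4 + 1"] using le by (intro mult_left_mono)
      also have "B \<le> (if l = j \<and> p = k then B else 0) + (if l = k \<and> p = j then B else 0)"
      proof -
        define u v where "u = (if l = j \<and> p = k then B else 0)" and "v = (if l = k \<and> p = j then B else 0)"
        have "u \<ge> 0" "v \<ge> 0" unfolding u_def v_def using B0 by simp_all
        moreover have "u = B \<or> v = B" using True unfolding u_def v_def by argo
        ultimately have "B \<le> u + v" by linarith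
        then show ?thesis unfolding u_def v_def .
      qed
      finally show ?thesis .
    next
      case False
      have "expectation (T j k l p) = 0"
        unfolding TE[OF jk lp] cov(2)[OF jk lp False] by simp
      moreover have "0 \<le> (if Q then B else 0)" for Q using B0 by simp
      ultimately show ?thesis by (simp only: add_nonneg_nonneg)
    qed
    have single: "(\<Sum>l<m. \<Sum>p<m. if l = a \<and> p = b then B else 0) = B" if "a < m" "b < m" for a b
    proof -
      have "(\<Sum>p<m. if l = a \<and> p = b then B else 0) = (if l = a then B else 0)" for l
        using that by (cases "l = a") auto
      then show ?thesis using that by simp
    qed
    have "(\<Sum>l<m. \<Sum>p<m. expectation (T j k l p)) \<le>
        (\<Sum>l<m. \<Sum>p<m. (if l = j \<and> p = k then B else 0) + (if l = k \<and> p = j then B else 0))"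
      by (intro sum_mono bound) auto
    also have "\<dots> = 2 * B" by (simp add: sum.distrib single jk)
    finally show "(\<Sum>l<m. \<Sum>p<m. expectation (T j k l p)) \<le> 2 * (mom 4 + 1) * expectation (\<lambda>\<omega>. (q j k \<omega>)\<^sup>2)"
      by (simp only: B_def mult.assoc)
  qed
  finally show "expectation (\<lambda>\<omega>. (\<Sum>j<m. \<Sum>k<m. q j k \<omega> * \<xi> j k \<omega>)\<^sup>2)
      \<le> 2 * (mom 4 + 1) * (\<Sum>j<m. \<Sum>k<m. expectation (\<lambda>\<omega>. (q j k \<omega>)\<^sup>2))"
    by (simp add: sum_distrib_left)
qed

end

context
  fixes w :: "nat \<Rightarrow> nat \<Rightarrow> 'a \<Rightarrow> real" and n m :: nat and mom :: "nat \<Rightarrow> real"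
  assumes indep: "indep_vars (\<lambda>_. borel) (\<lambda>(i, j). w i j) ({..<n} \<times> {..<m})"
    and int: "\<And>i j k. i < n \<Longrightarrow> j < m \<Longrightarrow> integrable M (\<lambda>\<omega>. w i j \<omega> ^ k)"
    and mom: "\<And>i j k. i < n \<Longrightarrow> j < m \<Longrightarrow> expectation (\<lambda>\<omega>. w i j \<omega> ^ k) = mom k"
    and mom1: "mom 1 = 0" and mom2: "mom 2 = 1"
begin

lemma row_indep:
  assumes i: "i < n"
  shows "indep_vars (\<lambda>_. borel) (w i) {..<m}"
proof -
  have "indep_vars (\<lambda>j. PiM {(i, j)} (\<lambda>_. borel)) (\<lambda>j \<omega>. restrict (\<lambda>p. (case p of (a, b) \<Rightarrow> w a b) \<omega>) {(i, j)}) {..<m}"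
    by (rule indep_vars_restrict[OF indep]) (use i in \<open>auto simp: disjoint_family_on_def\<close>)
  then have "indep_vars (\<lambda>_. borel) (\<lambda>j \<omega>. (\<lambda>z. z (i, j)) (restrict (\<lambda>p. (case p of (a, b) \<Rightarrow> w a b) \<omega>) {(i, j)})) {..<m}"
    by (rule indep_vars_compose2) (rule measurable_component_singleton, simp)
  then show ?thesis by simp
qed

text \<open>
  The coefficients are \<open>G\<close> evaluated after \<open>zero_row i\<close>, so they are independent of the \<open>i\<close>-th
  row. This is used for the resolvent and, to get the law of large numbers for
  the squared length of a row, for the identity matrix.
\<close>

lemma row_form_deviation:
  fixes G :: "(nat \<Rightarrow> nat \<Rightarrow> real) \<Rightarrow> nat \<Rightarrow> nat \<Rightarrow> real"
  assumes i: "i < n" and B: "B \<ge> 0"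
    and meas: "\<And>j k. j < m \<Longrightarrow> k < m \<Longrightarrow>
       (\<lambda>z. G (zero_row i (\<lambda>a b. z (a, b))) j k)
         \<in> borel_measurable (PiM (({..<n} - {i}) \<times> {..<m}) (\<lambda>_. borel))"
    and cong: "\<And>V V'. (\<And>a b. a < n \<Longrightarrow> b < m \<Longrightarrow> V a b = V' a b) \<Longrightarrow> G V = G V'"
    and bounded: "\<And>V j k. j < m \<Longrightarrow> k < m \<Longrightarrow> \<bar>G V j k\<bar> \<le> B"
    and sym: "\<And>V j k. j < m \<Longrightarrow> k < m \<Longrightarrow> G V j k = G V k j"
    and column: "\<And>V k. k < m \<Longrightarrow> (\<Sum>j<m. (G V j k)\<^sup>2) \<le> B\<^sup>2"
  defines "q \<equiv> \<lambda>j k \<omega>. G (zero_row i (\<lambda>a b. w a b \<omega>)) j k"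
  shows "integrable M (\<lambda>\<omega>. ((\<Sum>j<m. w i j \<omega> * (\<Sum>k<m. q j k \<omega> * w i k \<omega>)) - (\<Sum>j<m. q j j \<omega>))\<^sup>2)"
    and "expectation (\<lambda>\<omega>. ((\<Sum>j<m. w i j \<omega> * (\<Sum>k<m. q j k \<omega> * w i k \<omega>)) - (\<Sum>j<m. q j j \<omega>))\<^sup>2)
      \<le> 2 * (mom 4 + 1) * (real m * B\<^sup>2)"
proof -
  let ?A = "({..<n} - {i}) \<times> {..<m}" and ?R = "{i} \<times> {..<m}"
  define \<xi> where "\<xi> = (\<lambda>j k \<omega>. centred_product (\<lambda>a. w i a \<omega>) j k)"
  have ivar: "indep_var (PiM ?A (\<lambda>_. borel)) (\<lambda>\<omega>. restrict (\<lambda>(a, b). w a b \<omega>) ?A)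
      (PiM ?R (\<lambda>_. borel)) (\<lambda>\<omega>. restrict (\<lambda>(a, b). w a b \<omega>) ?R)"
    using indep_var_restrict[OF indep, of ?A ?R] i by (auto simp: case_prod_unfold)
  have qeq: "G (zero_row i (\<lambda>a b. restrict (\<lambda>(a, b). w a b \<omega>) ?A (a, b))) = G (zero_row i (\<lambda>a b. w a b \<omega>))" for \<omega>
    by (rule cong) (auto simp: zero_row_def)
  have ind: "indep_var borel (\<lambda>\<omega>. q j k \<omega> * q l p \<omega>) borel (\<lambda>\<omega>. \<xi> j k \<omega> * \<xi> l p \<omega>)"
    if "j < m" "k < m" "l < m" "p < m" for j k l p
  proof -
    let ?Y1 = "\<lambda>z. G (zero_row i (\<lambda>a b. z (a, b))) j k * G (zero_row i (\<lambda>a b. z (a, b))) l p"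
    let ?Y2 = "\<lambda>z. centred_product (\<lambda>a. z (i, a)) j k * centred_product (\<lambda>a. z (i, a)) l p"
    have comp: "(\<lambda>z. z (i, a)) \<in> borel_measurable (PiM ?R (\<lambda>_. borel))" if "a < m" for a
      using that by (intro measurable_component_singleton) auto
    have "?Y1 \<in> borel_measurable (PiM ?A (\<lambda>_. borel))" by (intro borel_measurable_times meas that)
    moreover have "?Y2 \<in> borel_measurable (PiM ?R (\<lambda>_. borel))"
      unfolding centred_product_def
      by (intro borel_measurable_times borel_measurable_diff borel_measurable_const comp that)
    ultimately have "indep_var borel (?Y1 \<circ> (\<lambda>\<omega>. restrict (\<lambda>(a, b). w a b \<omega>) ?A))
        borel (?Y2 \<circ> (\<lambda>\<omega>. restrict (\<lambda>(a, b). w a b \<omega>) ?R))"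
      by (rule indep_var_compose[OF ivar])
    moreover have "?Y1 \<circ> (\<lambda>\<omega>. restrict (\<lambda>(a, b). w a b \<omega>) ?A) = (\<lambda>\<omega>. q j k \<omega> * q l p \<omega>)"
      by (simp only: o_def qeq q_def)
    moreover have "?Y2 \<circ> (\<lambda>\<omega>. restrict (\<lambda>(a, b). w a b \<omega>) ?R) = (\<lambda>\<omega>. \<xi> j k \<omega> * \<xi> l p \<omega>)"
      using that by (simp add: o_def \<xi>_def centred_product_def)
    ultimately show ?thesis by simp
  qed
  have qm: "q j k \<in> borel_measurable M" if "j < m" "k < m" for j k
  proof -
    have "(\<lambda>\<omega>. restrict (\<lambda>(a, b). w a b \<omega>) ?A) \<in> measurable M (PiM ?A (\<lambda>_. borel))"
      using indep_var_rv1[OF ivar] .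
    from measurable_compose[OF this meas[OF that]] show ?thesis unfolding q_def qeq .
  qed
  have qb: "\<bar>q j k \<omega>\<bar> \<le> B" if "j < m" "k < m" for j k \<omega>
    unfolding q_def by (rule bounded[OF that])
  have qint: "integrable M (\<lambda>\<omega>. q j k \<omega> * q l p \<omega>)" if "j < m" "k < m" "l < m" "p < m" for j k l p
  proof (rule integrable_const_bound[where B = "B * B"])
    show "AE \<omega> in M. norm (q j k \<omega> * q l p \<omega>) \<le> B * B"
      using qb that B by (intro AE_I2) (auto simp: abs_mult intro!: mult_mono)
  qed (intro borel_measurable_times qm that)
  have qsym: "q j k \<omega> = q k j \<omega>" if "j < m" "k < m" for j k \<omega>
    unfolding q_def by (rule sym[OF that])
  have form: "(\<Sum>j<m. w i j \<omega> * (\<Sum>k<m. q j k \<omega> * w i k \<omega>)) - (\<Sum>j<m. q j j \<omega>) = (\<Sum>j<m. \<Sum>k<m. q j k \<omega> * \<xi> j k \<omega>)" for \<omega>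
  proof -
    have "(\<Sum>k<m. q j k \<omega> * \<xi> j k \<omega>) = w i j \<omega> * (\<Sum>k<m. q j k \<omega> * w i k \<omega>) - q j j \<omega>" if "j < m" for j
    proof -
      have "(\<Sum>k<m. q j k \<omega> * \<xi> j k \<omega>) = (\<Sum>k<m. w i j \<omega> * (q j k \<omega> * w i k \<omega>) - (if j = k then q j k \<omega> else 0))"
        by (intro sum.cong) (auto simp: \<xi>_def centred_product_def algebra_simps)
      then show ?thesis using that by (simp add: sum_subtractf sum_distrib_left)
    qed
    then show ?thesis by (simp add: sum_subtractf)
  qed
  have qf: "integrable M (\<lambda>\<omega>. (\<Sum>j<m. \<Sum>k<m. q j k \<omega> * \<xi> j k \<omega>)\<^sup>2)"
    "expectation (\<lambda>\<omega>. (\<Sum>j<m. \<Sum>k<m. q j k \<omega> * \<xi> j k \<omega>)\<^sup>2)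
      \<le> 2 * (mom 4 + 1) * (\<Sum>j<m. \<Sum>k<m. expectation (\<lambda>\<omega>. (q j k \<omega>)\<^sup>2))"
    unfolding \<xi>_def
    by (rule quadratic_form_second_moment[OF row_indep[OF i] int[OF i] mom[OF i] mom1 mom2
          ind[unfolded \<xi>_def] qint qsym]; assumption)+
  show "integrable M (\<lambda>\<omega>. ((\<Sum>j<m. w i j \<omega> * (\<Sum>k<m. q j k \<omega> * w i k \<omega>)) - (\<Sum>j<m. q j j \<omega>))\<^sup>2)"
    unfolding form by (rule qf(1))
  have "(\<Sum>j<m. \<Sum>k<m. expectation (\<lambda>\<omega>. (q j k \<omega>)\<^sup>2)) = expectation (\<lambda>\<omega>. \<Sum>j<m. \<Sum>k<m. (q j k \<omega>)\<^sup>2)"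
  proof -
    have qint2: "integrable M (\<lambda>\<omega>. (q j k \<omega>)\<^sup>2)" if "j < m" "k < m" for j k
      using qint[OF that that] by (simp add: power2_eq_square)
    have 1: "expectation (\<lambda>\<omega>. \<Sum>k<m. (q j k \<omega>)\<^sup>2) = (\<Sum>k<m. expectation (\<lambda>\<omega>. (q j k \<omega>)\<^sup>2))" if "j < m" for j
      by (rule Bochner_Integration.integral_sum) (use qint2 that in auto)
    show ?thesis
      by (subst Bochner_Integration.integral_sum)
         (use qint2 1 in \<open>auto intro!: Bochner_Integration.integrable_sum sum.cong\<close>)
  qed
  also have "\<dots> \<le> expectation (\<lambda>\<omega>. real m * B\<^sup>2)"
  proof (rule integral_mono)
    show "integrable M (\<lambda>\<omega>. \<Sum>j<m. \<Sum>k<m. (q j k \<omega>)\<^sup>2)"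
      using qint by (auto simp: power2_eq_square intro!: Bochner_Integration.integrable_sum)
    fix \<omega>
    have "(\<Sum>j<m. \<Sum>k<m. (q j k \<omega>)\<^sup>2) = (\<Sum>k<m. \<Sum>j<m. (q j k \<omega>)\<^sup>2)" by (rule sum.swap)
    also have "\<dots> \<le> (\<Sum>k<m. B\<^sup>2)" unfolding q_def by (intro sum_mono column) auto
    finally show "(\<Sum>j<m. \<Sum>k<m. (q j k \<omega>)\<^sup>2) \<le> real m * B\<^sup>2" by simp
  qed auto
  also have "\<dots> = real m * B\<^sup>2" by (simp add: prob_space)
  finally have le: "(\<Sum>j<m. \<Sum>k<m. expectation (\<lambda>\<omega>. (q j k \<omega>)\<^sup>2)) \<le> real m * B\<^sup>2" .
  have "expectation (\<lambda>\<omega>. (\<Sum>j<m. \<Sum>k<m. q j k \<omega> * \<xi> j k \<omega>)\<^sup>2) \<le> 2 * (mom 4 + 1) * (real m * B\<^sup>2)"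
  proof (cases "m = 0")
    case False
    then have "0 \<le> mom 4" using mom[OF i, of 0 4] by (metis bot_nat_0.not_eq_extremum integral_nonneg_AE AE_I2 zero_le_even_power even_numeral)
    then show ?thesis using order_trans[OF qf(2) mult_left_mono[OF le]] by simp
  qed simp
  then show "expectation (\<lambda>\<omega>. ((\<Sum>j<m. w i j \<omega> * (\<Sum>k<m. q j k \<omega> * w i k \<omega>)) - (\<Sum>j<m. q j j \<omega>))\<^sup>2)
      \<le> 2 * (mom 4 + 1) * (real m * B\<^sup>2)"
    unfolding form .
qed

lemma leave_one_form_deviation:
  assumes i: "i < n" and s: "s > 0" and \<kappa>: "\<kappa> \<ge> 0"
  defines "D \<equiv> \<lambda>\<omega>. leave_one_form s \<kappa> (\<lambda>a b. w a b \<omega>) n m i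
      - \<kappa> * (\<Sum>j<m. resolvent s \<kappa> (zero_row i (\<lambda>a b. w a b \<omega>)) n m j j)"
  shows "integrable M (\<lambda>\<omega>. (D \<omega>)\<^sup>2)" and "expectation (\<lambda>\<omega>. (D \<omega>)\<^sup>2) \<le> \<kappa>\<^sup>2 * (2 * (mom 4 + 1) * (real m * (1 / s)\<^sup>2))"
proof -
  let ?G = "\<lambda>V. resolvent s \<kappa> V n m"
  have meas: "(\<lambda>z. ?G (zero_row i (\<lambda>a b. z (a, b))) j k)
      \<in> borel_measurable (PiM (({..<n} - {i}) \<times> {..<m}) (\<lambda>_. borel))" if "j < m" "k < m" for j k
  proof (rule resolvent_measurable[OF _ that])
    fix a b assume ab: "a < n" "b < m"
    show "(\<lambda>z. zero_row i (\<lambda>a b. z (a, b)) a b) \<in> borel_measurable (PiM (({..<n} - {i}) \<times> {..<m}) (\<lambda>_. borel))"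
    proof (cases "a = i")
      case True
      then show ?thesis by (simp add: zero_row_def)
    next
      case False
      then show ?thesis using ab by (simp add: zero_row_def)
    qed
  qed
  have col: "(\<Sum>j<m. (?G V j k)\<^sup>2) \<le> (1 / s)\<^sup>2" if "k < m" for V k
    using resolvent_column_bound[OF s \<kappa> that, of V n] by (simp add: power_divide)
  note rf = row_form_deviation[OF i _ meas resolvent_cong resolvent_entry_bound[OF s \<kappa>] resolvent_sym[OF s \<kappa>] col]
  have D: "(D \<omega>)\<^sup>2 = \<kappa>\<^sup>2 * ((\<Sum>j<m. w i j \<omega> * (\<Sum>k<m. ?G (zero_row i (\<lambda>a b. w a b \<omega>)) j k * w i k \<omega>))
      - (\<Sum>j<m. ?G (zero_row i (\<lambda>a b. w a b \<omega>)) j j))\<^sup>2" for \<omega>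
    unfolding D_def leave_one_form_def right_diff_distrib[symmetric] power_mult_distrib ..
  show "integrable M (\<lambda>\<omega>. (D \<omega>)\<^sup>2)" unfolding D using s by (intro integrable_mult_right rf(1)) auto
  show "expectation (\<lambda>\<omega>. (D \<omega>)\<^sup>2) \<le> \<kappa>\<^sup>2 * (2 * (mom 4 + 1) * (real m * (1 / s)\<^sup>2))"
    unfolding D integral_mult_right_zero using s by (intro mult_left_mono rf(2)) auto
qed

lemma row_norm_deviation:
  fixes i :: nat and \<kappa> :: real
  assumes i: "i < n"
  defines "D \<equiv> \<lambda>\<omega>. \<kappa> * (\<Sum>j<m. (w i j \<omega>)\<^sup>2) - \<kappa> * real m"
  shows "integrable M (\<lambda>\<omega>. (D \<omega>)\<^sup>2)" and "expectation (\<lambda>\<omega>. (D \<omega>)\<^sup>2) \<le> \<kappa>\<^sup>2 * (2 * (mom 4 + 1) * (real m * 1\<^sup>2))"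
proof -
  let ?G = "\<lambda>(V :: nat \<Rightarrow> nat \<Rightarrow> real) (j :: nat) k. if j = k then 1 else 0 :: real"
  have col: "(\<Sum>j<m. (?G V j k)\<^sup>2) \<le> 1\<^sup>2" if "k < m" for V :: "nat \<Rightarrow> nat \<Rightarrow> real" and k
  proof -
    have "(\<Sum>j<m. (?G V j k)\<^sup>2) = (\<Sum>j<m. if j = k then 1 else 0)" by (intro sum.cong) auto
    then show ?thesis using that by simp
  qed
  have form: "(\<Sum>j<m. w i j \<omega> * (\<Sum>k<m. ?G V j k * w i k \<omega>)) - (\<Sum>j<m. ?G V j j) = (\<Sum>j<m. (w i j \<omega>)\<^sup>2) - real m" for V :: "nat \<Rightarrow> nat \<Rightarrow> real" and \<omega>
  proof -
    have "(\<Sum>k<m. ?G V j k * w i k \<omega>) = (\<Sum>k<m. if j = k then w i k \<omega> else 0)" for j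
      by (intro sum.cong) auto
    then show ?thesis by (simp add: power2_eq_square)
  qed
  have rf: "integrable M (\<lambda>\<omega>. ((\<Sum>j<m. (w i j \<omega>)\<^sup>2) - real m)\<^sup>2)"
    "expectation (\<lambda>\<omega>. ((\<Sum>j<m. (w i j \<omega>)\<^sup>2) - real m)\<^sup>2) \<le> 2 * (mom 4 + 1) * (real m * 1\<^sup>2)"
  proof -
    have nn: "(1 :: real) \<ge> 0" by simp
    have ms: "(\<lambda>z. ?G (zero_row i (\<lambda>a b. z (a, b))) j k)
        \<in> borel_measurable (PiM (({..<n} - {i}) \<times> {..<m}) (\<lambda>_. borel))" for j k
      by (rule borel_measurable_const)
    have cg: "?G V = ?G V'" for V V' :: "nat \<Rightarrow> nat \<Rightarrow> real" by (rule refl)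
    have bd: "\<bar>?G V j k\<bar> \<le> 1" for V :: "nat \<Rightarrow> nat \<Rightarrow> real" and j k by simp
    have sm: "?G V j k = ?G V k j" for V :: "nat \<Rightarrow> nat \<Rightarrow> real" and j k by auto
    show "integrable M (\<lambda>\<omega>. ((\<Sum>j<m. (w i j \<omega>)\<^sup>2) - real m)\<^sup>2)"
      "expectation (\<lambda>\<omega>. ((\<Sum>j<m. (w i j \<omega>)\<^sup>2) - real m)\<^sup>2) \<le> 2 * (mom 4 + 1) * (real m * 1\<^sup>2)"
      unfolding form[symmetric]
      by (rule row_form_deviation[where G = ?G and B = 1, OF i nn ms cg bd sm col]; assumption)+
  qed
  have D: "(D \<omega>)\<^sup>2 = \<kappa>\<^sup>2 * ((\<Sum>j<m. (w i j \<omega>)\<^sup>2) - real m)\<^sup>2" for \<omega>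
    unfolding D_def right_diff_distrib[symmetric] power_mult_distrib ..
  show "integrable M (\<lambda>\<omega>. (D \<omega>)\<^sup>2)" unfolding D by (intro integrable_mult_right rf(1))
  show "expectation (\<lambda>\<omega>. (D \<omega>)\<^sup>2) \<le> \<kappa>\<^sup>2 * (2 * (mom 4 + 1) * (real m * 1\<^sup>2))"
    unfolding D integral_mult_right_zero by (intro mult_left_mono rf(2)) auto
qed

end

end

section \<open>Convergence with high probability\<close>

definition likely :: "(nat \<Rightarrow> 'a measure) \<Rightarrow> (nat \<times> 'a \<Rightarrow> bool) \<Rightarrow> bool" where
  "likely P R \<longleftrightarrow> (\<exists>E. (\<forall>\<^sub>F N in sequentially. E N \<in> sets (P N) \<and> (\<forall>\<omega>\<in>E N. R (N, \<omega>))) \<and>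
     (\<lambda>N. measure (P N) (space (P N) - E N)) \<longlonglongrightarrow> 0)"

text \<open>
  Along this filter a property holds eventually if it holds on measurable events whose
  probabilities tend to one. Convergence along it is convergence in probability, but the calculus of limits
  and deterministic inequalities can be used directly, even though the probability spaces vary.
\<close>

definition whp :: "(nat \<Rightarrow> 'a measure) \<Rightarrow> (nat \<times> 'a) filter" where
  "whp P = Abs_filter (likely P)"

lemma likelyI:
  assumes "\<forall>\<^sub>F N in sequentially. E N \<in> sets (P N) \<and> (\<forall>\<omega>\<in>E N. R (N, \<omega>))"
    and "(\<lambda>N. measure (P N) (space (P N) - E N)) \<longlonglongrightarrow> 0"
  shows "likely P R"
  unfolding likely_def by (rule exI[of _ E]) (use assms in blast)

lemma likelyE:
  assumes "likely P R"
  obtains E where "\<forall>\<^sub>F N in sequentially. E N \<in> sets (P N) \<and> (\<forall>\<omega>\<in>E N. R (N, \<omega>))"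
    "(\<lambda>N. measure (P N) (space (P N) - E N)) \<longlonglongrightarrow> 0"
  using assms unfolding likely_def by blast

lemma eventually_whp: "eventually R (whp P) \<longleftrightarrow> likely P R"
  unfolding whp_def
proof (rule eventually_Abs_filter, rule is_filter.intro)
  show "likely P (\<lambda>z. True)"
    by (rule likelyI[where E = "\<lambda>N. space (P N)"]) simp_all
next
  fix R S :: "nat \<times> 'a \<Rightarrow> bool"
  assume "likely P R" "likely P S"
  obtain E where E: "\<forall>\<^sub>F N in sequentially. E N \<in> sets (P N) \<and> (\<forall>\<omega>\<in>E N. R (N, \<omega>))"
    "(\<lambda>N. measure (P N) (space (P N) - E N)) \<longlonglongrightarrow> 0" using \<open>likely P R\<close> by (rule likelyE)
  obtain F where F: "\<forall>\<^sub>F N in sequentially. F N \<in> sets (P N) \<and> (\<forall>\<omega>\<in>F N. S (N, \<omega>))"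
    "(\<lambda>N. measure (P N) (space (P N) - F N)) \<longlonglongrightarrow> 0" using \<open>likely P S\<close> by (rule likelyE)
  show "likely P (\<lambda>z. R z \<and> S z)"
  proof (rule likelyI[where E = "\<lambda>N. E N \<inter> F N"])
    show "\<forall>\<^sub>F N in sequentially. E N \<inter> F N \<in> sets (P N) \<and> (\<forall>\<omega>\<in>E N \<inter> F N. R (N, \<omega>) \<and> S (N, \<omega>))"
      using E(1) F(1) by eventually_elim auto
    show "(\<lambda>N. measure (P N) (space (P N) - E N \<inter> F N)) \<longlonglongrightarrow> 0"
    proof (rule tendsto_sandwich[OF _ _ tendsto_const])
      show "\<forall>\<^sub>F N in sequentially. 0 \<le> measure (P N) (space (P N) - E N \<inter> F N)" by simp
      show "\<forall>\<^sub>F N in sequentially. measure (P N) (space (P N) - E N \<inter> F N) \<le>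
          measure (P N) (space (P N) - E N) + measure (P N) (space (P N) - F N)"
        using E(1) F(1)
      proof eventually_elim
        case (elim N)
        have "space (P N) - E N \<inter> F N = (space (P N) - E N) \<union> (space (P N) - F N)" by auto
        then show ?case
          using elim measure_Un_le[OF sets.compl_sets sets.compl_sets, of "E N" "P N" "F N"] by simp
      qed
      show "(\<lambda>N. measure (P N) (space (P N) - E N) + measure (P N) (space (P N) - F N)) \<longlonglongrightarrow> 0"
        using tendsto_add[OF E(2) F(2)] by simp
    qed
  qed
next
  fix R S :: "nat \<times> 'a \<Rightarrow> bool"
  assume le: "\<forall>z. R z \<longrightarrow> S z" and "likely P R"
  obtain E where E: "\<forall>\<^sub>F N in sequentially. E N \<in> sets (P N) \<and> (\<forall>\<omega>\<in>E N. R (N, \<omega>))"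
    "(\<lambda>N. measure (P N) (space (P N) - E N)) \<longlonglongrightarrow> 0" using \<open>likely P R\<close> by (rule likelyE)
  have "\<forall>\<^sub>F N in sequentially. E N \<in> sets (P N) \<and> (\<forall>\<omega>\<in>E N. S (N, \<omega>))"
    using E(1) by eventually_elim (use le in blast)
  then show "likely P S" using E(2) by (rule likelyI)
qed

lemma eventually_whp_sequentially:
  assumes "\<forall>\<^sub>F N in sequentially. \<forall>\<omega>\<in>space (P N). R (N, \<omega>)"
  shows "eventually R (whp P)"
  unfolding eventually_whp
  by (rule likelyI[where E = "\<lambda>N. space (P N)"]) (use assms in \<open>auto elim: eventually_mono\<close>)

lemma filterlim_fst_whp: "filterlim fst sequentially (whp P)"
  unfolding filterlim_def le_filter_def eventually_filtermap
  by (auto intro!: eventually_whp_sequentially elim: eventually_mono)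

lemma tendsto_whp_sequentially:
  "f \<longlonglongrightarrow> l \<Longrightarrow> ((\<lambda>z. f (fst z)) \<longlongrightarrow> l) (whp P)"
  by (rule filterlim_compose[OF _ filterlim_fst_whp])

lemma tendsto_in_prob_whp:
  assumes prob: "\<forall>\<^sub>F N in sequentially. prob_space (P N)"
    and meas: "\<forall>\<^sub>F N in sequentially. X N \<in> borel_measurable (P N)"
    and lim: "((\<lambda>z. X (fst z) (snd z)) \<longlongrightarrow> c) (whp P)"
  shows "tendsto_in_prob P X c"
  unfolding tendsto_in_prob_def
proof (intro conjI meas allI impI)
  fix \<epsilon> :: real assume "\<epsilon> > 0"
  then have "eventually (\<lambda>z. dist (X (fst z) (snd z)) c < \<epsilon>) (whp P)" using lim by (intro tendstoD)
  then obtain E where E: "\<forall>\<^sub>F N in sequentially. E N \<in> sets (P N) \<and> (\<forall>\<omega>\<in>E N. dist (X N \<omega>) c < \<epsilon>)"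
    "(\<lambda>N. measure (P N) (space (P N) - E N)) \<longlonglongrightarrow> 0" unfolding eventually_whp likely_def by auto
  show "(\<lambda>n. measure (P n) {\<omega> \<in> space (P n). \<bar>X n \<omega> - c\<bar> > \<epsilon>}) \<longlonglongrightarrow> 0"
  proof (rule tendsto_sandwich[OF _ _ tendsto_const E(2)])
    show "\<forall>\<^sub>F n in sequentially. 0 \<le> measure (P n) {\<omega> \<in> space (P n). \<bar>X n \<omega> - c\<bar> > \<epsilon>}" by simp
    show "\<forall>\<^sub>F n in sequentially. measure (P n) {\<omega> \<in> space (P n). \<bar>X n \<omega> - c\<bar> > \<epsilon>} \<le> measure (P n) (space (P n) - E n)"
      using E(1) prob
    proof eventually_elim
      case (elim n)
      interpret prob_space "P n" by (rule elim(2))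
      show ?case using elim(1) by (intro finite_measure_mono) (auto simp: dist_real_def)
    qed
  qed
qed

text \<open>
  Convergence of means of nonnegative variables to zero implies convergence in probability, by Markov's
  inequality.
\<close>

lemma markov_whp:
  fixes Z :: "nat \<Rightarrow> 'a \<Rightarrow> real"
  assumes ev: "\<forall>\<^sub>F N in sequentially. prob_space (P N) \<and> integrable (P N) (Z N) \<and>
      (\<forall>\<omega>\<in>space (P N). 0 \<le> Z N \<omega>) \<and> integral\<^sup>L (P N) (Z N) \<le> b N"
    and b: "b \<longlonglongrightarrow> 0"
  shows "((\<lambda>z. Z (fst z) (snd z)) \<longlongrightarrow> 0) (whp P)"
proof (rule tendstoI)
  fix \<epsilon> :: real assume \<epsilon>: "\<epsilon> > 0"
  define E where "E = (\<lambda>N. {\<omega>\<in>space (P N). 0 \<le> Z N \<omega> \<and> Z N \<omega> < \<epsilon>})"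
  have "\<forall>\<^sub>F N in sequentially. E N \<in> sets (P N) \<and> (\<forall>\<omega>\<in>E N. dist (Z N \<omega>) 0 < \<epsilon>)"
    using ev
  proof eventually_elim
    case (elim N)
    then have [measurable]: "Z N \<in> borel_measurable (P N)" by auto
    have "E N \<in> sets (P N)" unfolding E_def by measurable
    then show ?case by (auto simp: E_def dist_real_def)
  qed
  moreover have "(\<lambda>N. measure (P N) (space (P N) - E N)) \<longlonglongrightarrow> 0"
  proof (rule tendsto_sandwich[OF _ _ tendsto_const])
    show "\<forall>\<^sub>F N in sequentially. 0 \<le> measure (P N) (space (P N) - E N)" by simp
    show "\<forall>\<^sub>F N in sequentially. measure (P N) (space (P N) - E N) \<le> b N / \<epsilon>"
      using ev
    proof eventually_elim
      case (elim N)
      have "space (P N) - E N = {\<omega>\<in>space (P N). Z N \<omega> \<ge> \<epsilon>}" using elim by (auto simp: E_def)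
      then have "measure (P N) (space (P N) - E N) \<le> integral\<^sup>L (P N) (Z N) / \<epsilon>"
        using integral_Markov_inequality_measure[of "P N" "Z N" "{}" \<epsilon>] elim \<epsilon> by (simp add: AE_I2)
      also have "\<dots> \<le> b N / \<epsilon>" using elim \<epsilon> by (intro divide_right_mono) auto
      finally show ?case .
    qed
    show "(\<lambda>N. b N / \<epsilon>) \<longlonglongrightarrow> 0" using tendsto_divide[OF b tendsto_const, of \<epsilon>] \<epsilon> by simp
  qed
  ultimately show "eventually (\<lambda>z. dist (Z (fst z) (snd z)) 0 < \<epsilon>) (whp P)"
    unfolding eventually_whp likely_def by auto
qed

section \<open>Stability of the self-consistent equation\<close>

text \<open>
  If \<open>r\<close> is the row and \<open>v\<close> its image under the resolvent, then \<open>s |v|\<^sup>2 \<le> r \<bullet> v\<close>. Together with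
  \<open>0 \<le> |r - s v|\<^sup>2\<close> this gives \<open>s (r \<bullet> v) \<le> |r|\<^sup>2\<close>.
\<close>

lemma leave_one_form_le:
  assumes s: "s > 0" and \<kappa>: "\<kappa> \<ge> 0"
  shows "s * leave_one_form s \<kappa> W n m i \<le> \<kappa> * (\<Sum>j<m. (W i j)\<^sup>2)"
proof -
  define v where "v = (\<lambda>j. \<Sum>k<m. resolvent s \<kappa> (zero_row i W) n m j k * W i k)"
  have "s * (\<Sum>j<m. (v j)\<^sup>2) \<le> (\<Sum>j<m. W i j * v j)"
    using resolvent_coercive[OF s \<kappa>, where m = m and W = "zero_row i W" and n = n and w = "W i"] by (simp add: v_def)
  then have "s * (s * (\<Sum>j<m. (v j)\<^sup>2)) \<le> s * (\<Sum>j<m. W i j * v j)" using s by (intro mult_left_mono) auto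
  moreover have "2 * (s * (\<Sum>j<m. W i j * v j)) \<le> (\<Sum>j<m. (W i j)\<^sup>2) + s * (s * (\<Sum>j<m. (v j)\<^sup>2))"
  proof -
    have "2 * (s * (\<Sum>j<m. W i j * v j)) = (\<Sum>j<m. 2 * (s * (W i j * v j)))" by (simp add: sum_distrib_left)
    also have "\<dots> \<le> (\<Sum>j<m. (W i j)\<^sup>2 + s * (s * (v j)\<^sup>2))"
    proof (rule sum_mono)
      fix j
      have "0 \<le> (W i j - s * v j)\<^sup>2" by simp
      then show "2 * (s * (W i j * v j)) \<le> (W i j)\<^sup>2 + s * (s * (v j)\<^sup>2)"
        by (simp add: power2_eq_square algebra_simps)
    qed
    finally show ?thesis by (simp add: sum.distrib sum_distrib_left)
  qed
  ultimately have "s * (\<Sum>j<m. W i j * v j) \<le> (\<Sum>j<m. (W i j)\<^sup>2)" by linarith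
  then have "\<kappa> * (s * (\<Sum>j<m. W i j * v j)) \<le> \<kappa> * (\<Sum>j<m. (W i j)\<^sup>2)" using \<kappa> by (rule mult_left_mono)
  then show ?thesis by (simp add: leave_one_form_def v_def mult_ac)
qed

lemma inverse_one_plus_Lipschitz:
  assumes "a \<ge> 0" "b \<ge> (0 :: real)"
  shows "\<bar>1 / (1 + a) - 1 / (1 + b)\<bar> \<le> \<bar>a - b\<bar>"
proof -
  have "1 / (1 + a) - 1 / (1 + b) = (b - a) / ((1 + a) * (1 + b))" using assms by (simp add: field_simps)
  moreover have "1 \<le> (1 + a) * (1 + b)" using mult_mono[of 1 "1 + a" 1 "1 + b"] assms by simp
  ultimately show ?thesis
    using assms by (simp add: abs_divide abs_mult abs_minus_commute divide_le_eq mult_le_cancel_left1)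
qed

text \<open>
  The difference between \<open>\<tau>\<^sub>i\<close> and the normalized trace of the inverse with which it is formed.
\<close>

definition row_deviation :: "real \<Rightarrow> (nat \<Rightarrow> nat \<Rightarrow> real) \<Rightarrow> nat \<Rightarrow> nat \<Rightarrow> nat \<Rightarrow> real" where
  "row_deviation s W n m i = leave_one_form s (1 / real n) W n m i
     - 1 / real n * (\<Sum>j<m. resolvent s (1 / real n) (zero_row i W) n m j j)"

lemma leave_one_form_near_trace:
  assumes s: "s > 0" and n: "n \<ge> 1" and i: "i < n"
  shows "\<bar>leave_one_form s (1 / real n) W n m i - 1 / real n * (\<Sum>j<m. resolvent s (1 / real n) W n m j j)\<bar>
    \<le> \<bar>row_deviation s W n m i\<bar> + 1 / real n * (1 / s)"
proof -
  have \<kappa>: "1 / real n \<ge> 0" by simp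
  define d where "d = (\<Sum>j<m. resolvent s (1 / real n) (zero_row i W) n m j j) - (\<Sum>j<m. resolvent s (1 / real n) W n m j j)"
  have d: "0 \<le> d" "d \<le> 1 / s" unfolding d_def using leave_one_out(3,4)[OF s \<kappa> i] by auto
  have "0 \<le> 1 / real n * d" "1 / real n * d \<le> 1 / real n * (1 / s)"
    by (rule mult_nonneg_nonneg[OF \<kappa> d(1)], rule mult_left_mono[OF d(2) \<kappa>])
  moreover have "leave_one_form s (1 / real n) W n m i - 1 / real n * (\<Sum>j<m. resolvent s (1 / real n) W n m j j)
      = row_deviation s W n m i + 1 / real n * d"
    unfolding row_deviation_def d_def right_diff_distrib by simp
  ultimately show ?thesis by linarith
qed

text \<open>
  The function \<open>1 / (1 + t) - (s t - (\<alpha> - 1))\<close> vanishes at \<open>mp_trace \<alpha> s\<close> and decreases with slope at most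
  \<open>-s\<close>, so it suffices to bound it at the normalized trace, where the self-consistent identity
  applies. The Cauchy-Schwarz inequality passes to the mean square of the deviations.
\<close>

lemma trace_near_limit:
  assumes s: "s > 0" and n: "n \<ge> 1" and \<alpha>: "\<alpha> \<ge> 1"
  shows "\<bar>1 / real n * (\<Sum>j<m. resolvent s (1 / real n) W n m j j) - mp_trace \<alpha> s\<bar>
    \<le> (sqrt ((\<Sum>i<n. (row_deviation s W n m i)\<^sup>2) / real n) + 1 / real n * (1 / s) + \<bar>real m / real n - \<alpha>\<bar>) / s"
proof -
  define t where "t = 1 / real n * (\<Sum>j<m. resolvent s (1 / real n) W n m j j)"
  define \<tau> where "\<tau> = leave_one_form s (1 / real n) W n m"
  define u where "u = mp_trace \<alpha> s"
  note sc = resolvent_self_consistent[OF s n, where m = m and W = W, folded t_def \<tau>_def]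
  have u: "u > 0" "1 / (1 + u) = s * u - (\<alpha> - 1)" unfolding u_def by (rule mp_trace_equation[OF \<alpha> s])+
  have \<tau>0: "\<tau> i \<ge> 0" if "i < n" for i unfolding \<tau>_def using leave_one_out(1)[OF s _ that] by simp
  define D where "D = (\<lambda>i. \<bar>row_deviation s W n m i\<bar>)"
  have "(\<Sum>i<n. 1 / (1 + \<tau> i)) / real n - 1 / (1 + t) = (\<Sum>i<n. 1 / (1 + \<tau> i) - 1 / (1 + t)) / real n"
    using n by (simp add: sum_subtractf diff_divide_distrib)
  then have "\<bar>(\<Sum>i<n. 1 / (1 + \<tau> i)) / real n - 1 / (1 + t)\<bar> = \<bar>\<Sum>i<n. 1 / (1 + \<tau> i) - 1 / (1 + t)\<bar> / real n"
    by (simp only: abs_divide abs_of_nat)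
  also have "\<dots> \<le> (\<Sum>i<n. D i + 1 / real n * (1 / s)) / real n"
  proof (rule divide_right_mono)
    have "\<bar>\<Sum>i<n. 1 / (1 + \<tau> i) - 1 / (1 + t)\<bar> \<le> (\<Sum>i<n. \<bar>1 / (1 + \<tau> i) - 1 / (1 + t)\<bar>)" by (rule sum_abs)
    also have "\<dots> \<le> (\<Sum>i<n. D i + 1 / real n * (1 / s))"
    proof (rule sum_mono)
      fix i assume "i \<in> {..<n}"
      then have i: "i < n" by simp
      have "\<bar>1 / (1 + \<tau> i) - 1 / (1 + t)\<bar> \<le> \<bar>\<tau> i - t\<bar>" by (rule inverse_one_plus_Lipschitz[OF \<tau>0[OF i] sc(1)])
      also have "\<dots> \<le> D i + 1 / real n * (1 / s)"
        unfolding \<tau>_def t_def D_def by (rule leave_one_form_near_trace[OF s n i])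
      finally show "\<bar>1 / (1 + \<tau> i) - 1 / (1 + t)\<bar> \<le> D i + 1 / real n * (1 / s)" .
    qed
    finally show "\<bar>\<Sum>i<n. 1 / (1 + \<tau> i) - 1 / (1 + t)\<bar> \<le> (\<Sum>i<n. D i + 1 / real n * (1 / s))" .
  qed simp
  also have "\<dots> = (\<Sum>i<n. D i) / real n + 1 / real n * (1 / s)"
    using n by (simp add: sum.distrib add_divide_distrib)
  also have "(\<Sum>i<n. D i) / real n \<le> sqrt ((\<Sum>i<n. (row_deviation s W n m i)\<^sup>2) / real n)"
  proof (rule real_le_rsqrt)
    have "(\<Sum>i<n. D i)\<^sup>2 \<le> (\<Sum>i<n. (D i)\<^sup>2) * real n"
      using sum_squared_le_sum_of_squares[of D "{..<n}"] by simp
    then have "(\<Sum>i<n. D i)\<^sup>2 / (real n)\<^sup>2 \<le> (\<Sum>i<n. (D i)\<^sup>2) * real n / (real n)\<^sup>2"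
      by (rule divide_right_mono) simp
    then show "((\<Sum>i<n. D i) / real n)\<^sup>2 \<le> (\<Sum>i<n. (row_deviation s W n m i)\<^sup>2) / real n"
      using n by (simp add: D_def power_divide power2_eq_square split: if_splits)
  qed
  finally have main: "\<bar>(1 - real m / real n + s * t) - 1 / (1 + t)\<bar>
      \<le> sqrt ((\<Sum>i<n. (row_deviation s W n m i)\<^sup>2) / real n) + 1 / real n * (1 / s)"
    unfolding sc(2) by simp
  have "s * \<bar>t - u\<bar> \<le> \<bar>(1 / (1 + t) - (s * t - (\<alpha> - 1)))\<bar>"
  proof (cases "t \<le> u")
    case True
    then have "1 / (1 + u) \<le> 1 / (1 + t)" using sc(1) u(1) by (simp add: frac_le)
    moreover have "s * \<bar>t - u\<bar> = s * u - s * t" using True by (simp add: algebra_simps)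
    ultimately show ?thesis using u(2) by linarith
  next
    case False
    then have "1 / (1 + t) \<le> 1 / (1 + u)" using sc(1) u(1) by (simp add: frac_le)
    moreover have "s * \<bar>t - u\<bar> = s * t - s * u" using False by (simp add: algebra_simps)
    ultimately show ?thesis using u(2) by linarith
  qed
  also have "\<dots> \<le> sqrt ((\<Sum>i<n. (row_deviation s W n m i)\<^sup>2) / real n) + 1 / real n * (1 / s) + \<bar>real m / real n - \<alpha>\<bar>"
    using main by linarith
  finally show ?thesis using s unfolding t_def[symmetric] u_def[symmetric] by (simp add: le_divide_eq mult.commute)
qed

lemma limit_mass:
  assumes \<alpha>: "\<alpha> \<ge> 1"
  shows "pairing (limit_density \<alpha>) (\<lambda>x. 1) = \<alpha>"
proof -
  have "\<forall>\<^sub>F n in sequentially. mass_below (limit_density \<alpha>) (real n) = \<alpha>"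
  proof -
    obtain k :: nat where k: "upper_edge \<alpha> < real k" using reals_Archimedean2 by blast
    show ?thesis
    proof (rule eventually_sequentiallyI[of k])
      fix n assume "k \<le> n"
      then have "upper_edge \<alpha> < real n" using k by linarith
      then have "Omega \<alpha> (real n) = real n - \<alpha>"
        using Omega_eq_explicit[OF \<alpha>, of "real n"] edge_facts(4)[OF \<alpha>] by simp
      then show "mass_below (limit_density \<alpha>) (real n) = \<alpha>"
        using mass_below_limit[OF \<alpha>, of "real n"] by simp
    qed
  qed
  then have "(\<lambda>n. mass_below (limit_density \<alpha>) (real n)) \<longlonglongrightarrow> \<alpha>" by (rule tendsto_eventually)
  then show ?thesis
    using mass_below_tendsto_total[OF unit_density_limit[OF \<alpha>]] LIMSEQ_unique by blast
qed

text \<open>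
  This gives a lower bound for the total mass of a random density in terms of its Stieltjes transform.
\<close>

lemma kernel_le_mass:
  assumes h: "unit_density h" and s: "s > 0"
  shows "s * pairing h (\<lambda>x. 1 / (s + x)) \<le> pairing h (\<lambda>x. 1)"
proof -
  have "s * pairing h (\<lambda>x. 1 / (s + x)) = pairing h (\<lambda>x. s * (1 / (s + x)) + 0 * (1 / (s + x)))"
    using pairing_lin[OF h test_fun_kernel[OF s] test_fun_kernel[OF s], of s 0] by simp
  also have "\<dots> \<le> pairing h (\<lambda>x. 1)"
    unfolding pairing_def
  proof (rule set_integral_mono)
    show "set_integrable lborel {0..} (\<lambda>x. h x * (s * (1 / (s + x)) + 0 * (1 / (s + x))))"
      by (intro test_fun_integrable[OF h] test_fun_lin test_fun_kernel s)
    show "set_integrable lborel {0..} (\<lambda>x. h x * 1)" by (rule test_fun_integrable[OF h test_fun_one])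
    fix x :: real assume x: "x \<in> {0..}"
    then have "s * (1 / (s + x)) + 0 * (1 / (s + x)) \<le> 1" using s by (simp add: divide_le_eq)
    then show "h x * (s * (1 / (s + x)) + 0 * (1 / (s + x))) \<le> h x * 1"
      using h x by (intro mult_left_mono) (auto simp: unit_density_def)
  qed
  finally show ?thesis .
qed

lemma (in interlacing_multisets) diagram_distance:
  assumes \<alpha>: "\<alpha> \<ge> 1"
    and close: "\<And>x. x \<ge> 0 \<Longrightarrow> \<bar>mass_below (diagram_density X Y) x - mass_below (limit_density \<alpha>) x\<bar> \<le> \<epsilon>"
  shows "\<bar>rect_diagram X Y x - Omega \<alpha> x\<bar> \<le> \<bar>pairing (diagram_density X Y) (\<lambda>x. 1) - \<alpha>\<bar> + 2 * \<epsilon>"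
proof (cases "x \<ge> 0")
  case True
  then show ?thesis using close[OF True] by (simp add: rect_diagram_nonneg mass_below_limit[OF \<alpha> True])
next
  case False
  then have "x < 0" by simp
  moreover have "\<epsilon> \<ge> 0" using close[of 0] by (meson abs_ge_zero order_trans order_refl)
  ultimately show ?thesis by (simp add: rect_diagram_neg Omega_negative[OF \<alpha>])
qed

lemma rect_diagram_scaled:
  assumes \<kappa>: "\<kappa> > 0"
  shows "\<kappa> * rect_diagram X Y (x / \<kappa>) = rect_diagram (image_mset (\<lambda>a. \<kappa> * a) X) (image_mset (\<lambda>a. \<kappa> * a) Y) x"
proof -
  have "\<kappa> * (\<Sum>a\<in>#Z. \<bar>x / \<kappa> - a\<bar>) = (\<Sum>a\<in>#image_mset (\<lambda>a. \<kappa> * a) Z. \<bar>x - a\<bar>)" for Z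
  proof (induction Z)
    case (add a Z)
    have "\<kappa> * \<bar>x / \<kappa> - a\<bar> = \<bar>\<kappa> * (x / \<kappa> - a)\<bar>" using \<kappa> by (simp add: abs_mult)
    also have "\<kappa> * (x / \<kappa> - a) = x - \<kappa> * a" using \<kappa> by (simp add: right_diff_distrib)
    finally show ?case using add by (simp add: distrib_left)
  qed simp
  then show ?thesis unfolding rect_diagram_def right_diff_distrib by simp
qed

lemma continuous_rect_diagram: "continuous_on S (rect_diagram X Y)"
  unfolding rect_diagram_def[abs_def]
  by (intro continuous_on_diff continuous_on_sum_mset continuous_intros)

text \<open>
  A supremum over a countable set, needed for measurability.
\<close>

lemma SUP_rational:
  fixes f :: "real \<Rightarrow> real"
  assumes cont: "continuous_on UNIV f" and bound: "\<And>x. f x \<le> B"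
  shows "(SUP x. f x) = (SUP x\<in>\<rat>. f x)"
proof (rule antisym)
  have bdd: "bdd_above (f ` A)" for A using bound by (rule bdd_aboveI2)
  have "f x \<le> (SUP x\<in>\<rat>. f x)" for x
    by (rule continuous_le_on_closure[where S = "\<rat>"])
       (use cont in \<open>auto simp: Rats_closure_real intro!: cSUP_upper bdd\<close>)
  then show "(SUP x. f x) \<le> (SUP x\<in>\<rat>. f x)" by (intro cSUP_least) auto
  show "(SUP x\<in>\<rat>. f x) \<le> (SUP x. f x)"
    by (intro cSUP_subset_mono bdd) auto
qed

section \<open>Convergence of the rescaled diagrams\<close>

lemma gram_mat_eq:
  assumes "A \<in> carrier_mat n m"
  shows "A * transpose_mat A = gram_mat (\<lambda>i j. A $$ (i, j)) n m"
  by (rule eq_matI) (use assms in \<open>auto simp: gram_mat_def scalar_prod_def atLeast0LessThan\<close>)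

definition sup_distance :: "real \<Rightarrow> (nat \<Rightarrow> nat \<Rightarrow> real) \<Rightarrow> nat \<Rightarrow> nat \<Rightarrow> real" where
  "sup_distance \<alpha> W n m = (SUP x. \<bar>rect_diagram (scaled_eigenvalues (1 / real n) W n m)
      (scaled_eigenvalues (1 / real n) W (n - 1) m) x - Omega \<alpha> x\<bar>)"

lemma sup_distance_eq:
  assumes A: "A \<in> carrier_mat n m" and n: "n \<ge> 1"
  shows "(let Y = A * transpose_mat A; Y' = mat_delete Y (n - 1) (n - 1);
          w = rect_diagram (eigenvalues_mset Y) (eigenvalues_mset Y')
      in SUP x. \<bar>1 / real n * w (x * real n) - Omega \<alpha> x\<bar>) = sup_distance \<alpha> (\<lambda>i j. A $$ (i, j)) n m"
proof -
  let ?W = "\<lambda>i j. A $$ (i, j)"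
  have R: "1 / real n * rect_diagram X Y (x * real n)
      = rect_diagram (image_mset (\<lambda>a. 1 / real n * a) X) (image_mset (\<lambda>a. 1 / real n * a) Y) x" for X Y x
    using rect_diagram_scaled[of "1 / real n" X Y x] n by simp
  show ?thesis
    unfolding Let_def gram_mat_eq[OF A] gram_mat_delete[OF n] R sup_distance_def scaled_eigenvalues_def ..
qed

abbreviation "gram_density W n m \<equiv>
  diagram_density (scaled_eigenvalues (1 / real n) W n m) (scaled_eigenvalues (1 / real n) W (n - 1) m)"

lemma gram_interlacing: "n \<ge> 1 \<Longrightarrow>
  interlacing_multisets (scaled_eigenvalues (1 / real n) W n m) (scaled_eigenvalues (1 / real n) W (n - 1) m)"
  by (rule scaled_interlacing) auto

lemma unit_density_gram: "n \<ge> 1 \<Longrightarrow> unit_density (gram_density W n m)"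
  by (rule interlacing_multisets.unit_density_diagram[OF gram_interlacing])

lemma gram_kernel: "n \<ge> 1 \<Longrightarrow> s > 0 \<Longrightarrow>
  pairing (gram_density W n m) (\<lambda>x. 1 / (s + x)) = ln (1 + leave_one_form s (1 / real n) W n m (n - 1))"
  by (rule kernel_gram) auto

text \<open>
  The mass is the limit of \<open>s * ln (1 + \<tau>)\<close> as \<open>s \<rightarrow> \<infinity>\<close>, and \<open>s \<tau>\<close> is at most the right-hand side. An
  inequality is enough: the matching lower bound follows from the convergence of the Stieltjes transform.
\<close>

lemma gram_mass_le:
  assumes n: "n \<ge> 1"
  shows "pairing (gram_density W n m) (\<lambda>x. 1) \<le> 1 / real n * (\<Sum>j<m. (W (n - 1) j)\<^sup>2)"
proof (rule LIMSEQ_le_const2[OF kernel_tendsto_total[OF unit_density_gram[OF n]]])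
  have \<kappa>: "1 / real n \<ge> 0" by simp
  have "real (Suc k) * pairing (gram_density W n m) (\<lambda>x. 1 / (real (Suc k) + x)) \<le> 1 / real n * (\<Sum>j<m. (W (n - 1) j)\<^sup>2)" for k
  proof -
    define s where "s = real (Suc k)"
    have s: "s > 0" by (simp add: s_def)
    define \<tau> where "\<tau> = leave_one_form s (1 / real n) W n m (n - 1)"
    have \<tau>: "\<tau> \<ge> 0" unfolding \<tau>_def using leave_one_out(1)[OF s \<kappa>, of "n - 1" n W m] n by simp
    have "pairing (gram_density W n m) (\<lambda>x. 1 / (s + x)) \<le> \<tau>"
      unfolding gram_kernel[OF n s] \<tau>_def[symmetric] using \<tau> by (rule ln_add_one_self_le_self)
    then have "s * pairing (gram_density W n m) (\<lambda>x. 1 / (s + x)) \<le> s * \<tau>" using s by (intro mult_left_mono) auto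
    also have "\<dots> \<le> 1 / real n * (\<Sum>j<m. (W (n - 1) j)\<^sup>2)" unfolding \<tau>_def by (rule leave_one_form_le[OF s \<kappa>])
    finally show ?thesis by (simp add: s_def)
  qed
  then show "\<exists>N. \<forall>k\<ge>N. real (Suc k) * pairing (gram_density W n m) (\<lambda>x. 1 / (real (Suc k) + x)) \<le> 1 / real n * (\<Sum>j<m. (W (n - 1) j)\<^sup>2)"
    by blast
qed

lemma mass_below_bounds:
  assumes "unit_density h" "x \<ge> 0"
  shows "0 \<le> mass_below h x" "mass_below h x \<le> pairing h (\<lambda>x. 1)"
proof -
  have "mass_below h 0 = 0"
    unfolding mass_below_def set_lebesgue_integral_def
    by (rule integral_eq_zero_AE) (rule eventually_mono[OF AE_lborel_singleton[of 0]], auto simp: indicator_def)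
  then show "0 \<le> mass_below h x" using mass_below_mono_Lipschitz(1)[OF assms(1) order_refl assms(2)] by simp
  show "mass_below h x \<le> pairing h (\<lambda>x. 1)" by (rule mass_below_mono_Lipschitz(3)[OF assms order_refl])
qed

text \<open>
  The Stieltjes transform of the density is measurable by its formula in terms of the matrix
  entries; \<open>stieltjes_measurability\<close> transfers this to the values of the diagram.
\<close>

lemma sup_distance_measurable:
  assumes \<alpha>: "\<alpha> \<ge> 1" and n: "n \<ge> 1"
    and meas: "\<And>i j. i < n \<Longrightarrow> j < m \<Longrightarrow> (\<lambda>\<omega>. V \<omega> i j) \<in> borel_measurable M"
  shows "(\<lambda>\<omega>. sup_distance \<alpha> (V \<omega>) n m) \<in> borel_measurable M"
proof -
  let ?h = "\<lambda>\<omega>. gram_density (V \<omega>) n m"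
  have kernel: "(\<lambda>\<omega>. pairing (?h \<omega>) (\<lambda>x. 1 / (s + x))) \<in> borel_measurable M" if s: "s > 0" for s
  proof -
    have "(\<lambda>\<omega>. zero_row (n - 1) (V \<omega>) a b) \<in> borel_measurable M" if "a < n" "b < m" for a b
      using meas[OF that] by (cases "a = n - 1") (simp_all add: zero_row_def)
    then have "(\<lambda>\<omega>. resolvent s (1 / real n) (zero_row (n - 1) (V \<omega>)) n m j k) \<in> borel_measurable M"
      if "j < m" "k < m" for j k by (rule resolvent_measurable) (use that in auto)
    then have "(\<lambda>\<omega>. leave_one_form s (1 / real n) (V \<omega>) n m (n - 1)) \<in> borel_measurable M"
      unfolding leave_one_form_def using n
      by (intro borel_measurable_times borel_measurable_const borel_measurable_sum meas) auto
    then show ?thesis unfolding gram_kernel[OF n s] by (intro borel_measurable_ln borel_measurable_add) auto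
  qed
  have mass: "(\<lambda>\<omega>. pairing (?h \<omega>) (\<lambda>x. 1)) \<in> borel_measurable M"
    by (rule stieltjes_measurability(1)) (use unit_density_gram[OF n] kernel in auto)
  have below: "(\<lambda>\<omega>. mass_below (?h \<omega>) x) \<in> borel_measurable M" if "x \<ge> 0" for x
    by (rule stieltjes_measurability(2)) (use unit_density_gram[OF n] kernel that in auto)
  let ?D = "\<lambda>\<omega>. rect_diagram (scaled_eigenvalues (1 / real n) (V \<omega>) n m) (scaled_eigenvalues (1 / real n) (V \<omega>) (n - 1) m)"
  have point: "(\<lambda>\<omega>. \<bar>?D \<omega> x - Omega \<alpha> x\<bar>) \<in> borel_measurable M" for x
  proof (cases "x \<ge> 0")
    case True
    show ?thesis
      unfolding interlacing_multisets.rect_diagram_nonneg[OF gram_interlacing[OF n] True]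
      by (intro borel_measurable_abs borel_measurable_diff borel_measurable_add borel_measurable_times
          borel_measurable_const mass below True)
  next
    case False
    then have x: "x < 0" by simp
    show ?thesis
      unfolding interlacing_multisets.rect_diagram_neg[OF gram_interlacing[OF n] x]
      by (intro borel_measurable_abs borel_measurable_diff borel_measurable_const mass)
  qed
  have bound: "\<bar>?D \<omega> x - Omega \<alpha> x\<bar> \<le> \<bar>pairing (?h \<omega>) (\<lambda>x. 1) - \<alpha>\<bar> + 2 * (pairing (?h \<omega>) (\<lambda>x. 1) + \<alpha>)" for \<omega> x
  proof (rule interlacing_multisets.diagram_distance[OF gram_interlacing[OF n] \<alpha>])
    fix x :: real assume "x \<ge> 0"
    note mass_below_bounds[OF unit_density_gram[OF n, of "V \<omega>" m] this]
      mass_below_bounds[OF unit_density_limit[OF \<alpha>] this, unfolded limit_mass[OF \<alpha>]]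
    then show "\<bar>mass_below (?h \<omega>) x - mass_below (limit_density \<alpha>) x\<bar> \<le> pairing (?h \<omega>) (\<lambda>x. 1) + \<alpha>"
      by linarith
  qed
  have "continuous_on UNIV (\<lambda>x. \<bar>?D \<omega> x - Omega \<alpha> x\<bar>)" for \<omega>
    using is_Omega_Omega[OF \<alpha>]
    by (intro continuous_intros continuous_rect_diagram) (auto simp: is_Omega_def)
  then have eq: "sup_distance \<alpha> (V \<omega>) n m = (SUP x\<in>\<rat>. \<bar>?D \<omega> x - Omega \<alpha> x\<bar>)" for \<omega>
    unfolding sup_distance_def by (rule SUP_rational[OF _ bound])
  show ?thesis
    unfolding eq
    by (rule borel_measurable_cSUP[OF countable_rat point], rule bdd_aboveI2, rule bound)
qed

lemma sup_distance_le:
  assumes \<alpha>: "\<alpha> \<ge> 1" and n: "n \<ge> 1"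
    and close: "\<forall>x\<ge>0. \<bar>mass_below (gram_density W n m) x - mass_below (limit_density \<alpha>) x\<bar> \<le> \<epsilon>"
  shows "0 \<le> sup_distance \<alpha> W n m"
    and "sup_distance \<alpha> W n m \<le> \<bar>pairing (gram_density W n m) (\<lambda>x. 1) - \<alpha>\<bar> + 2 * \<epsilon>"
proof -
  let ?D = "rect_diagram (scaled_eigenvalues (1 / real n) W n m) (scaled_eigenvalues (1 / real n) W (n - 1) m)"
  have bound: "\<bar>?D x - Omega \<alpha> x\<bar> \<le> \<bar>pairing (gram_density W n m) (\<lambda>x. 1) - \<alpha>\<bar> + 2 * \<epsilon>" for x
    using close by (intro interlacing_multisets.diagram_distance[OF gram_interlacing[OF n] \<alpha>]) auto
  show "sup_distance \<alpha> W n m \<le> \<bar>pairing (gram_density W n m) (\<lambda>x. 1) - \<alpha>\<bar> + 2 * \<epsilon>"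
    unfolding sup_distance_def by (rule cSUP_least, simp, rule bound)
  have "0 \<le> \<bar>?D 0 - Omega \<alpha> 0\<bar>" by simp
  also have "\<dots> \<le> sup_distance \<alpha> W n m"
    unfolding sup_distance_def by (rule cSUP_upper[OF UNIV_I], rule bdd_aboveI2, rule bound)
  finally show "0 \<le> sup_distance \<alpha> W n m" .
qed

context
  fixes M :: "nat \<Rightarrow> nat" and \<alpha> :: real and P :: "nat \<Rightarrow> 'a measure"
    and V :: "nat \<Rightarrow> 'a \<Rightarrow> nat \<Rightarrow> nat \<Rightarrow> real" and mom :: "nat \<Rightarrow> real"
  assumes M_lim: "(\<lambda>N. real (M N) / real N) \<longlonglongrightarrow> \<alpha>" and \<alpha>: "\<alpha> \<ge> 1"
    and prob: "\<And>N. N \<ge> 1 \<Longrightarrow> prob_space (P N)"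
    and indep: "\<And>N. N \<ge> 1 \<Longrightarrow>
      prob_space.indep_vars (P N) (\<lambda>_. borel) (\<lambda>(i, j) \<omega>. V N \<omega> i j) ({..<N} \<times> {..<M N})"
    and int: "\<And>N i j k. i < N \<Longrightarrow> j < M N \<Longrightarrow> integrable (P N) (\<lambda>\<omega>. V N \<omega> i j ^ k)"
    and mom: "\<And>N i j k. i < N \<Longrightarrow> j < M N \<Longrightarrow> integral\<^sup>L (P N) (\<lambda>\<omega>. V N \<omega> i j ^ k) = mom k"
    and mom1: "mom 1 = 0" and mom2: "mom 2 = 1"
begin

lemma bound_vanishes: "(\<lambda>N. (1 / real N)\<^sup>2 * (2 * (mom 4 + 1) * (real (M N) * c))) \<longlonglongrightarrow> 0"
proof -
  have "(\<lambda>N. 1 / real N) \<longlonglongrightarrow> 0" by real_asymp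
  then have "(\<lambda>N. (real (M N) / real N) * (1 / real N) * (2 * (mom 4 + 1) * c)) \<longlonglongrightarrow> \<alpha> * 0 * (2 * (mom 4 + 1) * c)"
    by (intro tendsto_intros M_lim)
  moreover have "(real (M N) / real N) * (1 / real N) * (2 * (mom 4 + 1) * c) = (1 / real N)\<^sup>2 * (2 * (mom 4 + 1) * (real (M N) * c))" for N
    by (simp add: power2_eq_square)
  ultimately show ?thesis by simp
qed

lemma deviation_moment:
  assumes N: "N \<ge> 1" and i: "i < N" and s: "s > 0"
  shows "integrable (P N) (\<lambda>\<omega>. (row_deviation s (V N \<omega>) N (M N) i)\<^sup>2)"
    and "integral\<^sup>L (P N) (\<lambda>\<omega>. (row_deviation s (V N \<omega>) N (M N) i)\<^sup>2)
      \<le> (1 / real N)\<^sup>2 * (2 * (mom 4 + 1) * (real (M N) * (1 / s)\<^sup>2))"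
proof -
  interpret prob_space "P N" by (rule prob[OF N])
  have \<kappa>: "1 / real N \<ge> 0" by simp
  show "integrable (P N) (\<lambda>\<omega>. (row_deviation s (V N \<omega>) N (M N) i)\<^sup>2)"
    "integral\<^sup>L (P N) (\<lambda>\<omega>. (row_deviation s (V N \<omega>) N (M N) i)\<^sup>2)
      \<le> (1 / real N)\<^sup>2 * (2 * (mom 4 + 1) * (real (M N) * (1 / s)\<^sup>2))"
    unfolding row_deviation_def
    by (rule leave_one_form_deviation[where w = "\<lambda>i j \<omega>. V N \<omega> i j", OF indep[OF N] int mom mom1 mom2 i s \<kappa>]; assumption)+
qed

lemma last_row_deviation:
  assumes s: "s > 0"
  shows "((\<lambda>z. (row_deviation s (V (fst z) (snd z)) (fst z) (M (fst z)) (fst z - 1))\<^sup>2) \<longlongrightarrow> 0) (whp P)"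
proof (rule markov_whp[OF _ bound_vanishes])
  show "\<forall>\<^sub>F N in sequentially. prob_space (P N) \<and> integrable (P N) (\<lambda>\<omega>. (row_deviation s (V N \<omega>) N (M N) (N - 1))\<^sup>2) \<and>
      (\<forall>\<omega>\<in>space (P N). 0 \<le> (row_deviation s (V N \<omega>) N (M N) (N - 1))\<^sup>2) \<and>
      (\<integral>\<omega>. (row_deviation s (V N \<omega>) N (M N) (N - 1))\<^sup>2 \<partial>P N)
        \<le> (1 / real N)\<^sup>2 * (2 * (mom 4 + 1) * (real (M N) * (1 / s)\<^sup>2))"
    (is "eventually ?Q _")
  proof (rule eventually_sequentiallyI[of 1])
    fix N :: nat assume N: "1 \<le> N"
    then have i: "N - 1 < N" by simp
    show "?Q N"
      by (intro conjI ballI zero_le_power2 prob[OF N] deviation_moment[OF N i s])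
  qed
qed

lemma mean_deviation:
  assumes s: "s > 0"
  shows "((\<lambda>z. (\<Sum>i<fst z. (row_deviation s (V (fst z) (snd z)) (fst z) (M (fst z)) i)\<^sup>2) / real (fst z)) \<longlongrightarrow> 0) (whp P)"
proof (rule markov_whp[OF _ bound_vanishes])
  show "\<forall>\<^sub>F N in sequentially. prob_space (P N) \<and>
      integrable (P N) (\<lambda>\<omega>. (\<Sum>i<N. (row_deviation s (V N \<omega>) N (M N) i)\<^sup>2) / real N) \<and>
      (\<forall>\<omega>\<in>space (P N). 0 \<le> (\<Sum>i<N. (row_deviation s (V N \<omega>) N (M N) i)\<^sup>2) / real N) \<and>
      (\<integral>\<omega>. (\<Sum>i<N. (row_deviation s (V N \<omega>) N (M N) i)\<^sup>2) / real N \<partial>P N)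
        \<le> (1 / real N)\<^sup>2 * (2 * (mom 4 + 1) * (real (M N) * (1 / s)\<^sup>2))"
    (is "eventually ?Q _")
  proof (rule eventually_sequentiallyI[of 1])
    fix N :: nat assume N: "1 \<le> N"
    define b where "b = (1 / real N)\<^sup>2 * (2 * (mom 4 + 1) * (real (M N) * (1 / s)\<^sup>2))"
    have i: "integrable (P N) (\<lambda>\<omega>. (row_deviation s (V N \<omega>) N (M N) i)\<^sup>2)" if "i < N" for i
      by (rule deviation_moment(1)[OF N that s])
    have "(\<integral>\<omega>. (\<Sum>i<N. (row_deviation s (V N \<omega>) N (M N) i)\<^sup>2) / real N \<partial>P N)
        = (\<Sum>i<N. \<integral>\<omega>. (row_deviation s (V N \<omega>) N (M N) i)\<^sup>2 \<partial>P N) / real N"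
      by (subst integral_divide_zero, subst Bochner_Integration.integral_sum) (use i in auto)
    also have "\<dots> \<le> (\<Sum>i<N. b) / real N"
      unfolding b_def by (intro divide_right_mono sum_mono deviation_moment(2)[OF N _ s]) auto
    also have "\<dots> = b" using N by simp
    finally have "(\<integral>\<omega>. (\<Sum>i<N. (row_deviation s (V N \<omega>) N (M N) i)\<^sup>2) / real N \<partial>P N) \<le> b" .
    moreover have "integrable (P N) (\<lambda>\<omega>. (\<Sum>i<N. (row_deviation s (V N \<omega>) N (M N) i)\<^sup>2) / real N)"
      by (intro integrable_divide_zero Bochner_Integration.integrable_sum i) auto
    ultimately show "?Q N"
      unfolding b_def by (intro conjI ballI prob[OF N] divide_nonneg_nonneg sum_nonneg zero_le_power2 of_nat_0_le_iff)
  qed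
qed

lemma inverse_vanishes: "((\<lambda>z. 1 / real (fst z)) \<longlongrightarrow> 0) (whp P)"
  by (rule tendsto_whp_sequentially) real_asymp

lemma ratio_tendsto: "((\<lambda>z. real (M (fst z)) / real (fst z)) \<longlongrightarrow> \<alpha>) (whp P)"
  by (rule tendsto_whp_sequentially[OF M_lim])

lemma eventually_positive: "eventually (\<lambda>z. fst z \<ge> 1) (whp P)"
  by (rule eventually_whp_sequentially) (auto intro: eventually_sequentiallyI[of 1])

text \<open>
  The form for the last row is close to the normalized trace, which is close to its limit; every random
  error term is controlled by a mean square deviation.
\<close>

lemma leave_one_form_tendsto:
  assumes s: "s > 0"
  shows "((\<lambda>z. leave_one_form s (1 / real (fst z)) (V (fst z) (snd z)) (fst z) (M (fst z)) (fst z - 1)) \<longlongrightarrow> mp_trace \<alpha> s) (whp P)"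
proof -
  let ?D = "\<lambda>z. row_deviation s (V (fst z) (snd z)) (fst z) (M (fst z))"
  let ?\<tau> = "\<lambda>z. leave_one_form s (1 / real (fst z)) (V (fst z) (snd z)) (fst z) (M (fst z)) (fst z - 1)"
  define err where "err = (\<lambda>z. (sqrt ((\<Sum>i<fst z. (?D z i)\<^sup>2) / real (fst z)) + 1 / real (fst z) * (1 / s)
      + \<bar>real (M (fst z)) / real (fst z) - \<alpha>\<bar>) / s + (sqrt ((?D z (fst z - 1))\<^sup>2) + 1 / real (fst z) * (1 / s)))"
  have "(err \<longlongrightarrow> (sqrt 0 + 0 * (1 / s) + \<bar>\<alpha> - \<alpha>\<bar>) / s + (sqrt 0 + 0 * (1 / s))) (whp P)"
    unfolding err_def using s
    by (intro tendsto_intros mean_deviation last_row_deviation inverse_vanishes ratio_tendsto) auto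
  then have "(err \<longlongrightarrow> 0) (whp P)" by simp
  moreover have "eventually (\<lambda>z. norm (?\<tau> z - mp_trace \<alpha> s) \<le> err z) (whp P)"
    using eventually_positive
  proof eventually_elim
    case (elim z)
    then have i: "fst z - 1 < fst z" by simp
    show ?case
      using leave_one_form_near_trace[OF s elim i, where W = "V (fst z) (snd z)" and m = "M (fst z)"]
        trace_near_limit[OF s elim \<alpha>, where W = "V (fst z) (snd z)" and m = "M (fst z)"]
      unfolding err_def real_norm_def real_sqrt_abs by linarith
  qed
  ultimately have "((\<lambda>z. ?\<tau> z - mp_trace \<alpha> s) \<longlongrightarrow> 0) (whp P)" by (rule Lim_null_comparison[rotated])
  then show ?thesis by (rule LIM_zero_cancel)
qed

abbreviation "sampled_density z \<equiv> gram_density (V (fst z) (snd z)) (fst z) (M (fst z))"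

lemma kernel_tendsto:
  assumes s: "s > 0"
  shows "((\<lambda>z. pairing (sampled_density z) (\<lambda>x. 1 / (s + x))) \<longlongrightarrow> pairing (limit_density \<alpha>) (\<lambda>x. 1 / (s + x))) (whp P)"
proof -
  have "1 + mp_trace \<alpha> s \<noteq> 0" using mp_trace_equation(1)[OF \<alpha> s] by simp
  then have "((\<lambda>z. ln (1 + leave_one_form s (1 / real (fst z)) (V (fst z) (snd z)) (fst z) (M (fst z)) (fst z - 1)))
      \<longlongrightarrow> ln (1 + mp_trace \<alpha> s)) (whp P)"
    by (intro tendsto_intros leave_one_form_tendsto s)
  then show ?thesis
    unfolding limit_stieltjes[OF \<alpha> s]
    by (rule Lim_transform_eventually)
       (rule eventually_mono[OF eventually_positive], rule gram_kernel[OF _ s, symmetric], assumption)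
qed

lemma last_row_norm:
  "((\<lambda>z. (1 / real (fst z) * (\<Sum>j<M (fst z). (V (fst z) (snd z) (fst z - 1) j)\<^sup>2)
      - 1 / real (fst z) * real (M (fst z)))\<^sup>2) \<longlongrightarrow> 0) (whp P)"
proof (rule markov_whp[OF _ bound_vanishes[of "1\<^sup>2"]])
  let ?Z = "\<lambda>N \<omega>. (1 / real N * (\<Sum>j<M N. (V N \<omega> (N - 1) j)\<^sup>2) - 1 / real N * real (M N))\<^sup>2"
  show "\<forall>\<^sub>F N in sequentially. prob_space (P N) \<and> integrable (P N) (?Z N) \<and> (\<forall>\<omega>\<in>space (P N). 0 \<le> ?Z N \<omega>) \<and>
      integral\<^sup>L (P N) (?Z N) \<le> (1 / real N)\<^sup>2 * (2 * (mom 4 + 1) * (real (M N) * 1\<^sup>2))"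
    (is "eventually ?Q _")
  proof (rule eventually_sequentiallyI[of 1])
    fix N :: nat assume N: "1 \<le> N"
    then have i: "N - 1 < N" by simp
    interpret prob_space "P N" by (rule prob[OF N])
    have "integrable (P N) (?Z N)" "integral\<^sup>L (P N) (?Z N) \<le> (1 / real N)\<^sup>2 * (2 * (mom 4 + 1) * (real (M N) * 1\<^sup>2))"
      by (rule row_norm_deviation[where w = "\<lambda>i j \<omega>. V N \<omega> i j", OF indep[OF N] int mom mom1 mom2 i]; assumption)+
    then show "?Q N"
      using prob[OF N] by simp
  qed
qed

text \<open>
  From below the mass is bounded by \<open>s\<close> times the Stieltjes transform at \<open>s\<close>, whose limit is close to \<open>\<alpha>\<close>
  for large \<open>s\<close>. From above it is bounded by the normalized squared length of the last row, which
  tends to \<open>\<alpha>\<close> by the law of large numbers.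
\<close>

lemma mass_tendsto: "((\<lambda>z. pairing (sampled_density z) (\<lambda>x. 1)) \<longlongrightarrow> \<alpha>) (whp P)"
proof (rule order_tendstoI)
  fix a assume a: "a < \<alpha>"
  have "(\<lambda>n. real (Suc n) * pairing (limit_density \<alpha>) (\<lambda>x. 1 / (real (Suc n) + x))) \<longlonglongrightarrow> \<alpha>"
    using kernel_tendsto_total[OF unit_density_limit[OF \<alpha>]] by (simp add: limit_mass[OF \<alpha>])
  then have "\<forall>\<^sub>F n in sequentially. a < real (Suc n) * pairing (limit_density \<alpha>) (\<lambda>x. 1 / (real (Suc n) + x))"
    using a by (rule order_tendstoD)
  then obtain n where "a < real (Suc n) * pairing (limit_density \<alpha>) (\<lambda>x. 1 / (real (Suc n) + x))"
    by (auto simp: eventually_sequentially)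
  then obtain s where s: "s > 0" "a < s * pairing (limit_density \<alpha>) (\<lambda>x. 1 / (s + x))"
    by (metis of_nat_0_less_iff zero_less_Suc)
  have "((\<lambda>z. s * pairing (sampled_density z) (\<lambda>x. 1 / (s + x))) \<longlongrightarrow> s * pairing (limit_density \<alpha>) (\<lambda>x. 1 / (s + x))) (whp P)"
    by (intro tendsto_intros kernel_tendsto s)
  then have "eventually (\<lambda>z. a < s * pairing (sampled_density z) (\<lambda>x. 1 / (s + x))) (whp P)"
    using s(2) by (rule order_tendstoD)
  then show "eventually (\<lambda>z. a < pairing (sampled_density z) (\<lambda>x. 1)) (whp P)"
    using eventually_positive
  proof eventually_elim
    case (elim z)
    then show ?case using kernel_le_mass[OF unit_density_gram[OF elim(2)] s(1)] less_le_trans by blast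
  qed
next
  fix a assume a: "\<alpha> < a"
  define R where "R = (\<lambda>z. 1 / real (fst z) * (\<Sum>j<M (fst z). (V (fst z) (snd z) (fst z - 1) j)\<^sup>2))"
  define r where "r = (\<lambda>z :: nat \<times> 'a. 1 / real (fst z) * real (M (fst z)))"
  have "((\<lambda>z. sqrt ((R z - r z)\<^sup>2)) \<longlongrightarrow> sqrt 0) (whp P)"
    unfolding R_def r_def by (intro tendsto_intros last_row_norm)
  then have "((\<lambda>z. R z - r z) \<longlongrightarrow> 0) (whp P)" by (simp add: tendsto_rabs_zero_iff)
  moreover have "(r \<longlongrightarrow> \<alpha>) (whp P)" using ratio_tendsto unfolding r_def by simp
  ultimately have "((\<lambda>z. (R z - r z) + r z) \<longlongrightarrow> 0 + \<alpha>) (whp P)" by (rule tendsto_add)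
  then have "(R \<longlongrightarrow> \<alpha>) (whp P)" by simp
  then have "eventually (\<lambda>z. R z < a) (whp P)" using a by (rule order_tendstoD)
  then show "eventually (\<lambda>z. pairing (sampled_density z) (\<lambda>x. 1) < a) (whp P)"
    using eventually_positive
  proof eventually_elim
    case (elim z)
    then show ?case using gram_mass_le[OF elim(2), where W = "V (fst z) (snd z)" and m = "M (fst z)"] by (simp add: R_def)
  qed
qed

lemma sup_distance_tendsto: "((\<lambda>z. sup_distance \<alpha> (V (fst z) (snd z)) (fst z) (M (fst z))) \<longlongrightarrow> 0) (whp P)"
proof (rule tendstoI)
  fix e :: real assume e: "e > 0"
  have dens: "eventually (\<lambda>z. unit_density (sampled_density z)) (whp P)"
    using eventually_positive by eventually_elim (rule unit_density_gram)
  have mass: "((\<lambda>z. pairing (sampled_density z) (\<lambda>x. 1)) \<longlongrightarrow> pairing (limit_density \<alpha>) (\<lambda>x. 1)) (whp P)"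
    using mass_tendsto by (simp add: limit_mass[OF \<alpha>])
  have "eventually (\<lambda>z. \<forall>x\<ge>0. \<bar>mass_below (sampled_density z) x - mass_below (limit_density \<alpha>) x\<bar> \<le> e / 4) (whp P)"
    by (rule stieltjes_continuity[OF dens unit_density_limit[OF \<alpha>] mass kernel_tendsto]) (use e in auto)
  moreover have "eventually (\<lambda>z. dist (pairing (sampled_density z) (\<lambda>x. 1)) \<alpha> < e / 4) (whp P)"
    using mass_tendsto e by (intro tendstoD) auto
  ultimately show "eventually (\<lambda>z. dist (sup_distance \<alpha> (V (fst z) (snd z)) (fst z) (M (fst z))) 0 < e) (whp P)"
    using eventually_positive
  proof eventually_elim
    case (elim z)
    show ?case
      using sup_distance_le[OF \<alpha> elim(3) elim(1)] elim(2) e unfolding dist_real_def by linarith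
  qed
qed

theorem sup_distance_in_prob: "tendsto_in_prob P (\<lambda>N \<omega>. sup_distance \<alpha> (V N \<omega>) N (M N)) 0"
proof (rule tendsto_in_prob_whp)
  show "\<forall>\<^sub>F N in sequentially. prob_space (P N)" by (rule eventually_sequentiallyI[of 1]) (rule prob)
  show "\<forall>\<^sub>F N in sequentially. (\<lambda>\<omega>. sup_distance \<alpha> (V N \<omega>) N (M N)) \<in> borel_measurable (P N)"
  proof (rule eventually_sequentiallyI[of 1])
    fix N :: nat assume N: "1 \<le> N"
    interpret prob_space "P N" by (rule prob[OF N])
    show "(\<lambda>\<omega>. sup_distance \<alpha> (V N \<omega>) N (M N)) \<in> borel_measurable (P N)"
    proof (rule sup_distance_measurable[OF \<alpha> N])
      fix i j assume "i < N" "j < M N"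
      then show "(\<lambda>\<omega>. V N \<omega> i j) \<in> borel_measurable (P N)"
        using indep[OF N] by (auto simp: indep_vars_def)
    qed
  qed
  show "((\<lambda>z. sup_distance \<alpha> (V (fst z) (snd z)) (fst z) (M (fst z))) \<longlongrightarrow> 0) (whp P)"
    by (rule sup_distance_tendsto)
qed

end

theorem theorem2:
  fixes M :: "nat \<Rightarrow> nat" and \<alpha> :: real
    and P :: "nat \<Rightarrow> 'a measure" and W :: "nat \<Rightarrow> 'a \<Rightarrow> real mat" and \<mu> :: "real measure"
  assumes M_pos: "\<And>N. N \<ge> 1 \<Longrightarrow> M N > 0"
    and M_lim: "(\<lambda>N. real (M N) / real N) \<longlonglongrightarrow> \<alpha>"
    and \<alpha>_ge: "\<alpha> \<ge> 1"
    and prob: "\<And>N. N \<ge> 1 \<Longrightarrow> prob_space (P N)"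
    and dim: "\<And>N \<omega>. N \<ge> 1 \<Longrightarrow> \<omega> \<in> space (P N) \<Longrightarrow> W N \<omega> \<in> carrier_mat N (M N)"
    and indep: "\<And>N. N \<ge> 1 \<Longrightarrow>
      prob_space.indep_vars (P N) (\<lambda>_. borel) (\<lambda>(i, j) \<omega>. W N \<omega> $$ (i, j))
        ({..<N} \<times> {..<M N})"
    and law: "\<And>N i j. N \<ge> 1 \<Longrightarrow> i < N \<Longrightarrow> j < M N \<Longrightarrow>
      distr (P N) borel (\<lambda>\<omega>. W N \<omega> $$ (i, j)) = \<mu>"
    and mean: "prob_space.expectation \<mu> (\<lambda>t. t) = 0"
    and var: "prob_space.variance \<mu> (\<lambda>t. t) = 1"
    and moments: "\<And>k::nat. k \<ge> 1 \<Longrightarrow> integrable \<mu> (\<lambda>t. \<bar>t\<bar> ^ k)"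
  shows "tendsto_in_prob P
    (\<lambda>N \<omega>.
      let Y = W N \<omega> * transpose_mat (W N \<omega>);
          Y' = mat_delete Y (N - 1) (N - 1);
          w = rect_diagram (eigenvalues_mset Y) (eigenvalues_mset Y')
      in SUP x. \<bar>1 / real N * w (x * real N) - Omega \<alpha> x\<bar>)
    0"
proof -
  let ?V = "\<lambda>N \<omega> i j. W N \<omega> $$ (i, j)"
  let ?X = "\<lambda>N \<omega>. let Y = W N \<omega> * transpose_mat (W N \<omega>);
          Y' = mat_delete Y (N - 1) (N - 1);
          w = rect_diagram (eigenvalues_mset Y) (eigenvalues_mset Y')
      in SUP x. \<bar>1 / real N * w (x * real N) - Omega \<alpha> x\<bar>"
  define mom where "mom = (\<lambda>k. integral\<^sup>L \<mu> (\<lambda>t. t ^ k))"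
  have meas: "(\<lambda>\<omega>. ?V N \<omega> i j) \<in> borel_measurable (P N)" if "i < N" "j < M N" for N i j
  proof -
    have N: "N \<ge> 1" using that by simp
    interpret prob_space "P N" by (rule prob[OF N])
    show ?thesis using indep[OF N] that by (auto simp: indep_vars_def)
  qed
  have law': "distr (P N) borel (\<lambda>\<omega>. ?V N \<omega> i j) = \<mu>" if "i < N" "j < M N" for N i j
    using law[OF _ that] that by simp
  have pow: "integrable \<mu> (\<lambda>t. t ^ k)" for k
  proof (cases "k = 0")
    case True
    have M1: "(0 :: nat) < 1" "0 < M 1" using M_pos by auto
    interpret prob_space "P 1" by (rule prob) simp
    have "prob_space \<mu>" using prob_space_distr[OF meas[OF M1]] law'[OF M1] by simp
    then show ?thesis using True by (simp add: prob_space_def finite_measure.integrable_const)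
  next
    case False
    have M1: "(0 :: nat) < 1" "0 < M 1" using M_pos by auto
    have sets: "sets \<mu> = sets borel" using law'[OF M1] by (metis sets_distr)
    have m: "(\<lambda>t. t ^ k) \<in> borel_measurable \<mu>" unfolding measurable_cong_sets[OF sets refl] by measurable
    have "k \<ge> 1" using False by simp
    then have "integrable \<mu> (\<lambda>t. norm (t ^ k))" unfolding real_norm_def power_abs by (rule moments)
    then show ?thesis using m by (rule integrable_norm_cancel)
  qed
  have int: "integrable (P N) (\<lambda>\<omega>. ?V N \<omega> i j ^ k)" if "i < N" "j < M N" for N i j k
    using integrable_distr_eq[OF meas[OF that], of "\<lambda>t. t ^ k"] pow[of k] law'[OF that] by simp
  have mom: "integral\<^sup>L (P N) (\<lambda>\<omega>. ?V N \<omega> i j ^ k) = mom k" if "i < N" "j < M N" for N i j k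
    using integral_distr[OF meas[OF that], of "\<lambda>t. t ^ k"] law'[OF that] by (simp add: mom_def)
  have mom1: "mom 1 = 0" "mom 2 = 1" using mean var by (simp_all add: mom_def)
  have lim: "tendsto_in_prob P (\<lambda>N \<omega>. sup_distance \<alpha> (?V N \<omega>) N (M N)) 0"
    by (rule sup_distance_in_prob[OF M_lim \<alpha>_ge prob indep int mom mom1]; assumption)
  have eq: "?X N \<omega> = sup_distance \<alpha> (?V N \<omega>) N (M N)" if "N \<ge> 1" "\<omega> \<in> space (P N)" for N \<omega>
    by (rule sup_distance_eq[OF dim[OF that] that(1)])
  show ?thesis
    unfolding tendsto_in_prob_def
  proof (intro conjI allI impI)
    have "\<forall>\<^sub>F N in sequentially. (\<lambda>\<omega>. sup_distance \<alpha> (?V N \<omega>) N (M N)) \<in> borel_measurable (P N)"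
      using lim by (simp add: tendsto_in_prob_def)
    then show "\<forall>\<^sub>F N in sequentially. ?X N \<in> borel_measurable (P N)"
      using eventually_ge_at_top[of 1]
      by eventually_elim (simp only: measurable_cong[OF eq])
    fix \<epsilon> :: real assume "\<epsilon> > 0"
    then have "(\<lambda>N. measure (P N) {\<omega>\<in>space (P N). \<bar>sup_distance \<alpha> (?V N \<omega>) N (M N) - 0\<bar> > \<epsilon>}) \<longlonglongrightarrow> 0"
      using lim by (simp add: tendsto_in_prob_def)
    moreover have "\<forall>\<^sub>F N in sequentially. measure (P N) {\<omega>\<in>space (P N). \<bar>sup_distance \<alpha> (?V N \<omega>) N (M N) - 0\<bar> > \<epsilon>}
        = measure (P N) {\<omega>\<in>space (P N). \<bar>?X N \<omega> - 0\<bar> > \<epsilon>}"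
      using eventually_ge_at_top[of 1]
    proof eventually_elim
      case (elim N)
      show ?case by (intro arg_cong[of _ _ "measure (P N)"] Collect_cong conj_cong refl) (simp only: eq[OF elim])
    qed
    ultimately show "(\<lambda>N. measure (P N) {\<omega>\<in>space (P N). \<bar>?X N \<omega> - 0\<bar> > \<epsilon>}) \<longlonglongrightarrow> 0"
      by (rule Lim_transform_eventually)
  qed
qed

end
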